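(* ($L^{\mathrm p}(\mathbb Q_p)$-improving estimate.) Let $p$ be a prime, let $m\in\mathbb Z_+$ with $m\ge2$, and let $\mathcal P=\{P_1,\dots,P_m\}\subset\mathbb Q_p[\mathrm y]$ be polynomials with degrees $d_i=\deg P_i$ satisfying $1\le d_1\le d_2\le\cdots\le d_m$ and $d_m\ge2$. Let $1<p_1,\dots,p_m<\infty$ and define $$\frac1{p_*}:=\frac1{p_1}+\cdots+\frac1{p_m},\qquad K:=\frac{d_1}{p_1}+\cdots+\frac{d_m}{p_m},\qquad q_{*,K}:=\begin{cases}\infty&\text{if }K\le1,\\ d_m/(K-1)&\text{if }K>1.\end{cases}$$ Suppose $1\le p_*<\infty$ and $$\frac{d_1}{p_1}+\cdots+\frac{d_{m-1}}{p_{m-1}}<1.$$ Then the bound $$\|A(f_1,\dots,f_m)\|_{L^q(\mathbb Q_p)}\lesssim_{\mathcal P}\|f_1\|_{L^{p_1}(\mathbb Q_p)}\cdots\|f_m\|_{L^{p_m}(\mathbb Q_p)}$$ holds for all $p_*\le q<q_{*,K}$, with an implicit constant that does not depend on the prime $p$, where $$A(f_1,\dots,f_m)(x):=\int_{\mathbb Z_p}f_1(x-P_1(y))\cdots f_m(x-P_m(y))\,d\nu(y),\qquad x\in\mathbb Q_p.$$ Furthermore, if $K<1$, or if $K>1$ and $p_*>1$, then the bound holds for $p_*\le q\le q_{*,K}$.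
   Context: $\mathbb Q_p$ is the field of $p$-adic numbers, $\mathbb Z_p$ its ring of integers (the closed unit ball), and $\nu$ is Haar measure on $\mathbb Q_p$ normalized so that $\nu(\mathbb Z_p)=1$. The functions $f_i$ range over $L^{p_i}(\mathbb Q_p)$. The implicit constant may depend on the polynomials $\mathcal P$ and on the exponents, but not on $p$ itself. *)

theory Defs
  imports "HOL-Probability.Probability" "HOL-Algebra.QuotRing" "HOL-Algebra.Polynomials"
begin

section \<open>The field of p-adic numbers\<close>

text \<open>
  The constant in the theorem is uniform in the prime, so all the fields of p-adic numbers have to
  live on one type.  For each prime, the field is a \<^typ>\<open>(nat \<Rightarrow> rat) set ring\<close>: the completion of
  the rationals, i.e. the ring of p-adic Cauchy sequences modulo the ideal of p-adic null sequences.
\<close>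

definition rat_padic_abs :: "nat \<Rightarrow> rat \<Rightarrow> real" where
  "rat_padic_abs p x =
     (if x = 0 then 0
      else real p powi (int (multiplicity (int p) (snd (quotient_of x)))
                      - int (multiplicity (int p) (fst (quotient_of x)))))"

definition padic_Cauchy :: "nat \<Rightarrow> (nat \<Rightarrow> rat) \<Rightarrow> bool" where
  "padic_Cauchy p s \<longleftrightarrow>
     (\<forall>e>0. \<exists>N. \<forall>i\<ge>N. \<forall>j\<ge>N. rat_padic_abs p (s i - s j) < e)"

definition padic_Cauchy_ring :: "nat \<Rightarrow> (nat \<Rightarrow> rat) ring" where
  "padic_Cauchy_ring p =
     \<lparr>carrier = {s. padic_Cauchy p s},
      mult = (\<lambda>s t i. s i * t i), one = (\<lambda>i. 1),
      zero = (\<lambda>i. 0), add = (\<lambda>s t i. s i + t i)\<rparr>"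

definition padic_null :: "nat \<Rightarrow> (nat \<Rightarrow> rat) set" where
  "padic_null p = {s. (\<lambda>i. rat_padic_abs p (s i)) \<longlonglongrightarrow> 0}"

definition Qp :: "nat \<Rightarrow> (nat \<Rightarrow> rat) set ring" where
  "Qp p = padic_Cauchy_ring p Quot padic_null p"

text \<open>An element \<open>x\<close> of \<^term>\<open>Qp p\<close> is a coset; all its representatives have the same limit.\<close>

definition padic_abs :: "nat \<Rightarrow> (nat \<Rightarrow> rat) set \<Rightarrow> real" where
  "padic_abs p x = (THE r. \<forall>s\<in>x. (\<lambda>i. rat_padic_abs p (s i)) \<longlonglongrightarrow> r)"

definition Zp :: "nat \<Rightarrow> (nat \<Rightarrow> rat) set set" where
  "Zp p = {x \<in> carrier (Qp p). padic_abs p x \<le> 1}"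

definition padic_open :: "nat \<Rightarrow> (nat \<Rightarrow> rat) set set \<Rightarrow> bool" where
  "padic_open p U \<longleftrightarrow> U \<subseteq> carrier (Qp p) \<and>
     (\<forall>x\<in>U. \<exists>e>0. \<forall>y\<in>carrier (Qp p). padic_abs p (y \<ominus>\<^bsub>Qp p\<^esub> x) < e \<longrightarrow> y \<in> U)"

definition padic_borel :: "nat \<Rightarrow> (nat \<Rightarrow> rat) set measure" where
  "padic_borel p = sigma (carrier (Qp p)) {U. padic_open p U}"

text \<open>
  Finiteness on compact sets need not be demanded: it follows from invariance, as the compact open
  set \<^term>\<open>Zp p\<close> has measure 1.  Regularity is automatic, and these conditions determine \<open>\<nu>\<close>.
\<close>

definition normalized_haar :: "nat \<Rightarrow> (nat \<Rightarrow> rat) set measure \<Rightarrow> bool" where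
  "normalized_haar p \<nu> \<longleftrightarrow>
     space \<nu> = carrier (Qp p) \<and> sets \<nu> = sets (padic_borel p) \<and>
     (\<forall>a\<in>carrier (Qp p). \<forall>E\<in>sets \<nu>. emeasure \<nu> ((\<lambda>x. a \<oplus>\<^bsub>Qp p\<^esub> x) ` E) = emeasure \<nu> E) \<and>
     emeasure \<nu> (Zp p) = 1"


section \<open>Lebesgue norms\<close>

definition Lnorm :: "'a measure \<Rightarrow> ereal \<Rightarrow> ('a \<Rightarrow> complex) \<Rightarrow> ennreal" where
  "Lnorm M q f =
     (if q = \<infinity> then esssup M (\<lambda>x. ennreal (cmod (f x)))
      else let I = (\<integral>\<^sup>+x. ennreal (cmod (f x) powr real_of_ereal q) \<partial>M)
           in if I = \<infinity> then \<infinity> else ennreal (enn2real I powr (1 / real_of_ereal q)))"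

definition Lspace :: "'a measure \<Rightarrow> ereal \<Rightarrow> ('a \<Rightarrow> complex) set" where
  "Lspace M q = {f \<in> borel_measurable M. Lnorm M q f < \<infinity>}"


section \<open>The multilinear average and the exponents\<close>

definition avg_integrand ::
  "nat \<Rightarrow> nat \<Rightarrow> (nat \<Rightarrow> (nat \<Rightarrow> rat) set list) \<Rightarrow> (nat \<Rightarrow> (nat \<Rightarrow> rat) set \<Rightarrow> complex)
    \<Rightarrow> (nat \<Rightarrow> rat) set \<Rightarrow> (nat \<Rightarrow> rat) set \<Rightarrow> complex" where
  "avg_integrand p m P f x y = (\<Prod>i=1..m. f i (x \<ominus>\<^bsub>Qp p\<^esub> ring.eval (Qp p) (P i) y))"

definition avg ::
  "nat \<Rightarrow> (nat \<Rightarrow> rat) set measure \<Rightarrow> nat \<Rightarrow> (nat \<Rightarrow> (nat \<Rightarrow> rat) set list)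
    \<Rightarrow> (nat \<Rightarrow> (nat \<Rightarrow> rat) set \<Rightarrow> complex) \<Rightarrow> (nat \<Rightarrow> rat) set \<Rightarrow> complex" where
  "avg p \<nu> m P f x = (LINT y:Zp p|\<nu>. avg_integrand p m P f x y)"

definition p_star :: "nat \<Rightarrow> (nat \<Rightarrow> real) \<Rightarrow> real" where
  "p_star m r = 1 / (\<Sum>i=1..m. 1 / r i)"

definition K_exp :: "nat \<Rightarrow> (nat \<Rightarrow> nat) \<Rightarrow> (nat \<Rightarrow> real) \<Rightarrow> real" where
  "K_exp m d r = (\<Sum>i=1..m. real (d i) / r i)"

definition q_star :: "nat \<Rightarrow> (nat \<Rightarrow> nat) \<Rightarrow> (nat \<Rightarrow> real) \<Rightarrow> ereal" where
  "q_star m d r =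
     (if K_exp m d r \<le> 1 then \<infinity> else ereal (real (d m) / (K_exp m d r - 1)))"

text \<open>
  Polynomials are coefficient lists with the leading coefficient first.  For different primes the
  polynomials lie in different rings, so ``a constant depending on the polynomials but not on the
  prime'' is read as: a constant depending on the polynomials only through their number, their
  degrees and a bound \<open>B\<close> for the size of their data, namely an upper bound for the absolute values
  of the coefficients and for the inverse absolute values of the leading coefficients.  (The bound
  cannot be dropped: scaling the polynomials changes the best constant.)  Any given tuple of
  polynomials satisfies this for some \<open>B\<close>, and a given tuple of polynomials with rational
  coefficients satisfies it for one \<open>B\<close> and all primes simultaneously.
\<close>

definition admissible_polys ::
  "nat \<Rightarrow> nat \<Rightarrow> (nat \<Rightarrow> nat) \<Rightarrow> real \<Rightarrow> (nat \<Rightarrow> (nat \<Rightarrow> rat) set list) \<Rightarrow> bool" where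
  "admissible_polys p m d B P \<longleftrightarrow>
     (\<forall>i\<in>{1..m}. P i \<in> carrier (univ_poly (Qp p) (carrier (Qp p))) \<and> Polynomials.degree (P i) = d i \<and>
        (\<forall>c\<in>set (P i). padic_abs p c \<le> B) \<and> 1 / B \<le> padic_abs p (Polynomials.lead_coeff (P i)))"

text \<open>
  The Bochner integral is 0 by convention for a non-integrable integrand, so the requirement that
  \<^const>\<open>avg\<close> be given by a convergent integral almost everywhere is made explicit.
\<close>

definition improving_bound ::
  "nat \<Rightarrow> (nat \<Rightarrow> nat) \<Rightarrow> (nat \<Rightarrow> real) \<Rightarrow> ereal \<Rightarrow> bool" where
  "improving_bound m d r q \<longleftrightarrow>
     (\<forall>B>0. \<exists>C\<ge>0. \<forall>p \<nu> P f.
        Factorial_Ring.prime p \<longrightarrow> normalized_haar p \<nu> \<longrightarrow> admissible_polys p m d B P \<longrightarrow>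
        (\<forall>i\<in>{1..m}. f i \<in> Lspace \<nu> (ereal (r i))) \<longrightarrow>
        (AE x in \<nu>. set_integrable \<nu> (Zp p) (avg_integrand p m P f x)) \<and>
        avg p \<nu> m P f \<in> borel_measurable \<nu> \<and>
        Lnorm \<nu> q (avg p \<nu> m P f) \<le> ennreal C * (\<Prod>i=1..m. Lnorm \<nu> (ereal (r i)) (f i)))"

end

theory Submission
  imports Defs
begin

text \<open>
The estimate is homogeneous in each function, so the absolute values \<open>F i\<close> of the functions may be
taken with norm at most 1; dividing by any number larger than the norm and letting it tend to the
norm avoids a separate treatment of functions of norm 0.  Let \<open>u\<close> be the absolute value of the
average.  At the exponent \<open>p_star\<close>, the bound with constant 1 follows from Jensen's inequality,
the weighted inequality of arithmetic and geometric means and translation invariance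
(\<open>trivial_bound\<close>).  If a bound at some larger exponent \<open>q1\<close> is known as well, then all exponents
between them follow from \<open>u powr q \<le> u powr p_star + u powr q1\<close>.  So only large exponents matter.

The gain in integrability comes from the integration in \<open>y\<close>, and it is weakest near the critical points
of the polynomials.  Cut the unit ball into sets \<open>S k\<close>, on which every derivative \<open>P\<^sub>i'\<close> is at least about
\<open>2 powr (- k * (d i - 1))\<close> in absolute value, while some derivative is not much larger than that.
Two facts hold with constants independent of the prime: the measure of \<open>S k\<close> is \<open>O(2 powr - k)\<close>
(\<open>sublevel_estimate\<close>), and the map \<open>y \<mapsto> x - P\<^sub>i(y)\<close> pushes the measure on \<open>S k\<close> forward to a measure
bounded by \<open>O(2 powr (k * (d i - 1)))\<close> times Haar measure (\<open>transport_le\<close>).  Together with translation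
invariance these facts are the assumptions of the locale \<open>averaging_family\<close>, in which the analysis is
carried out.

Apply Hoelder's inequality in \<open>y\<close> on \<open>S k\<close> with the exponents \<open>r 1, ..., r m\<close>; this is possible because
\<open>p_star \<ge> 1\<close>.  The first \<open>m - 1\<close> factors are bounded uniformly in \<open>x\<close>.  The last factor is controlled
both in \<open>L\<close>-infinity and, after integration in \<open>x\<close>, in \<open>L\<close> with exponent \<open>r m\<close>, hence for all \<open>q \<ge> r m\<close>.
Altogether the contribution of \<open>S k\<close> has \<open>q\<close>-norm \<open>O(2 powr (k * (K - 1 - d m / q)))\<close>.  This is summable
precisely for \<open>q < q_star\<close>, and the hypothesis on the first \<open>m - 1\<close> exponents says precisely that
\<open>r m < q_star\<close>, so that the condition \<open>q \<ge> r m\<close> is harmless (\<open>subcritical_bound\<close>).  If \<open>K < 1\<close>, the same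
works for \<open>q = \<infinity>\<close> (\<open>sup_bound\<close>).

At the endpoint \<open>q = d m / (K - 1)\<close> the contributions of the scales no longer decay.  But if
\<open>p_star > 1\<close>, Hoelder's inequality can also be used with an exponent \<open>s < r m\<close> for the last function,
and \<open>critical_bound\<close> gets the strong bound by a real interpolation argument carried out at each point:
some scale \<open>k\<close> carries the value \<open>u\<close> up to a factor growing slowly with the distance of \<open>k\<close> from a
scale fixed by \<open>u\<close>; the scales on one side are excluded by the uniform bound, and on the other side
the values of \<open>F m\<close> below a threshold fixed by \<open>u\<close> contribute too little.  This leaves \<open>u powr q\<close> bounded by a
sum over \<open>k\<close> of weighted integrals of \<open>F m powr s\<close>, and after integration in \<open>x\<close> the weights form a geometric
series that decays in both directions from the scale given by the size of \<open>F m\<close>, with sum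
\<open>O(F m powr r m)\<close>.

Both p-adic facts rest on synthetic division, \<open>Q(y) - Q(z) = (y - z) R(y)\<close> with \<open>R\<close> of smaller degree and
the same leading coefficient, which replaces factorization over an algebraic closure.  Uniformity in
the prime comes from two observations: the part of the unit ball in a ball of radius \<open>\<rho>\<close> has measure
at most \<open>\<rho>\<close> whatever the prime, and the factor \<open>n\<close> by which differentiation multiplies a leading
coefficient has absolute value at least \<open>1 / n\<close>.
\<close>

section \<open>Hoelder's inequality and two-sided geometric sums\<close>

lemma weighted_AM_GM:
  fixes x w :: "'i \<Rightarrow> real"
  assumes "finite I" and w: "\<And>i. i \<in> I \<Longrightarrow> 0 \<le> w i" and x: "\<And>i. i \<in> I \<Longrightarrow> 0 \<le> x i"
    and sum1: "(\<Sum>i\<in>I. w i) = 1"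
  shows "(\<Prod>i\<in>I. x i powr w i) \<le> (\<Sum>i\<in>I. w i * x i)"
proof (cases "\<exists>i\<in>I. x i = 0")
  case True
  then have "(\<Prod>i\<in>I. x i powr w i) = 0"
    using assms(1) by (auto intro!: prod_zero)
  then show ?thesis
    using w x by (simp add: sum_nonneg)
next
  case False
  have "I \<noteq> {}" using sum1 by auto
  have "(\<Prod>i\<in>I. x i powr w i) = exp (\<Sum>i\<in>I. w i * ln (x i))"
    using False assms(1) by (simp add: exp_sum powr_def)
  also have "\<dots> \<le> (\<Sum>i\<in>I. w i * exp (ln (x i)))"
    using convex_on_sum[OF assms(1) \<open>I \<noteq> {}\<close> exp_convex sum1, of "\<lambda>i. ln (x i)"] w by simp
  also have "\<dots> = (\<Sum>i\<in>I. w i * x i)"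
    using False x by (intro sum.cong) (auto simp: less_le)
  finally show ?thesis .
qed

text \<open>
Hoelder's inequality for finitely many functions, in terms of upper bounds \<open>a i\<close> for the integrals
instead of the integrals themselves: dividing each \<open>G i\<close> by \<open>a i\<close> reduces it to the pointwise inequality
of arithmetic and geometric means, and no powers of extended reals occur.
\<close>

lemma nn_integral_prod_powr_le:
  fixes G :: "'i \<Rightarrow> 'a \<Rightarrow> real" and w a :: "'i \<Rightarrow> real"
  assumes "finite I" and w: "\<And>i. i \<in> I \<Longrightarrow> 0 \<le> w i" and sum1: "(\<Sum>i\<in>I. w i) = 1"
    and G[measurable]: "\<And>i. i \<in> I \<Longrightarrow> G i \<in> borel_measurable M"
    and G0: "\<And>i x. i \<in> I \<Longrightarrow> 0 \<le> G i x"
    and a: "\<And>i. i \<in> I \<Longrightarrow> 0 \<le> a i"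
    and Ga: "\<And>i. i \<in> I \<Longrightarrow> (\<integral>\<^sup>+x. ennreal (G i x) \<partial>M) \<le> ennreal (a i)"
  shows "(\<integral>\<^sup>+x. ennreal (\<Prod>i\<in>I. G i x powr w i) \<partial>M) \<le> ennreal (\<Prod>i\<in>I. a i powr w i)"
proof (cases "\<exists>i\<in>I. a i = 0")
  case True
  then obtain i where i: "i \<in> I" "a i = 0" by auto
  then have "(\<integral>\<^sup>+x. ennreal (G i x) \<partial>M) = 0" using Ga[of i] by simp
  then have "AE x in M. ennreal (G i x) = 0"
    using i(1) by (subst (asm) nn_integral_0_iff_AE) auto
  then have "AE x in M. ennreal (\<Prod>i\<in>I. G i x powr w i) = 0"
  proof eventually_elim
    case (elim x)
    then have "G i x = 0" using G0[OF i(1), of x] by (simp add: ennreal_eq_0_iff)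
    then have "(\<Prod>i\<in>I. G i x powr w i) = 0" using i(1) assms(1) by (auto intro!: prod_zero)
    then show ?case by simp
  qed
  then have "(\<integral>\<^sup>+x. ennreal (\<Prod>i\<in>I. G i x powr w i) \<partial>M) = (\<integral>\<^sup>+x. 0 \<partial>M)"
    by (intro nn_integral_cong_AE)
  then show ?thesis by simp
next
  case False
  then have pos: "a i > 0" if "i \<in> I" for i using a[OF that] that by (auto simp: less_le)
  define P where "P = (\<Prod>i\<in>I. a i powr w i)"
  have P: "P > 0" unfolding P_def using pos by (intro prod_pos) (metis less_irrefl powr_gt_zero)
  have pw: "ennreal (\<Prod>i\<in>I. G i x powr w i) \<le> ennreal P * (\<Sum>i\<in>I. ennreal (w i / a i) * ennreal (G i x))" for x
  proof -
    have "(\<Prod>i\<in>I. G i x powr w i) = P * (\<Prod>i\<in>I. (G i x / a i) powr w i)"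
      unfolding P_def prod.distrib[symmetric]
    proof (intro prod.cong refl)
      fix i assume "i \<in> I"
      then show "G i x powr w i = a i powr w i * (G i x / a i) powr w i"
        using pos[of i] G0[of i x] by (simp add: powr_divide)
    qed
    also have "\<dots> \<le> P * (\<Sum>i\<in>I. w i * (G i x / a i))"
      using P w pos G0 sum1 assms(1) by (intro mult_left_mono weighted_AM_GM) (auto simp: less_imp_le)
    also have "(\<Sum>i\<in>I. w i * (G i x / a i)) = (\<Sum>i\<in>I. (w i / a i) * G i x)" by simp
    finally have "ennreal (\<Prod>i\<in>I. G i x powr w i) \<le> ennreal (P * (\<Sum>i\<in>I. (w i / a i) * G i x))"
      by (rule ennreal_leI)
    also have "\<dots> = ennreal P * ennreal (\<Sum>i\<in>I. (w i / a i) * G i x)"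
      using P w pos G0 by (intro ennreal_mult) (auto intro!: sum_nonneg simp: less_imp_le)
    also have "ennreal (\<Sum>i\<in>I. (w i / a i) * G i x) = (\<Sum>i\<in>I. ennreal ((w i / a i) * G i x))"
      using w pos G0 by (intro sum_ennreal[symmetric]) (auto simp: less_imp_le)
    also have "\<dots> = (\<Sum>i\<in>I. ennreal (w i / a i) * ennreal (G i x))"
      using w pos G0 by (intro sum.cong ennreal_mult) (auto simp: less_imp_le)
    finally show ?thesis .
  qed
  have "(\<integral>\<^sup>+x. ennreal (\<Prod>i\<in>I. G i x powr w i) \<partial>M)
      \<le> (\<integral>\<^sup>+x. ennreal P * (\<Sum>i\<in>I. ennreal (w i / a i) * ennreal (G i x)) \<partial>M)"
    by (intro nn_integral_mono pw)
  also have "\<dots> = ennreal P * (\<Sum>i\<in>I. ennreal (w i / a i) * (\<integral>\<^sup>+x. ennreal (G i x) \<partial>M))"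
    by (simp add: nn_integral_cmult nn_integral_sum)
  also have "\<dots> \<le> ennreal P * (\<Sum>i\<in>I. ennreal (w i / a i) * ennreal (a i))"
    by (intro mult_left_mono sum_mono Ga) auto
  also have "(\<Sum>i\<in>I. ennreal (w i / a i) * ennreal (a i)) = (\<Sum>i\<in>I. ennreal (w i))"
  proof (intro sum.cong refl)
    fix i assume "i \<in> I"
    then show "ennreal (w i / a i) * ennreal (a i) = ennreal (w i)"
      using pos[of i] w[of i] by (simp add: ennreal_mult[symmetric])
  qed
  also have "\<dots> = 1" using w sum1 by (simp add: sum_ennreal)
  finally show ?thesis by (simp add: P_def)
qed

text \<open>
Twice the sum of the geometric series with ratio \<open>2 powr - \<eta>\<close>: it bounds the series decaying in both
directions from an arbitrary real center.
\<close>

definition geo_const :: "real \<Rightarrow> real" where "geo_const \<eta> = 2 / (1 - 2 powr - \<eta>)"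

lemma geo_const_pos: "0 < \<eta> \<Longrightarrow> 0 < geo_const \<eta>"
  by (simp add: geo_const_def powr_less_one)

lemma sum_two_sided_geometric:
  fixes \<theta> \<eta> :: real
  assumes "0 < \<eta>"
  shows "(\<Sum>k::nat. ennreal (2 powr (- \<eta> * \<bar>real k - \<theta>\<bar>))) \<le> ennreal (geo_const \<eta>)"
proof -
  define x :: real where "x = 2 powr - \<eta>"
  have x: "0 < x" "x < 1" using assms by (auto simp: x_def powr_less_one)
  have xk: "x ^ k = 2 powr (- \<eta> * real k)" for k
    by (simp add: x_def powr_powr powr_realpow[symmetric])
  have gs: "(\<Sum>j<K. x ^ j) \<le> 1 / (1 - x)" for K
    using x by (simp add: sum_gp_strict divide_right_mono)
  have part: "(\<Sum>k<K. 2 powr (- \<eta> * \<bar>real k - \<theta>\<bar>)) \<le> geo_const \<eta>" for K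
  proof (cases "\<theta> < 0")
    case True
    have "(\<Sum>k<K. 2 powr (- \<eta> * \<bar>real k - \<theta>\<bar>)) \<le> (\<Sum>k<K. x ^ k)"
      unfolding xk using True assms by (intro sum_mono powr_mono) auto
    also have "\<dots> \<le> 1 / (1 - x)" by (rule gs)
    also have "\<dots> \<le> geo_const \<eta>" using x by (simp add: geo_const_def x_def divide_right_mono)
    finally show ?thesis .
  next
    case False
    define n where "n = nat \<lfloor>\<theta>\<rfloor>"
    have n: "real n \<le> \<theta>" "\<theta> < real n + 1" using False by (auto simp: n_def)
    have "(\<Sum>k<K. 2 powr (- \<eta> * \<bar>real k - \<theta>\<bar>)) \<le> (\<Sum>k<Suc n + K. 2 powr (- \<eta> * \<bar>real k - \<theta>\<bar>))"
      by (intro sum_mono2) auto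
    also have "\<dots> = (\<Sum>k<Suc n. 2 powr (- \<eta> * \<bar>real k - \<theta>\<bar>))
        + (\<Sum>k<K. 2 powr (- \<eta> * \<bar>real (Suc n + k) - \<theta>\<bar>))"
      by (induction K) (auto simp: algebra_simps)
    also have "(\<Sum>k<Suc n. 2 powr (- \<eta> * \<bar>real k - \<theta>\<bar>)) \<le> (\<Sum>k<Suc n. x ^ (Suc n - Suc k))"
      unfolding xk using n assms by (intro sum_mono powr_mono) (auto simp: of_nat_diff)
    also have "(\<Sum>k<Suc n. x ^ (Suc n - Suc k)) = (\<Sum>k<Suc n. x ^ k)"
      by (rule sum.nat_diff_reindex)
    also have "(\<Sum>k<Suc n. x ^ k) \<le> 1 / (1 - x)" by (rule gs)
    also have "(\<Sum>k<K. 2 powr (- \<eta> * \<bar>real (Suc n + k) - \<theta>\<bar>)) \<le> (\<Sum>k<K. x ^ k)"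
      unfolding xk using n assms by (intro sum_mono powr_mono) (auto simp: of_nat_diff)
    also have "(\<Sum>k<K. x ^ k) \<le> 1 / (1 - x)" by (rule gs)
    also have "1 / (1 - x) + 1 / (1 - x) = geo_const \<eta>" by (simp add: geo_const_def x_def)
    finally show ?thesis by simp
  qed
  have "(\<Sum>k<K. ennreal (2 powr (- \<eta> * \<bar>real k - \<theta>\<bar>))) \<le> ennreal (geo_const \<eta>)" for K
    using part[of K] by (subst sum_ennreal) (auto intro: ennreal_leI)
  then show ?thesis by (auto simp: suminf_eq_SUP intro!: SUP_least)
qed

text \<open>
If every \<open>A k\<close> were smaller than the corresponding term of a series with sum at most \<open>u / 2\<close>, the sum of the
\<open>A k\<close> could not reach \<open>u\<close>.  This replaces the summation over the scales by the choice of one scale, at the cost of a factor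
\<open>2 powr (\<eta> * \<bar>k - \<theta>\<bar>)\<close>.
\<close>

lemma geometric_pigeonhole:
  fixes A :: "nat \<Rightarrow> ennreal"
  assumes "0 < u" "0 < \<eta>" and le: "ennreal u \<le> (\<Sum>k. A k)"
  shows "\<exists>k. ennreal u \<le> ennreal (2 * geo_const \<eta> * 2 powr (\<eta> * \<bar>real k - \<theta>\<bar>)) * A k"
proof (rule ccontr)
  assume "\<not> ?thesis"
  then have neg: "ennreal (2 * geo_const \<eta> * 2 powr (\<eta> * \<bar>real k - \<theta>\<bar>)) * A k < ennreal u" for k
    by (auto simp: not_le)
  note g = geo_const_pos[OF assms(2)]
  have "A k \<le> ennreal (u / (2 * geo_const \<eta>)) * ennreal (2 powr (- \<eta> * \<bar>real k - \<theta>\<bar>))" for k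
  proof -
    let ?t = "2 * geo_const \<eta> * 2 powr (\<eta> * \<bar>real k - \<theta>\<bar>)"
    have t: "?t > 0" using g by simp
    have "A k = ennreal (1 / ?t) * (ennreal ?t * A k)"
      using t by (subst mult.assoc[symmetric], subst ennreal_mult[symmetric]) auto
    also have "\<dots> \<le> ennreal (1 / ?t) * ennreal u"
      using neg[of k] by (intro mult_left_mono) auto
    also have "\<dots> = ennreal (u / (2 * geo_const \<eta>)) * ennreal (2 powr (- \<eta> * \<bar>real k - \<theta>\<bar>))"
      using g assms(1) by (simp add: ennreal_mult[symmetric] powr_minus field_simps)
    finally show ?thesis .
  qed
  then have "(\<Sum>k. A k) \<le> (\<Sum>k. ennreal (u / (2 * geo_const \<eta>)) * ennreal (2 powr (- \<eta> * \<bar>real k - \<theta>\<bar>)))"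
    by (intro suminf_le) auto
  also have "\<dots> = ennreal (u / (2 * geo_const \<eta>)) * (\<Sum>k. ennreal (2 powr (- \<eta> * \<bar>real k - \<theta>\<bar>)))"
    by simp
  also have "\<dots> \<le> ennreal (u / (2 * geo_const \<eta>)) * ennreal (geo_const \<eta>)"
    by (intro mult_left_mono sum_two_sided_geometric assms) auto
  also have "\<dots> = ennreal (u / 2)"
    using g assms(1) by (simp add: ennreal_mult[symmetric])
  also have "\<dots> < ennreal u" using assms(1) by (simp add: ennreal_less_iff)
  finally show False using le by simp
qed

section \<open>Multilinear averages decomposed into scales\<close>

text \<open>
The situation to which the p-adic averages are reduced.  The function \<open>\<phi> i x y\<close> stands for \<open>x - P\<^sub>i(y)\<close>, \<open>N\<close> for
Haar measure on the unit ball, and \<open>S k\<close> for the points at distance roughly \<open>2 powr - k\<close> from the critical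
points of the polynomials.  The assumption on single scales is the change of variables formula with
the lower bound \<open>2 powr (- k * (d i - 1))\<close> for the derivative of \<open>P\<^sub>i\<close> on \<open>S k\<close>.  The functions \<open>F i\<close> are
the normalized absolute values of the given functions.
\<close>

locale averaging_family =
  fixes M N :: "'a measure" and m :: nat and d :: "nat \<Rightarrow> nat" and r :: "nat \<Rightarrow> real"
    and c :: real and S :: "nat \<Rightarrow> 'a set" and \<phi> :: "nat \<Rightarrow> 'a \<Rightarrow> 'a \<Rightarrow> 'a"
    and F :: "nat \<Rightarrow> 'a \<Rightarrow> real"
  assumes M: "sigma_finite_measure M" and N: "prob_space N"
    and m: "1 \<le> m" and d: "\<And>i. i \<in> {1..m} \<Longrightarrow> 1 \<le> d i"
    and r: "\<And>i. i \<in> {1..m} \<Longrightarrow> 1 < r i" and r_sum: "(\<Sum>i=1..m. 1 / r i) \<le> 1"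
    and c: "1 \<le> c"
    and \<phi>_meas: "\<And>i. i \<in> {1..m} \<Longrightarrow> (\<lambda>(x, y). \<phi> i x y) \<in> M \<Otimes>\<^sub>M N \<rightarrow>\<^sub>M M"
    and \<phi>_inv: "\<And>i g y. i \<in> {1..m} \<Longrightarrow> g \<in> borel_measurable M \<Longrightarrow> y \<in> space N \<Longrightarrow>
       (\<integral>\<^sup>+x. g (\<phi> i x y) \<partial>M) = (\<integral>\<^sup>+x. (g x :: ennreal) \<partial>M)"
    and S_sets: "\<And>k. S k \<in> sets N"
    and S_cover: "AE y in N. \<exists>k. y \<in> S k"
    and S_small: "\<And>k. emeasure N (S k) \<le> ennreal (c * 2 powr (- real k))"
    and S_reg: "\<And>i g k x. i \<in> {1..m} \<Longrightarrow> g \<in> borel_measurable M \<Longrightarrow> x \<in> space M \<Longrightarrow>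
       (\<integral>\<^sup>+y\<in>S k. g (\<phi> i x y) \<partial>N) \<le> ennreal (c * 2 powr (real k * (real (d i) - 1))) * (\<integral>\<^sup>+x. (g x :: ennreal) \<partial>M)"
    and F_meas: "\<And>i. i \<in> {1..m} \<Longrightarrow> F i \<in> borel_measurable M"
    and F_nonneg: "\<And>i x. 0 \<le> F i x"
    and F_norm: "\<And>i. i \<in> {1..m} \<Longrightarrow> (\<integral>\<^sup>+x. ennreal (F i x powr r i) \<partial>M) \<le> 1"
begin

definition average :: "'a \<Rightarrow> ennreal" where
  "average x = (\<integral>\<^sup>+y. ennreal (\<Prod>i=1..m. F i (\<phi> i x y)) \<partial>N)"

text \<open>
The contribution of one scale, with the last function kept variable: the critical bound has to
truncate it.
\<close>

definition piece :: "nat \<Rightarrow> ('a \<Rightarrow> real) \<Rightarrow> 'a \<Rightarrow> ennreal" where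
  "piece k g x = (\<integral>\<^sup>+y\<in>S k. ennreal ((\<Prod>i=1..m-1. F i (\<phi> i x y)) * g (\<phi> m x y)) \<partial>N)"

text \<open>
The weight that the first \<open>m - 1\<close> functions take in Hoelder's inequality, and below the exponent of \<open>2 powr k\<close> that
they cost on the scale \<open>k\<close>.
\<close>

definition \<sigma> :: real where "\<sigma> = (\<Sum>i=1..m-1. 1 / r i)"

definition \<beta> :: real where "\<beta> = (\<Sum>i=1..m-1. (real (d i) - 1) / r i)"

interpretation M: sigma_finite_measure M by (rule M)
interpretation N: prob_space N by (rule N)
interpretation MN: pair_sigma_finite M N by unfold_locales

lemma m_in: "m \<in> {1..m}" using m by auto

lemma c0: "0 < c" using c by simp

lemma r0: "i \<in> {1..m} \<Longrightarrow> 0 < r i" using r[of i] by simp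

lemma split_m: "{1..m} = insert m {1..m-1}" using m by auto

lemma sum_split: "(\<Sum>i=1..m. f i) = (\<Sum>i=1..m-1. f i) + (f m :: real)"
  unfolding split_m by (subst sum.insert) auto

lemma prod_split: "(\<Prod>i=1..m. f i) = (\<Prod>i=1..m-1. f i) * (f m :: real)"
  unfolding split_m by (subst prod.insert) auto

lemma sum_r: "(\<Sum>i=1..m. 1 / r i) = \<sigma> + 1 / r m"
  unfolding sum_split \<sigma>_def ..

lemma \<sigma>_nonneg: "0 \<le> \<sigma>"
  unfolding \<sigma>_def using r0 by (intro sum_nonneg) (auto simp: less_imp_le)

lemma K_exp_eq: "K_exp m d r = \<sigma> + \<beta> + real (d m) / r m"
  unfolding K_exp_def sum_split \<sigma>_def \<beta>_def by (simp add: sum.distrib[symmetric] diff_divide_distrib)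

lemma measurable_comp_\<phi>:
  assumes "i \<in> {1..m}" "g \<in> M \<rightarrow>\<^sub>M L"
  shows "(\<lambda>p. g (\<phi> i (fst p) (snd p))) \<in> M \<Otimes>\<^sub>M N \<rightarrow>\<^sub>M L"
  using measurable_compose[OF \<phi>_meas[OF assms(1)] assms(2)] by (simp add: case_prod_beta)

lemma measurable_section_\<phi>:
  assumes "i \<in> {1..m}" "g \<in> M \<rightarrow>\<^sub>M L" "x \<in> space M"
  shows "(\<lambda>y. g (\<phi> i x y)) \<in> N \<rightarrow>\<^sub>M L"
  using measurable_compose[OF measurable_Pair1'[OF assms(3)] measurable_comp_\<phi>[OF assms(1,2)]] by simp

lemma integral_piece_transport:
  fixes g :: "'a \<Rightarrow> ennreal"
  assumes i: "i \<in> {1..m}" and g: "g \<in> borel_measurable M" and T: "T \<in> sets N"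
  shows "(\<integral>\<^sup>+x. (\<integral>\<^sup>+y\<in>T. g (\<phi> i x y) \<partial>N) \<partial>M) = emeasure N T * (\<integral>\<^sup>+x. g x \<partial>M)"
proof -
  note [measurable] = measurable_comp_\<phi>[OF i g] T g
  have [measurable]: "(\<lambda>p. g (\<phi> i (fst p) (snd p)) * indicator T (snd p)) \<in> borel_measurable (M \<Otimes>\<^sub>M N)"
    by measurable
  have "(\<integral>\<^sup>+x. (\<integral>\<^sup>+y. g (\<phi> i x y) * indicator T y \<partial>N) \<partial>M)
      = (\<integral>\<^sup>+y. (\<integral>\<^sup>+x. g (\<phi> i x y) * indicator T y \<partial>M) \<partial>N)"
    by (rule MN.Fubini'[symmetric]) (simp add: case_prod_beta)
  also have "\<dots> = (\<integral>\<^sup>+y. (\<integral>\<^sup>+x. g x \<partial>M) * indicator T y \<partial>N)"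
  proof (intro nn_integral_cong)
    fix y assume y: "y \<in> space N"
    have "(\<lambda>x. g (\<phi> i x y)) \<in> borel_measurable M"
      using measurable_compose[OF measurable_Pair2'[OF y] measurable_comp_\<phi>[OF i g]] by simp
    then show "(\<integral>\<^sup>+x. g (\<phi> i x y) * indicator T y \<partial>M) = (\<integral>\<^sup>+x. g x \<partial>M) * indicator T y"
      by (simp add: nn_integral_multc \<phi>_inv[OF i g y])
  qed
  also have "\<dots> = (\<integral>\<^sup>+x. g x \<partial>M) * emeasure N T"
    by (rule nn_integral_cmult_indicator[OF T])
  finally show ?thesis by (simp add: mult.commute)
qed

lemma average_le_pieces:
  assumes x: "x \<in> space M"
  shows "average x \<le> (\<Sum>k. piece k (F m) x)"
proof -
  let ?f = "\<lambda>y. ennreal (\<Prod>i=1..m. F i (\<phi> i x y))"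
  have meas: "?f \<in> borel_measurable N"
    using measurable_section_\<phi>[OF _ F_meas x] by (intro measurable_compose[OF borel_measurable_prod measurable_ennreal]) auto
  have "average x \<le> (\<integral>\<^sup>+y. (\<Sum>k. ?f y * indicator (S k) y) \<partial>N)"
    unfolding average_def
  proof (intro nn_integral_mono_AE, use S_cover in eventually_elim)
    case (elim y)
    then obtain k where "y \<in> S k" by auto
    define h where "h = (\<lambda>k. ?f y * indicator (S k) y)"
    have "?f y = h k" using \<open>y \<in> S k\<close> by (simp add: h_def)
    also have "\<dots> \<le> (\<Sum>k. h k)" using sum_le_suminf[of h "{k}"] by simp
    finally show ?case unfolding h_def .
  qed
  also have "\<dots> = (\<Sum>k. \<integral>\<^sup>+y. ?f y * indicator (S k) y \<partial>N)"
    using meas S_sets by (intro nn_integral_suminf) auto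
  finally show ?thesis unfolding piece_def prod_split .
qed

text \<open>
Hoelder's inequality on one scale.  The weight that is left over, \<open>1 - 1 / s - \<sigma>\<close>, goes to the constant
function 1, so that the smallness of \<open>S k\<close> is exploited.
\<close>

lemma piece_le:
  assumes x: "x \<in> space M" and g: "g \<in> borel_measurable M" and g0: "\<And>x. 0 \<le> g x"
    and s: "0 < s" and w: "0 \<le> 1 - 1 / s - \<sigma>"
    and D: "0 \<le> D" and gD: "(\<integral>\<^sup>+y\<in>S k. ennreal (g (\<phi> m x y) powr s) \<partial>N) \<le> ennreal D"
  shows "piece k g x \<le> ennreal (c * 2 powr (real k * (\<beta> - (1 - 1 / s - \<sigma>))) * D powr (1 / s))"
proof -
  define w0 where "w0 = 1 - 1 / s - \<sigma>"
  define I where "I = insert 0 (insert m {1..m-1})"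
  define G where "G = (\<lambda>i y. if i = 0 then 1 else if i = m then g (\<phi> m x y) powr s else F i (\<phi> i x y) powr r i)"
  define W where "W = (\<lambda>i. if i = 0 then w0 else if i = m then 1 / s else 1 / r i)"
  define a where "a = (\<lambda>i. if i = 0 then c * 2 powr (- real k) else if i = m then D
      else c * 2 powr (real k * (real (d i) - 1)))"
  let ?NS = "restrict_space N (S k)"
  have sumI: "(\<Sum>i\<in>I. f i) = f 0 + (f m + (\<Sum>i=1..m-1. f i))" for f :: "nat \<Rightarrow> real"
    unfolding I_def using m by (subst sum.insert; auto)
  have prodI: "(\<Prod>i\<in>I. f i) = f 0 * (f m * (\<Prod>i=1..m-1. f i))" for f :: "nat \<Rightarrow> real"
    unfolding I_def using m by (subst prod.insert; auto)
  have restr: "(\<integral>\<^sup>+y. f y \<partial>?NS) = (\<integral>\<^sup>+y\<in>S k. f y \<partial>N)" for f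
    by (rule nn_integral_restrict_space) (use S_sets sets.Int_space_eq2 in auto)
  have W1: "(\<Sum>i\<in>I. W i) = 1"
  proof -
    have "(\<Sum>i=1..m-1. W i) = \<sigma>" unfolding \<sigma>_def W_def by (intro sum.cong) auto
    then show ?thesis using m by (simp add: sumI) (simp add: W_def w0_def)
  qed
  have "piece k g x = (\<integral>\<^sup>+y. ennreal ((\<Prod>i=1..m-1. F i (\<phi> i x y)) * g (\<phi> m x y)) \<partial>?NS)"
    by (simp add: piece_def restr)
  also have "\<dots> = (\<integral>\<^sup>+y. ennreal (\<Prod>i\<in>I. G i y powr W i) \<partial>?NS)"
  proof (intro nn_integral_cong arg_cong[where f=ennreal])
    fix y
    have "(\<Prod>i=1..m-1. G i y powr W i) = (\<Prod>i=1..m-1. F i (\<phi> i x y))"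
    proof (intro prod.cong refl)
      fix i assume i: "i \<in> {1..m-1}"
      then have "r i > 0" using r0[of i] by auto
      then show "G i y powr W i = F i (\<phi> i x y)"
        using i F_nonneg[of i] by (auto simp: G_def W_def powr_powr)
    qed
    then show "(\<Prod>i=1..m-1. F i (\<phi> i x y)) * g (\<phi> m x y) = (\<Prod>i\<in>I. G i y powr W i)"
      using m s g0 by (simp add: prodI) (simp add: G_def W_def powr_powr)
  qed
  also have "\<dots> \<le> ennreal (\<Prod>i\<in>I. a i powr W i)"
  proof (rule nn_integral_prod_powr_le)
    show "finite I" by (simp add: I_def)
    show "0 \<le> W i" if "i \<in> I" for i
      using that r0[of i] w s by (auto simp: W_def w0_def I_def less_imp_le)
    show "0 \<le> a i" if "i \<in> I" for i using D c by (auto simp: a_def)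
    show "0 \<le> G i y" for i y by (auto simp: G_def)
    show "G i \<in> borel_measurable ?NS" if iI: "i \<in> I" for i
    proof -
      consider "i = 0" | "i \<noteq> 0" "i = m" | "i \<noteq> 0" "i \<noteq> m" "i \<in> {1..m}"
        using iI m by (auto simp: I_def)
      then have "G i \<in> borel_measurable N"
      proof cases
        case 1 then show ?thesis by (simp add: G_def)
      next
        case 2 then show ?thesis using measurable_section_\<phi>[OF m_in g x] by (simp add: G_def)
      next
        case 3 then show ?thesis using measurable_section_\<phi>[OF 3(3) F_meas[OF 3(3)] x] by (simp add: G_def)
      qed
      then show ?thesis by (rule measurable_restrict_space1)
    qed
    show "(\<integral>\<^sup>+y. ennreal (G i y) \<partial>?NS) \<le> ennreal (a i)" if iI: "i \<in> I" for i
    proof -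
      consider "i = 0" | "i \<noteq> 0" "i = m" | "i \<noteq> 0" "i \<noteq> m" "i \<in> {1..m}"
        using iI m by (auto simp: I_def)
      then show ?thesis
      proof cases
        case 1
        then show ?thesis unfolding restr using S_small[of k] S_sets[of k] by (simp add: G_def a_def)
      next
        case 2
        then show ?thesis using gD by (simp add: restr G_def a_def)
      next
        case 3
        have "(\<integral>\<^sup>+y\<in>S k. ennreal (F i (\<phi> i x y) powr r i) \<partial>N)
          \<le> ennreal (c * 2 powr (real k * (real (d i) - 1))) * (\<integral>\<^sup>+x. ennreal (F i x powr r i) \<partial>M)"
          using F_meas[OF 3(3)] by (intro S_reg 3 x) auto
        also have "\<dots> \<le> ennreal (c * 2 powr (real k * (real (d i) - 1))) * 1"
          by (intro mult_left_mono F_norm 3) auto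
        finally show ?thesis using 3 by (simp add: restr G_def a_def)
      qed
    qed
  qed (rule W1)
  also have "(\<Prod>i\<in>I. a i powr W i) \<le> c * 2 powr (real k * (\<beta> - w0)) * D powr (1 / s)"
  proof -
    have "(\<Prod>i=1..m-1. a i powr W i) = (\<Prod>i=1..m-1. c powr (1 / r i) * 2 powr (real k * ((real (d i) - 1) / r i)))"
    proof (intro prod.cong refl)
      fix i assume "i \<in> {1..m-1}"
      then show "a i powr W i = c powr (1 / r i) * 2 powr (real k * ((real (d i) - 1) / r i))"
        using c0 by (auto simp: a_def W_def powr_mult powr_powr)
    qed
    also have "\<dots> = c powr \<sigma> * 2 powr (real k * \<beta>)"
      using c0 by (simp add: prod.distrib powr_sum[symmetric] \<sigma>_def \<beta>_def sum_distrib_left)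
    finally have "(\<Prod>i\<in>I. a i powr W i) = (c * 2 powr (- real k)) powr w0 * (D powr (1 / s) * (c powr \<sigma> * 2 powr (real k * \<beta>)))"
      using m by (simp add: prodI) (simp add: a_def W_def)
    also have "(c * 2 powr (- real k)) powr w0 = c powr w0 * 2 powr (- real k * w0)"
      using c0 by (simp add: powr_mult powr_powr)
    also have "c powr w0 * 2 powr (- real k * w0) * (D powr (1 / s) * (c powr \<sigma> * 2 powr (real k * \<beta>)))
        = (c powr w0 * c powr \<sigma>) * (2 powr (- real k * w0) * 2 powr (real k * \<beta>)) * D powr (1 / s)"
      by (simp only: ac_simps)
    also have "\<dots> = c powr (w0 + \<sigma>) * 2 powr (real k * (\<beta> - w0)) * D powr (1 / s)"
      by (simp only: powr_add[symmetric]) (simp add: algebra_simps)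
    also have "\<dots> \<le> c powr 1 * 2 powr (real k * (\<beta> - w0)) * D powr (1 / s)"
      using c s by (intro mult_right_mono powr_mono) (auto simp: w0_def)
    finally show ?thesis using c0 by simp
  qed
  finally show ?thesis unfolding w0_def by (simp add: ennreal_leI)
qed

text \<open>
Jensen's inequality in \<open>y\<close> moves the exponent \<open>p\<close> under the integral, the inequality of arithmetic and geometric
means with the weights \<open>p / r i\<close> separates the functions, and translation invariance evaluates the
integrals in \<open>x\<close>.  The average might be infinite at some points, so the bound is stated for real valued
functions \<open>u\<close> below it.
\<close>

lemma trivial_bound:
  fixes u :: "'a \<Rightarrow> real"
  assumes u0: "\<And>x. 0 \<le> u x" and u: "\<And>x. x \<in> space M \<Longrightarrow> ennreal (u x) \<le> average x"
  shows "(\<integral>\<^sup>+x. ennreal (u x powr p_star m r) \<partial>M) \<le> 1"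
proof -
  define p where "p = p_star m r"
  have rs: "(\<Sum>i=1..m. 1 / r i) > 0" using m r0 by (intro sum_pos) auto
  then have p1: "1 \<le> p" using r_sum by (simp add: p_def p_star_def)
  have pr: "(\<Sum>i=1..m. p / r i) = 1"
  proof -
    have "(\<Sum>i=1..m. p / r i) = p * (\<Sum>i=1..m. 1 / r i)" by (simp add: sum_distrib_left)
    then show ?thesis using rs by (simp add: p_def p_star_def)
  qed
  let ?P = "\<lambda>x y. \<Prod>i=1..m. F i (\<phi> i x y)"
  have P0: "0 \<le> ?P x y" for x y using F_nonneg by (simp add: prod_nonneg)
  have Jensen: "ennreal (u x powr p) \<le> (\<integral>\<^sup>+y. ennreal (?P x y powr p) \<partial>N)" if x: "x \<in> space M" for x
  proof (cases "(\<integral>\<^sup>+y. ennreal (?P x y powr p) \<partial>N) = \<infinity>")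
    case False
    then obtain D where D: "0 \<le> D" "(\<integral>\<^sup>+y. ennreal (?P x y powr p) \<partial>N) = ennreal D"
      by (cases "(\<integral>\<^sup>+y. ennreal (?P x y powr p) \<partial>N)") auto
    have meas: "?P x \<in> borel_measurable N"
      using measurable_section_\<phi>[OF _ F_meas x] by (intro borel_measurable_prod) auto
    have "average x = (\<integral>\<^sup>+y. ennreal (\<Prod>i\<in>{True, False}. (if i then ?P x y powr p else 1) powr (if i then 1 / p else 1 - 1 / p)) \<partial>N)"
      unfolding average_def using p1 P0 by (intro nn_integral_cong) (simp add: powr_powr)
    also have "\<dots> \<le> ennreal (\<Prod>i\<in>{True, False}. (if i then D else 1) powr (if i then 1 / p else 1 - 1 / p))"
      using p1 D meas by (intro nn_integral_prod_powr_le) (auto simp: N.emeasure_space_1 simp del: One_nat_def)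
    finally have "average x \<le> ennreal (D powr (1 / p))" by simp
    with u[OF x] have "ennreal (u x) \<le> ennreal (D powr (1 / p))" by (rule order_trans)
    then have "u x \<le> D powr (1 / p)" by (simp add: ennreal_le_iff)
    then have "u x powr p \<le> (D powr (1 / p)) powr p" using p1 u0 by (intro powr_mono2) auto
    also have "\<dots> = D" using p1 D by (simp add: powr_powr)
    finally show ?thesis unfolding D(2) by (rule ennreal_leI)
  qed simp
  have AMGM: "ennreal (?P x y powr p) \<le> (\<Sum>i=1..m. ennreal (p / r i) * ennreal (F i (\<phi> i x y) powr r i))" for x y
  proof -
    have "?P x y powr p = (\<Prod>i=1..m. (F i (\<phi> i x y) powr r i) powr (p / r i))"
      unfolding prod_powr_distrib using r0 by (intro prod.cong refl) (simp add: powr_powr, metis less_irrefl)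
    also have "\<dots> \<le> (\<Sum>i=1..m. (p / r i) * (F i (\<phi> i x y) powr r i))"
      using p1 r0 pr by (intro weighted_AM_GM) (auto simp: less_imp_le)
    finally have "ennreal (?P x y powr p) \<le> ennreal (\<Sum>i=1..m. (p / r i) * (F i (\<phi> i x y) powr r i))"
      by (rule ennreal_leI)
    also have "\<dots> = (\<Sum>i=1..m. ennreal ((p / r i) * (F i (\<phi> i x y) powr r i)))"
      using p1 r0 by (intro sum_ennreal[symmetric]) (auto simp: less_imp_le)
    also have "\<dots> = (\<Sum>i=1..m. ennreal (p / r i) * ennreal (F i (\<phi> i x y) powr r i))"
      using p1 r0 by (intro sum.cong ennreal_mult) (auto simp: less_imp_le)
    finally show ?thesis .
  qed
  have Fm: "(\<lambda>x. ennreal (F i x powr r i)) \<in> borel_measurable M" if "i \<in> {1..m}" for i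
    using F_meas[OF that] by simp
  have "(\<integral>\<^sup>+x. ennreal (u x powr p) \<partial>M)
      \<le> (\<integral>\<^sup>+x. (\<Sum>i=1..m. ennreal (p / r i) * (\<integral>\<^sup>+y\<in>space N. ennreal (F i (\<phi> i x y) powr r i) \<partial>N)) \<partial>M)"
  proof (intro nn_integral_mono)
    fix x assume x: "x \<in> space M"
    have meas: "(\<lambda>y. ennreal (F i (\<phi> i x y) powr r i)) \<in> borel_measurable N" if "i \<in> {1..m}" for i
      using measurable_section_\<phi>[OF that F_meas[OF that] x] by simp
    have "ennreal (u x powr p) \<le> (\<integral>\<^sup>+y. ennreal (?P x y powr p) \<partial>N)" by (rule Jensen[OF x])
    also have "\<dots> \<le> (\<integral>\<^sup>+y. (\<Sum>i=1..m. ennreal (p / r i) * ennreal (F i (\<phi> i x y) powr r i)) \<partial>N)"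
      by (intro nn_integral_mono AMGM)
    also have "\<dots> = (\<Sum>i=1..m. ennreal (p / r i) * (\<integral>\<^sup>+y. ennreal (F i (\<phi> i x y) powr r i) \<partial>N))"
      by (subst nn_integral_sum) (auto intro!: sum.cong nn_integral_cmult borel_measurable_times_ennreal meas simp del: One_nat_def)
    also have "\<dots> = (\<Sum>i=1..m. ennreal (p / r i) * (\<integral>\<^sup>+y\<in>space N. ennreal (F i (\<phi> i x y) powr r i) \<partial>N))"
      by (intro sum.cong refl arg_cong2[where f="(*)"] nn_integral_cong) auto
    finally show "ennreal (u x powr p) \<le> (\<Sum>i=1..m. ennreal (p / r i) * (\<integral>\<^sup>+y\<in>space N. ennreal (F i (\<phi> i x y) powr r i) \<partial>N))" .
  qed
  also have "\<dots> = (\<Sum>i=1..m. ennreal (p / r i) * (\<integral>\<^sup>+x. (\<integral>\<^sup>+y\<in>space N. ennreal (F i (\<phi> i x y) powr r i) \<partial>N) \<partial>M))"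
  proof -
    have "(\<lambda>x. \<integral>\<^sup>+y\<in>space N. ennreal (F i (\<phi> i x y) powr r i) \<partial>N) \<in> borel_measurable M" if "i \<in> {1..m}" for i
      using measurable_comp_\<phi>[OF that Fm[OF that]]
      by (intro N.borel_measurable_nn_integral) (simp add: case_prod_beta)
    note mx = this
    show ?thesis
      by (rule trans[OF nn_integral_sum])
         ((intro sum.cong refl nn_integral_cmult borel_measurable_times_ennreal borel_measurable_const mx; assumption)+)
  qed
  also have "\<dots> = (\<Sum>i=1..m. ennreal (p / r i) * (\<integral>\<^sup>+x. ennreal (F i x powr r i) \<partial>M))"
    using integral_piece_transport[OF _ Fm sets.top] by (intro sum.cong refl) (simp add: N.emeasure_space_1)
  also have "\<dots> \<le> (\<Sum>i=1..m. ennreal (p / r i) * 1)"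
    by (intro sum_mono mult_left_mono F_norm) auto
  also have "\<dots> = ennreal (\<Sum>i=1..m. p / r i)"
    using p1 r0 by (simp, intro sum_ennreal) (auto simp: less_imp_le)
  finally show ?thesis unfolding pr by (simp add: p_def)
qed

text \<open>
The factor that the last function contributes to Hoelder's inequality.  Unlike the others it is not
replaced by its supremum over \<open>x\<close> at once, because its integral over \<open>x\<close> is much smaller.
\<close>

definition H :: "nat \<Rightarrow> 'a \<Rightarrow> ennreal" where
  "H k x = (\<integral>\<^sup>+y\<in>S k. ennreal (F m (\<phi> m x y) powr r m) \<partial>N)"

lemma Fm_powr_meas: "(\<lambda>x. ennreal (F m x powr s)) \<in> borel_measurable M"
  using F_meas[OF m_in] by simp

lemma H_le:
  assumes "x \<in> space M"
  shows "H k x \<le> ennreal (c * 2 powr (real k * (real (d m) - 1)))"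
proof -
  have "H k x \<le> ennreal (c * 2 powr (real k * (real (d m) - 1))) * (\<integral>\<^sup>+x. ennreal (F m x powr r m) \<partial>M)"
    unfolding H_def by (intro S_reg m_in Fm_powr_meas assms)
  also have "\<dots> \<le> ennreal (c * 2 powr (real k * (real (d m) - 1))) * 1"
    by (intro mult_left_mono F_norm m_in) auto
  finally show ?thesis by simp
qed

lemma H_finite: "x \<in> space M \<Longrightarrow> H k x = ennreal (enn2real (H k x))"
  using H_le[of x k] by (metis ennreal_enn2real ennreal_less_top order_le_less_trans)

lemma enn2real_H_le: "x \<in> space M \<Longrightarrow> enn2real (H k x) \<le> c * 2 powr (real k * (real (d m) - 1))"
  using H_le[of x k] c0 by (metis enn2real_leI mult_nonneg_nonneg less_imp_le powr_ge_zero)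

lemma piece_le_H:
  assumes x: "x \<in> space M"
  shows "piece k (F m) x \<le> ennreal (c * 2 powr (real k * (\<beta> - (1 - 1 / r m - \<sigma>))) * enn2real (H k x) powr (1 / r m))"
  using r_sum[unfolded sum_r] H_finite[OF x, of k] r0[OF m_in]
  by (intro piece_le x F_meas m_in F_nonneg) (auto simp: H_def)

lemma piece_le_sup:
  assumes x: "x \<in> space M"
  shows "piece k (F m) x \<le> ennreal (c\<^sup>2 * 2 powr (real k * (K_exp m d r - 1)))"
proof -
  let ?p = "r m"
  have p: "?p > 1" using r[OF m_in] .
  have "enn2real (H k x) powr (1 / ?p) \<le> (c * 2 powr (real k * (real (d m) - 1))) powr (1 / ?p)"
    using p enn2real_H_le[OF x] by (intro powr_mono2) auto
  also have "\<dots> = c powr (1 / ?p) * 2 powr (real k * ((real (d m) - 1) / ?p))"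
    using c0 by (simp add: powr_mult powr_powr)
  also have "\<dots> \<le> c powr 1 * 2 powr (real k * ((real (d m) - 1) / ?p))"
    using p c by (intro mult_right_mono powr_mono) auto
  finally have "c * 2 powr (real k * (\<beta> - (1 - 1 / ?p - \<sigma>))) * enn2real (H k x) powr (1 / ?p)
      \<le> c * 2 powr (real k * (\<beta> - (1 - 1 / ?p - \<sigma>))) * (c * 2 powr (real k * ((real (d m) - 1) / ?p)))"
    using c0 by (intro mult_left_mono) auto
  also have "\<dots> = c\<^sup>2 * (2 powr (real k * (\<beta> - (1 - 1 / ?p - \<sigma>))) * 2 powr (real k * ((real (d m) - 1) / ?p)))"
    by (simp add: power2_eq_square)
  also have "\<dots> = c\<^sup>2 * 2 powr (real k * (K_exp m d r - 1))"
    unfolding powr_add[symmetric] K_exp_eq by (simp add: algebra_simps diff_divide_distrib)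
  finally show ?thesis using piece_le_H[OF x, of k] by (meson ennreal_leI order_trans)
qed

lemma sup_bound:
  assumes K: "K_exp m d r < 1" and x: "x \<in> space M"
  shows "average x \<le> ennreal (c\<^sup>2 * geo_const (1 - K_exp m d r))"
proof -
  let ?\<eta> = "1 - K_exp m d r"
  have "average x \<le> (\<Sum>k. piece k (F m) x)" by (rule average_le_pieces[OF x])
  also have "\<dots> \<le> (\<Sum>k. ennreal (c\<^sup>2) * ennreal (2 powr (- ?\<eta> * \<bar>real k - 0\<bar>)))"
    using piece_le_sup[OF x] by (intro suminf_le) (auto simp: ennreal_mult[symmetric] algebra_simps)
  also have "\<dots> = ennreal (c\<^sup>2) * (\<Sum>k. ennreal (2 powr (- ?\<eta> * \<bar>real k - 0\<bar>)))" by simp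
  also have "\<dots> \<le> ennreal (c\<^sup>2) * ennreal (geo_const ?\<eta>)"
    using K by (intro mult_left_mono sum_two_sided_geometric) auto
  also have "\<dots> = ennreal (c\<^sup>2 * geo_const ?\<eta>)" using geo_const_pos[of ?\<eta>] K by (simp add: ennreal_mult)
  finally show ?thesis .
qed

text \<open>
The pigeonhole principle with center 0 selects a scale, and \<open>H k x powr (q / r m)\<close> is split into one factor
\<open>H k x\<close>, which is integrated, and a power of the supremum of \<open>H k\<close>.  The exponent \<open>\<eta>\<close> measures
the distance to the endpoint; half of it pays for the pigeonhole principle, the other half for the
summation over the scales.
\<close>

lemma subcritical_bound:
  fixes u :: "'a \<Rightarrow> real"
  assumes u0: "\<And>x. 0 \<le> u x" and u: "\<And>x. x \<in> space M \<Longrightarrow> ennreal (u x) \<le> average x"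
    and q: "r m \<le> q" and \<eta>_pos: "0 < q * (1 - K_exp m d r) + real (d m)"
  defines "\<eta> \<equiv> q * (1 - K_exp m d r) + real (d m)"
  defines "\<epsilon> \<equiv> \<eta> / (2 * q)"
  defines "C \<equiv> (2 * geo_const \<epsilon> * c) powr q * c powr (q / r m - 1)"
  shows "(\<integral>\<^sup>+x. ennreal (u x powr q) \<partial>M) \<le> ennreal (C * c * geo_const (\<eta> / 2))"
proof -
  let ?p = "r m"
  define E where "E = q * (\<epsilon> + \<beta> - (1 - 1 / ?p - \<sigma>)) + (real (d m) - 1) * (q / ?p - 1)"
  have p: "?p > 1" using r[OF m_in] .
  have \<eta>: "\<eta> > 0" using \<eta>_pos by (simp add: \<eta>_def)
  have \<epsilon>: "\<epsilon> > 0" using \<eta> p q by (simp add: \<epsilon>_def)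
  have g: "geo_const \<epsilon> > 0" by (rule geo_const_pos[OF \<epsilon>])
  have C0: "C \<ge> 0" by (simp add: C_def)
  have E: "E - 1 = - (\<eta> / 2)"
    using p q by (simp add: E_def \<epsilon>_def \<eta>_def K_exp_eq field_simps)
  have pw: "ennreal (u x powr q) \<le> (\<Sum>k. ennreal (C * 2 powr (real k * E)) * H k x)" if x: "x \<in> space M" for x
  proof (cases "u x = 0")
    case False
    then have ux: "u x > 0" using u0[of x] by simp
    have "ennreal (u x) \<le> (\<Sum>k. piece k (F m) x)"
      using u[OF x] average_le_pieces[OF x] by (rule order_trans)
    then obtain k where k: "ennreal (u x) \<le> ennreal (2 * geo_const \<epsilon> * 2 powr (\<epsilon> * \<bar>real k - 0\<bar>)) * piece k (F m) x"
      using geometric_pigeonhole[OF ux \<epsilon>] by blast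
    define h where "h = enn2real (H k x)"
    have h: "0 \<le> h" "h \<le> c * 2 powr (real k * (real (d m) - 1))"
      using enn2real_H_le[OF x] by (auto simp: h_def)
    note k
    also have "ennreal (2 * geo_const \<epsilon> * 2 powr (\<epsilon> * \<bar>real k - 0\<bar>)) * piece k (F m) x
       \<le> ennreal (2 * geo_const \<epsilon> * 2 powr (\<epsilon> * \<bar>real k - 0\<bar>)) *
         ennreal (c * 2 powr (real k * (\<beta> - (1 - 1 / ?p - \<sigma>))) * h powr (1 / ?p))"
      unfolding h_def by (intro mult_left_mono piece_le_H x) auto
    also have "\<dots> = ennreal ((2 * geo_const \<epsilon> * c) * (2 powr (\<epsilon> * \<bar>real k - 0\<bar>) * 2 powr (real k * (\<beta> - (1 - 1 / ?p - \<sigma>)))) * h powr (1 / ?p))"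
      using g c0 by (subst ennreal_mult[symmetric]) (auto simp: ac_simps)
    also have "2 powr (\<epsilon> * \<bar>real k - 0\<bar>) * 2 powr (real k * (\<beta> - (1 - 1 / ?p - \<sigma>)))
        = 2 powr (real k * (\<epsilon> + \<beta> - (1 - 1 / ?p - \<sigma>)))"
      unfolding powr_add[symmetric] by (simp add: algebra_simps)
    finally have "u x \<le> (2 * geo_const \<epsilon> * c) * 2 powr (real k * (\<epsilon> + \<beta> - (1 - 1 / ?p - \<sigma>))) * h powr (1 / ?p)"
      using g c0 by (subst (asm) ennreal_le_iff) auto
    then have "u x powr q \<le> ((2 * geo_const \<epsilon> * c) * 2 powr (real k * (\<epsilon> + \<beta> - (1 - 1 / ?p - \<sigma>))) * h powr (1 / ?p)) powr q"
      using u0 p q by (intro powr_mono2) auto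
    also have "\<dots> = (2 * geo_const \<epsilon> * c) powr q * 2 powr (real k * (q * (\<epsilon> + \<beta> - (1 - 1 / ?p - \<sigma>)))) * h powr (q / ?p)"
      using g c0 by (simp add: powr_mult powr_powr ac_simps)
    also have "h powr (q / ?p) = h powr (q / ?p - 1) * h"
    proof (cases "h = 0")
      case False
      then have "h powr (q / ?p - 1) * h = h powr (q / ?p - 1) * h powr 1" using h by simp
      then show ?thesis unfolding powr_add[symmetric] by simp
    qed simp
    also have "h powr (q / ?p - 1) \<le> (c * 2 powr (real k * (real (d m) - 1))) powr (q / ?p - 1)"
      using h p q by (intro powr_mono2) auto
    also have "\<dots> = c powr (q / ?p - 1) * 2 powr (real k * ((real (d m) - 1) * (q / ?p - 1)))"
      using c0 by (simp add: powr_mult powr_powr ac_simps)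
    finally have "u x powr q \<le> (2 * geo_const \<epsilon> * c) powr q * 2 powr (real k * (q * (\<epsilon> + \<beta> - (1 - 1 / ?p - \<sigma>))))
        * (c powr (q / ?p - 1) * 2 powr (real k * ((real (d m) - 1) * (q / ?p - 1))) * h)"
      using h(1) by (simp add: mult_left_mono mult_right_mono)
    also have "\<dots> = C * (2 powr (real k * (q * (\<epsilon> + \<beta> - (1 - 1 / ?p - \<sigma>)))) * 2 powr (real k * ((real (d m) - 1) * (q / ?p - 1)))) * h"
      by (simp add: C_def)
    also have "\<dots> = C * 2 powr (real k * E) * h"
      unfolding powr_add[symmetric] E_def by (simp add: algebra_simps)
    finally have "ennreal (u x powr q) \<le> ennreal (C * 2 powr (real k * E) * h)" by (rule ennreal_leI)
    also have "\<dots> = ennreal (C * 2 powr (real k * E)) * H k x"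
      using C0 h(1) by (subst H_finite[OF x, of k], fold h_def) (intro ennreal_mult; auto)
    also have "\<dots> \<le> (\<Sum>k. ennreal (C * 2 powr (real k * E)) * H k x)"
      using sum_le_suminf[of "\<lambda>k. ennreal (C * 2 powr (real k * E)) * H k x" "{k}"] by simp
    finally show ?thesis .
  qed simp
  have Hm: "H k \<in> borel_measurable M" for k
    unfolding H_def using measurable_comp_\<phi>[OF m_in Fm_powr_meas] S_sets[of k]
    by (intro N.borel_measurable_nn_integral) (simp add: case_prod_beta)
  have "(\<integral>\<^sup>+x. ennreal (u x powr q) \<partial>M) \<le> (\<integral>\<^sup>+x. (\<Sum>k. ennreal (C * 2 powr (real k * E)) * H k x) \<partial>M)"
    by (intro nn_integral_mono pw)
  also have "\<dots> = (\<Sum>k. ennreal (C * 2 powr (real k * E)) * (\<integral>\<^sup>+x. H k x \<partial>M))"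
    using Hm by (simp add: nn_integral_suminf nn_integral_cmult)
  also have "\<dots> \<le> (\<Sum>k. ennreal (C * c) * ennreal (2 powr (- (\<eta> / 2) * \<bar>real k - 0\<bar>)))"
  proof (intro suminf_le)
    fix k
    have "(\<integral>\<^sup>+x. H k x \<partial>M) = emeasure N (S k) * (\<integral>\<^sup>+x. ennreal (F m x powr r m) \<partial>M)"
      unfolding H_def by (rule integral_piece_transport[OF m_in Fm_powr_meas S_sets])
    also have "\<dots> \<le> ennreal (c * 2 powr (- real k)) * 1"
      by (intro mult_mono S_small F_norm m_in) auto
    finally have "ennreal (C * 2 powr (real k * E)) * (\<integral>\<^sup>+x. H k x \<partial>M)
        \<le> ennreal (C * 2 powr (real k * E)) * ennreal (c * 2 powr (- real k))"
      by (intro mult_left_mono) auto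
    also have "\<dots> = ennreal (C * c * (2 powr (real k * E) * 2 powr (- real k)))"
      using C0 by (subst ennreal_mult[symmetric]) (auto simp: ac_simps c0 less_imp_le)
    also have "2 powr (real k * E) * 2 powr (- real k) = 2 powr (real k * (E - 1))"
      unfolding powr_add[symmetric] by (simp add: algebra_simps)
    also have "ennreal (C * c * 2 powr (real k * (E - 1))) = ennreal (C * c) * ennreal (2 powr (- (\<eta> / 2) * \<bar>real k - 0\<bar>))"
      unfolding E using C0 c0 by (subst ennreal_mult[symmetric]) (auto simp: ac_simps)
    finally show "ennreal (C * 2 powr (real k * E)) * (\<integral>\<^sup>+x. H k x \<partial>M)
        \<le> ennreal (C * c) * ennreal (2 powr (- (\<eta> / 2) * \<bar>real k - 0\<bar>))" .
  qed auto
  also have "\<dots> = ennreal (C * c) * (\<Sum>k. ennreal (2 powr (- (\<eta> / 2) * \<bar>real k - 0\<bar>)))" by simp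
  also have "\<dots> \<le> ennreal (C * c) * ennreal (geo_const (\<eta> / 2))"
    using \<eta> by (intro mult_left_mono sum_two_sided_geometric) auto
  also have "\<dots> = ennreal (C * c * geo_const (\<eta> / 2))"
    using geo_const_pos[of "\<eta> / 2"] \<eta> C0 c0 by (intro ennreal_mult[symmetric]) auto
  finally show ?thesis .
qed

lemma piece_add:
  assumes x: "x \<in> space M" and g: "g \<in> borel_measurable M" "h \<in> borel_measurable M"
    and g0: "\<And>x. 0 \<le> g x" "\<And>x. 0 \<le> h x" and f: "\<And>x. f x = g x + h x"
  shows "piece k f x = piece k g x + piece k h x"
proof -
  let ?P = "\<lambda>y. \<Prod>i=1..m-1. F i (\<phi> i x y)"
  have P0: "0 \<le> ?P y" for y using F_nonneg by (simp add: prod_nonneg)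
  have P: "?P \<in> borel_measurable N"
    using measurable_section_\<phi>[OF _ F_meas x] by (intro borel_measurable_prod) auto
  have meas: "(\<lambda>y. ennreal (?P y * g' (\<phi> m x y)) * indicator (S k) y) \<in> borel_measurable N"
    if "g' \<in> borel_measurable M" for g' :: "'a \<Rightarrow> real"
    using P measurable_section_\<phi>[OF m_in that x] S_sets[of k] by measurable
  have "piece k f x = (\<integral>\<^sup>+y. ennreal (?P y * g (\<phi> m x y)) * indicator (S k) y
      + ennreal (?P y * h (\<phi> m x y)) * indicator (S k) y \<partial>N)"
    unfolding piece_def f using P0 g0
    by (intro nn_integral_cong) (simp add: distrib_left distrib_right)
  also have "\<dots> = piece k g x + piece k h x"
    unfolding piece_def by (rule nn_integral_add[OF meas[OF g(1)] meas[OF g(2)]])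
  finally show ?thesis .
qed

text \<open>
Here \<open>1 / s\<close> is all the weight that Hoelder's inequality can give to the last function, and \<open>s < r m\<close> is
the assumption \<open>room\<close>.  The identity that makes the endpoint work is \<open>1 / p = 1 / q + a / d m\<close>.
The constants \<open>\<tau>\<close> and \<open>h0\<close> are chosen such that the excluded contributions are at most half of \<open>u\<close>.
\<close>

lemma critical_bound:
  fixes u :: "'a \<Rightarrow> real"
  assumes u0: "\<And>x. 0 \<le> u x" and u: "\<And>x. x \<in> space M \<Longrightarrow> ennreal (u x) \<le> average x"
    and K: "1 < K_exp m d r" and room: "\<sigma> + 1 / r m < 1" and \<kappa>: "\<sigma> + \<beta> < 1"
  defines "p \<equiv> r m" and "q \<equiv> real (d m) / (K_exp m d r - 1)" and "s \<equiv> 1 / (1 - \<sigma>)" and "a \<equiv> 1 - \<sigma> - \<beta>"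
  defines "\<epsilon> \<equiv> min a (K_exp m d r - 1) / 2"
  defines "G \<equiv> 2 * geo_const \<epsilon> * c\<^sup>2"
  defines "\<tau> \<equiv> (1 / (2 * G)) powr (1 / (K_exp m d r - 1))"
  defines "h0 \<equiv> \<tau> powr a / (2 * G)"
  defines "sg \<equiv> q - s - \<epsilon> * s * q / real (d m)"
  defines "T \<equiv> max (\<tau> powr (- real (d m) / q)) (h0 powr (- p / q))"
  defines "C \<equiv> (2 * G) powr s * \<tau> powr (- \<epsilon> * s) * T powr sg"
  shows "(\<integral>\<^sup>+x. ennreal (u x powr q) \<partial>M) \<le> ennreal (C * c * geo_const (min (real (d m) * (1 - s / p)) ((a - \<epsilon>) * s)))"
proof -
  let ?K = "K_exp m d r"
  let ?d = "real (d m)"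
  have d1: "1 \<le> ?d" using d[OF m_in] by simp
  have p1: "1 < p" using r[OF m_in] by (simp add: p_def)
  have \<sigma>1: "\<sigma> < 1" using room r0[OF m_in] by (smt (verit) divide_pos_pos)
  have s: "0 < s" "1 / s = 1 - \<sigma>" using \<sigma>1 by (auto simp: s_def)
  have sp: "s < p"
    using room p1 s \<sigma>1 by (simp add: s_def p_def field_simps)
  have a: "0 < a" using \<kappa> by (simp add: a_def)
  have \<epsilon>: "0 < \<epsilon>" "\<epsilon> < a" "\<epsilon> < ?K - 1" using a K by (auto simp: \<epsilon>_def)
  have q0: "0 < q" using d1 K by (simp add: q_def)
  have q_eq: "1 / p = 1 / q + a / ?d"
    using d1 K p1 by (simp add: q_def a_def K_exp_eq p_def field_simps)
  have qd: "q * (?K - 1) = ?d" using K by (simp add: q_def)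
  have qpa: "q / p - q * a / ?d = 1"
  proof -
    have "q / p = q * (1 / p)" by simp
    also have "\<dots> = 1 + q * a / ?d" unfolding q_eq using q0 by (simp add: distrib_left)
    finally show ?thesis by simp
  qed
  have G: "0 < G" using geo_const_pos[OF \<epsilon>(1)] c0 by (simp add: G_def)
  have \<tau>: "0 < \<tau>" using G by (simp add: \<tau>_def)
  have \<tau>K: "\<tau> powr (?K - 1) = 1 / (2 * G)" using G K by (simp add: \<tau>_def powr_powr)
  have h0: "0 < h0" using G \<tau> by (simp add: h0_def)
  have T: "0 < T" using \<tau> by (simp add: T_def less_max_iff_disj)
  have C0: "0 \<le> C" by (simp add: C_def)
  have sg: "0 < sg"
  proof -
    have "1 / q + \<epsilon> / ?d \<le> 1 / p" unfolding q_eq using \<epsilon> d1 by (simp add: divide_right_mono)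
    also have "\<dots> < 1 / s" using sp s(1) by (simp add: frac_less2)
    finally have "s * q * (1 / q + \<epsilon> / ?d) < s * q * (1 / s)" using s(1) q0 by (intro mult_strict_left_mono) auto
    moreover have "s * q * (1 / q + \<epsilon> / ?d) = s + \<epsilon> * s * q / ?d" using q0 by (simp add: distrib_left ac_simps)
    moreover have "s * q * (1 / s) = q" using s(1) by simp
    ultimately show ?thesis by (simp add: sg_def)
  qed
  define W where "W = (\<lambda>k z. F m z powr s * min (2 powr (real k * ?d / q)) (F m z powr (p / q)) powr sg)"
  have Wmeas: "(\<lambda>x. ennreal (W k x)) \<in> borel_measurable M" for k
    using F_meas[OF m_in] unfolding W_def by measurable
  have W0: "0 \<le> W k z" for k z by (simp add: W_def)
  define V where "V = (\<lambda>k x. \<integral>\<^sup>+y\<in>S k. ennreal (W k (\<phi> m x y)) \<partial>N)"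
  have pw: "ennreal (u x powr q) \<le> (\<Sum>k. ennreal (C * 2 powr (real k * ((\<epsilon> + \<beta>) * s))) * V k x)" if x: "x \<in> space M" for x
  proof (cases "u x = 0")
    case False
    then have ux: "0 < u x" using u0[of x] by simp
    define v where "v = u x"
    have v: "0 < v" using ux by (simp add: v_def)
    define \<theta> where "\<theta> = log 2 (\<tau> * v powr (q / ?d))"
    have \<theta>: "2 powr \<theta> = \<tau> * v powr (q / ?d)" using \<tau> v by (simp add: \<theta>_def)
    have \<theta>p: "2 powr (\<theta> * e) = \<tau> powr e * v powr (q * e / ?d)" for e
      using \<tau> v by (simp add: powr_powr[symmetric] \<theta> powr_mult) (simp add: powr_powr)
    have "ennreal v \<le> (\<Sum>k. piece k (F m) x)"
      unfolding v_def using u[OF x] average_le_pieces[OF x] by (rule order_trans)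
    then obtain k where k: "ennreal v \<le> ennreal (2 * geo_const \<epsilon> * 2 powr (\<epsilon> * \<bar>real k - \<theta>\<bar>)) * piece k (F m) x"
      using geometric_pigeonhole[OF v \<epsilon>(1)] by blast
    have g\<epsilon>: "0 < geo_const \<epsilon>" by (rule geo_const_pos[OF \<epsilon>(1)])
    have k\<theta>: "\<theta> < real k"
    proof (rule ccontr)
      assume "\<not> \<theta> < real k"
      then have le: "real k \<le> \<theta>" by simp
      \<comment> \<open>The uniform bound for the piece excludes the scales up to \<open>\<theta>\<close>.\<close>
      note k
      also have "ennreal (2 * geo_const \<epsilon> * 2 powr (\<epsilon> * \<bar>real k - \<theta>\<bar>)) * piece k (F m) x
          \<le> ennreal (2 * geo_const \<epsilon> * 2 powr (\<epsilon> * \<bar>real k - \<theta>\<bar>)) * ennreal (c\<^sup>2 * 2 powr (real k * (?K - 1)))"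
        by (intro mult_left_mono piece_le_sup x) auto
      also have "\<dots> = ennreal (G * (2 powr (\<epsilon> * \<bar>real k - \<theta>\<bar>) * 2 powr (real k * (?K - 1))))"
        using g\<epsilon> by (subst ennreal_mult[symmetric]) (auto simp: G_def ac_simps)
      finally have "v \<le> G * (2 powr (\<epsilon> * \<bar>real k - \<theta>\<bar>) * 2 powr (real k * (?K - 1)))"
        using G by (subst (asm) ennreal_le_iff) auto
      also have "\<dots> \<le> G * 2 powr (\<theta> * (?K - 1))"
      proof -
        have "\<epsilon> * \<bar>real k - \<theta>\<bar> \<le> (?K - 1) * (\<theta> - real k)" using le \<epsilon> by (auto intro: mult_right_mono)
        then have "\<epsilon> * \<bar>real k - \<theta>\<bar> + real k * (?K - 1) \<le> \<theta> * (?K - 1)" by (simp add: algebra_simps)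
        then show ?thesis unfolding powr_add[symmetric] using G by (intro mult_left_mono powr_mono) auto
      qed
      also have "\<dots> = v / 2" using \<theta>p[of "?K - 1"] qd d1 v G by (simp add: \<tau>K)
      finally show False using v by simp
    qed
    define h where "h = h0 * v powr (q / p)"
    have h: "0 < h" using h0 v by (simp add: h_def)
    \<comment> \<open>The part of \<open>F m\<close> below the threshold contributes at most half of \<open>v\<close>.\<close>
    define lo where "lo = (\<lambda>z. if F m z \<le> h then F m z else 0)"
    define hi where "hi = (\<lambda>z. if F m z \<le> h then 0 else F m z)"
    have lohi: "lo \<in> borel_measurable M" "hi \<in> borel_measurable M"
      using F_meas[OF m_in] unfolding lo_def hi_def by measurable
    have lohi0: "0 \<le> lo z" "0 \<le> hi z" for z using F_nonneg by (auto simp: lo_def hi_def)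
    have split: "piece k (F m) x = piece k lo x + piece k hi x"
      by (rule piece_add[OF x lohi lohi0]) (simp add: lo_def hi_def)
    have lo: "ennreal (2 * geo_const \<epsilon> * 2 powr (\<epsilon> * \<bar>real k - \<theta>\<bar>)) * piece k lo x \<le> ennreal (v / 2)"
    proof -
      have "(\<integral>\<^sup>+y\<in>S k. ennreal (lo (\<phi> m x y) powr s) \<partial>N) \<le> (\<integral>\<^sup>+y\<in>S k. ennreal (h powr s) \<partial>N)"
        using lohi0 s h by (intro nn_integral_mono mult_right_mono ennreal_leI powr_mono2) (auto simp: lo_def)
      also have "\<dots> = ennreal (h powr s) * emeasure N (S k)" using S_sets by (simp add: nn_integral_cmult_indicator)
      also have "\<dots> \<le> ennreal (h powr s) * ennreal (c * 2 powr (- real k))" by (intro mult_left_mono S_small) auto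
      also have "\<dots> = ennreal (h powr s * (c * 2 powr (- real k)))" using c0 by (subst ennreal_mult) auto
      finally have "piece k lo x \<le> ennreal (c * 2 powr (real k * (\<beta> - (1 - 1 / s - \<sigma>))) * (h powr s * (c * 2 powr (- real k))) powr (1 / s))"
        using s c0 by (intro piece_le x lohi lohi0) auto
      also have "(h powr s * (c * 2 powr (- real k))) powr (1 / s) = h * (c powr (1 / s) * 2 powr (- real k * (1 - \<sigma>)))"
        using s(1) h c0 by (simp add: powr_mult powr_powr) (simp add: s(2)[symmetric])
      also have "c * 2 powr (real k * (\<beta> - (1 - 1 / s - \<sigma>))) * (h * (c powr (1 / s) * 2 powr (- real k * (1 - \<sigma>))))
          = c * c powr (1 / s) * h * (2 powr (real k * \<beta>) * 2 powr (- real k * (1 - \<sigma>)))"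
        by (simp add: s(2))
      also have "2 powr (real k * \<beta>) * 2 powr (- real k * (1 - \<sigma>)) = 2 powr (- real k * a)"
        unfolding powr_add[symmetric] by (simp add: a_def algebra_simps)
      also have "c * c powr (1 / s) * h * 2 powr (- real k * a) \<le> c * c powr 1 * h * 2 powr (- real k * a)"
        unfolding s(2) using c c0 h \<sigma>_nonneg by (intro mult_right_mono mult_left_mono powr_mono) auto
      finally have "piece k lo x \<le> ennreal (c * c powr 1 * h * 2 powr (- real k * a))" by (simp add: ennreal_leI)
      then have "ennreal (2 * geo_const \<epsilon> * 2 powr (\<epsilon> * \<bar>real k - \<theta>\<bar>)) * piece k lo x
          \<le> ennreal (2 * geo_const \<epsilon> * 2 powr (\<epsilon> * \<bar>real k - \<theta>\<bar>)) * ennreal (c * c powr 1 * h * 2 powr (- real k * a))"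
        by (intro mult_left_mono) auto
      also have "\<dots> = ennreal (G * h * (2 powr (\<epsilon> * \<bar>real k - \<theta>\<bar>) * 2 powr (- real k * a)))"
        using g\<epsilon> c0 h by (subst ennreal_mult[symmetric]) (auto simp: G_def ac_simps power2_eq_square)
      also have "\<dots> \<le> ennreal (G * h * 2 powr (\<theta> * - a))"
      proof -
        have "\<epsilon> * \<bar>real k - \<theta>\<bar> \<le> a * (real k - \<theta>)" using k\<theta> \<epsilon> by (auto intro: mult_right_mono)
        then have "\<epsilon> * \<bar>real k - \<theta>\<bar> + - real k * a \<le> \<theta> * - a" by (simp add: algebra_simps)
        then show ?thesis unfolding powr_add[symmetric] using G h
          by (intro ennreal_leI mult_left_mono powr_mono) auto
      qed
      also have "G * h * 2 powr (\<theta> * - a) = G * h0 * \<tau> powr (- a) * (v powr (q / p) * v powr (q * - a / ?d))"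
        unfolding \<theta>p h_def by simp
      also have "v powr (q / p) * v powr (q * - a / ?d) = v"
        unfolding powr_add[symmetric] using qpa v by simp
      also have "G * h0 * \<tau> powr (- a) * v = v / 2"
        using \<tau> G by (simp add: h0_def powr_minus field_simps)
      finally show ?thesis .
    qed
    define D where "D = (\<integral>\<^sup>+y\<in>S k. ennreal (hi (\<phi> m x y) powr s) \<partial>N)"
    have "D < \<infinity>"
    proof -
      have "D \<le> (\<integral>\<^sup>+y\<in>S k. ennreal (h powr (s - p)) * ennreal (F m (\<phi> m x y) powr p) \<partial>N)"
        unfolding D_def
      proof (intro nn_integral_mono mult_right_mono)
        fix y
        show "ennreal (hi (\<phi> m x y) powr s) \<le> ennreal (h powr (s - p)) * ennreal (F m (\<phi> m x y) powr p)"
        proof (cases "F m (\<phi> m x y) \<le> h")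
          case False
          then have "F m (\<phi> m x y) powr (s - p) \<le> h powr (s - p)" using h sp by (intro powr_mono2') auto
          then have "F m (\<phi> m x y) powr (s - p) * F m (\<phi> m x y) powr p \<le> h powr (s - p) * F m (\<phi> m x y) powr p"
            by (intro mult_right_mono) auto
          then show ?thesis using False unfolding powr_add[symmetric]
            by (simp add: hi_def ennreal_mult[symmetric] ennreal_leI)
        qed (use s in \<open>simp add: hi_def\<close>)
      qed auto
      also have "\<dots> = ennreal (h powr (s - p)) * H k x"
        unfolding H_def p_def using measurable_section_\<phi>[OF m_in Fm_powr_meas x] S_sets[of k]
        by (subst nn_integral_cmult[symmetric]) (auto simp: mult.assoc)
      also have "\<dots> < \<infinity>"
        by (subst H_finite[OF x]) (simp add: ennreal_mult_less_top)
      finally show ?thesis .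
    qed
    then obtain D' where D': "0 \<le> D'" "D = ennreal D'" by (cases D) auto
    have hi: "ennreal (2 * geo_const \<epsilon> * 2 powr (\<epsilon> * \<bar>real k - \<theta>\<bar>)) * piece k hi x
        \<le> ennreal (G * 2 powr (\<epsilon> * (real k - \<theta>) + real k * \<beta>) * D' powr (1 / s))"
    proof -
      have "piece k hi x \<le> ennreal (c * 2 powr (real k * (\<beta> - (1 - 1 / s - \<sigma>))) * D' powr (1 / s))"
        using s D' by (intro piece_le x lohi lohi0) (auto simp: D_def)
      also have "\<dots> \<le> ennreal (c\<^sup>2 * 2 powr (real k * \<beta>) * D' powr (1 / s))"
        using c s(2) by (intro ennreal_leI mult_right_mono mult_mono) (auto simp: power2_eq_square)
      finally have "ennreal (2 * geo_const \<epsilon> * 2 powr (\<epsilon> * \<bar>real k - \<theta>\<bar>)) * piece k hi x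
         \<le> ennreal (2 * geo_const \<epsilon> * 2 powr (\<epsilon> * \<bar>real k - \<theta>\<bar>)) * ennreal (c\<^sup>2 * 2 powr (real k * \<beta>) * D' powr (1 / s))"
        by (intro mult_left_mono) auto
      also have "\<dots> = ennreal (G * 2 powr (\<epsilon> * (real k - \<theta>) + real k * \<beta>) * D' powr (1 / s))"
        using g\<epsilon> k\<theta> by (subst ennreal_mult[symmetric]) (auto simp: G_def ac_simps powr_add)
      finally show ?thesis .
    qed
    have "ennreal v \<le> ennreal (v / 2) + ennreal (G * 2 powr (\<epsilon> * (real k - \<theta>) + real k * \<beta>) * D' powr (1 / s))"
      using k unfolding split distrib_left by (rule order_trans) (intro add_mono lo hi)
    also have "\<dots> = ennreal (v / 2 + G * 2 powr (\<epsilon> * (real k - \<theta>) + real k * \<beta>) * D' powr (1 / s))"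
      using v G by (intro ennreal_plus[symmetric]) auto
    finally have "v \<le> v / 2 + G * 2 powr (\<epsilon> * (real k - \<theta>) + real k * \<beta>) * D' powr (1 / s)"
      using v G by (subst (asm) ennreal_le_iff) auto
    then have "v \<le> 2 * G * 2 powr (\<epsilon> * (real k - \<theta>) + real k * \<beta>) * D' powr (1 / s)" by simp
    then have "v powr s \<le> (2 * G * 2 powr (\<epsilon> * (real k - \<theta>) + real k * \<beta>) * D' powr (1 / s)) powr s"
      using v s by (intro powr_mono2) auto
    also have "\<dots> = (2 * G) powr s * 2 powr (s * (\<epsilon> * (real k - \<theta>) + real k * \<beta>)) * D'"
      using G s(1) D' by (simp add: powr_mult powr_powr ac_simps)
    also have "2 powr (s * (\<epsilon> * (real k - \<theta>) + real k * \<beta>)) = 2 powr (real k * ((\<epsilon> + \<beta>) * s)) * 2 powr (\<theta> * (- \<epsilon> * s))"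
      unfolding powr_add[symmetric] by (simp add: algebra_simps)
    finally have vs: "v powr s \<le> (2 * G) powr s * (2 powr (real k * ((\<epsilon> + \<beta>) * s)) * (\<tau> powr (- \<epsilon> * s) * v powr (q * (- \<epsilon> * s) / ?d))) * D'"
      unfolding \<theta>p .
    have "v powr q = v powr (q - s) * v powr s" unfolding powr_add[symmetric] by simp
    also have "\<dots> \<le> v powr (q - s) * ((2 * G) powr s * (2 powr (real k * ((\<epsilon> + \<beta>) * s)) * (\<tau> powr (- \<epsilon> * s) * v powr (q * (- \<epsilon> * s) / ?d))) * D')"
      by (intro mult_left_mono vs) auto
    also have "\<dots> = (2 * G) powr s * \<tau> powr (- \<epsilon> * s) * 2 powr (real k * ((\<epsilon> + \<beta>) * s)) * ((v powr (q - s) * v powr (q * (- \<epsilon> * s) / ?d)) * D')"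
      by (simp only: ac_simps)
    also have "v powr (q - s) * v powr (q * (- \<epsilon> * s) / ?d) = v powr sg"
      unfolding powr_add[symmetric] by (simp add: sg_def ac_simps)
    finally have vq: "v powr q \<le> (2 * G) powr s * \<tau> powr (- \<epsilon> * s) * 2 powr (real k * ((\<epsilon> + \<beta>) * s)) * (v powr sg * D')" .
    have vT: "ennreal (v powr sg) * D \<le> ennreal (T powr sg) * V k x"
    proof -
      \<comment> \<open>Both \<open>\<theta> < k\<close> and \<open>h < F m z\<close> are upper bounds for \<open>v\<close>, so the power of \<open>v\<close> can be replaced by a weight that does not depend on \<open>x\<close>.\<close>
      have bound: "v powr sg * hi z powr s \<le> T powr sg * W k z" for z
      proof (cases "F m z \<le> h")
        case False
        have "\<tau> * v powr (q / ?d) < 2 powr real k" unfolding \<theta>[symmetric] using k\<theta> by simp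
        then have "v powr (q / ?d) \<le> 2 powr real k / \<tau>" using \<tau> by (simp add: field_simps)
        then have "(v powr (q / ?d)) powr (?d / q) \<le> (2 powr real k / \<tau>) powr (?d / q)"
          using q0 by (intro powr_mono2) auto
        then have v1: "v \<le> \<tau> powr (- ?d / q) * 2 powr (real k * ?d / q)"
          using q0 d1 v \<tau> by (simp add: powr_powr powr_divide powr_minus field_simps)
        have "h0 * v powr (q / p) \<le> F m z" using False by (simp add: h_def)
        then have "v powr (q / p) \<le> F m z / h0" using h0 by (simp add: field_simps)
        then have "(v powr (q / p)) powr (p / q) \<le> (F m z / h0) powr (p / q)"
          using q0 p1 by (intro powr_mono2) auto
        then have v2: "v \<le> h0 powr (- p / q) * F m z powr (p / q)"
          using q0 p1 v h0 F_nonneg by (simp add: powr_powr powr_divide powr_minus field_simps)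
        have "v \<le> T * 2 powr (real k * ?d / q)"
          using v1 by (rule order_trans) (auto intro!: mult_right_mono simp: T_def)
        moreover have "v \<le> T * F m z powr (p / q)"
          using v2 by (rule order_trans) (auto intro!: mult_right_mono simp: T_def)
        ultimately have "v \<le> T * min (2 powr (real k * ?d / q)) (F m z powr (p / q))" by (auto simp: min_def)
        then have "v powr sg \<le> (T * min (2 powr (real k * ?d / q)) (F m z powr (p / q))) powr sg"
          using v sg by (intro powr_mono2) auto
        also have "\<dots> = T powr sg * min (2 powr (real k * ?d / q)) (F m z powr (p / q)) powr sg"
          by (rule powr_mult)
        finally have "v powr sg * F m z powr s \<le> T powr sg * min (2 powr (real k * ?d / q)) (F m z powr (p / q)) powr sg * F m z powr s"
          by (intro mult_right_mono) auto
        then show ?thesis using False by (simp add: W_def hi_def ac_simps)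
      qed (simp add: hi_def W0)
      have "ennreal (v powr sg) * D = (\<integral>\<^sup>+y\<in>S k. ennreal (v powr sg) * ennreal (hi (\<phi> m x y) powr s) \<partial>N)"
        unfolding D_def using measurable_section_\<phi>[OF m_in lohi(2) x] S_sets[of k]
        by (subst nn_integral_cmult[symmetric]) (auto simp: mult.assoc)
      also have "\<dots> \<le> (\<integral>\<^sup>+y\<in>S k. ennreal (T powr sg) * ennreal (W k (\<phi> m x y)) \<partial>N)"
        using bound W0 by (intro nn_integral_mono mult_right_mono) (auto simp: ennreal_mult[symmetric] intro!: ennreal_leI)
      also have "\<dots> = ennreal (T powr sg) * V k x"
        unfolding V_def using measurable_section_\<phi>[OF m_in Wmeas x] S_sets[of k]
        by (subst nn_integral_cmult[symmetric]) (auto simp: mult.assoc)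
      finally show ?thesis .
    qed
    let ?A = "(2 * G) powr s * \<tau> powr (- \<epsilon> * s) * 2 powr (real k * ((\<epsilon> + \<beta>) * s))"
    have "ennreal (v powr q) \<le> ennreal (?A * (v powr sg * D'))" by (intro ennreal_leI vq)
    also have "\<dots> = ennreal ?A * (ennreal (v powr sg) * D)"
      using D' by (simp add: ennreal_mult[symmetric])
    also have "\<dots> \<le> ennreal ?A * (ennreal (T powr sg) * V k x)" by (intro mult_left_mono vT) auto
    also have "\<dots> = ennreal (?A * T powr sg) * V k x"
      by (subst mult.assoc[symmetric], subst ennreal_mult[symmetric]) auto
    also have "?A * T powr sg = C * 2 powr (real k * ((\<epsilon> + \<beta>) * s))" by (simp add: C_def)
    also have "ennreal (C * 2 powr (real k * ((\<epsilon> + \<beta>) * s))) * V k x \<le> (\<Sum>k. ennreal (C * 2 powr (real k * ((\<epsilon> + \<beta>) * s))) * V k x)"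
      using sum_le_suminf[of "\<lambda>k. ennreal (C * 2 powr (real k * ((\<epsilon> + \<beta>) * s))) * V k x" "{k}"] by simp
    finally show ?thesis unfolding v_def .
  qed simp
  have Vm: "V k \<in> borel_measurable M" for k
    unfolding V_def using measurable_comp_\<phi>[OF m_in Wmeas] S_sets[of k]
    by (intro N.borel_measurable_nn_integral) (simp add: case_prod_beta)
  define b where "b = (a - \<epsilon>) * s"
  define \<alpha> where "\<alpha> = ?d * (1 - s / p)"
  have b: "0 < b" using \<epsilon> s by (simp add: b_def)
  have \<alpha>: "0 < \<alpha>" using sp s d1 by (simp add: \<alpha>_def)
  have \<alpha>_eq: "\<alpha> + b = ?d * sg / q"
  proof -
    have "\<alpha> = ?d * (1 - s * (1 / q + a / ?d))" unfolding \<alpha>_def q_eq[symmetric] by simp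
    then show ?thesis using q0 d1 by (simp add: b_def sg_def field_simps)
  qed
  have b_eq: "(\<epsilon> + \<beta>) * s - 1 = - b"
    using s \<sigma>1 by (simp add: b_def a_def s_def field_simps)
  have sumW: "(\<Sum>k. ennreal (2 powr (real k * - b) * W k z)) \<le> ennreal (geo_const (min \<alpha> b)) * ennreal (F m z powr p)" for z
  proof (cases "F m z = 0")
    case True
    then show ?thesis by (simp add: W_def)
  next
    case False
    then have Fz: "0 < F m z" using F_nonneg[of m z] by simp
    \<comment> \<open>The scale at which the two terms of the minimum in \<open>W\<close> agree; the series decays on both sides of it.\<close>
    define t where "t = p / ?d * log 2 (F m z)"
    have t: "2 powr (t * e) = F m z powr (p * e / ?d)" for e
    proof -
      have "2 powr (t * e) = (2 powr log 2 (F m z)) powr (p * e / ?d)" by (simp add: powr_powr t_def ac_simps)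
      then show ?thesis using Fz by simp
    qed
    have "2 powr (real k * - b) * W k z \<le> F m z powr p * 2 powr (- min \<alpha> b * \<bar>real k - t\<bar>)" for k
    proof -
      have "min (2 powr (real k * ?d / q)) (F m z powr (p / q)) = 2 powr (min (real k) t * (?d / q))"
      proof -
        have "F m z powr (p / q) = 2 powr (t * (?d / q))" using t[of "?d / q"] d1 by simp
        moreover have "real k * (?d / q) \<le> t * (?d / q) \<longleftrightarrow> real k \<le> t"
          using d1 q0 by (intro mult_le_cancel_right_pos) auto
        ultimately show ?thesis by (auto simp: min_def)
      qed
      then have "2 powr (real k * - b) * W k z = F m z powr s * (2 powr (real k * - b) * 2 powr (min (real k) t * (?d * sg / q)))"
        by (simp add: W_def powr_powr mult.assoc)
      also have "2 powr (real k * - b) * 2 powr (min (real k) t * (?d * sg / q)) = 2 powr (t * \<alpha>) * 2 powr (min (real k) t * (\<alpha> + b) - real k * b - t * \<alpha>)"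
        unfolding \<alpha>_eq[symmetric] powr_add[symmetric] by simp
      also have "2 powr (min (real k) t * (\<alpha> + b) - real k * b - t * \<alpha>) \<le> 2 powr (- min \<alpha> b * \<bar>real k - t\<bar>)"
      proof (intro powr_mono)
        show "min (real k) t * (\<alpha> + b) - real k * b - t * \<alpha> \<le> - min \<alpha> b * \<bar>real k - t\<bar>"
        proof (cases "real k \<le> t")
          case True
          then have "min \<alpha> b * (t - real k) \<le> \<alpha> * (t - real k)" by (intro mult_right_mono) auto
          then show ?thesis using True by (simp add: algebra_simps)
        next
          case False
          then have "min \<alpha> b * (real k - t) \<le> b * (real k - t)" by (intro mult_right_mono) auto
          then show ?thesis using False by (simp add: algebra_simps)
        qed
      qed simp
      also have "2 powr (t * \<alpha>) = F m z powr (p - s)"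
      proof -
        have "p * \<alpha> / ?d = p - s" using d1 p1 by (simp add: \<alpha>_def right_diff_distrib diff_divide_distrib)
        then show ?thesis unfolding t by simp
      qed
      also have "F m z powr s * (F m z powr (p - s) * 2 powr (- min \<alpha> b * \<bar>real k - t\<bar>)) = F m z powr p * 2 powr (- min \<alpha> b * \<bar>real k - t\<bar>)"
        by (subst mult.assoc[symmetric], subst powr_add[symmetric]) simp
      finally show ?thesis by (simp add: mult_left_mono)
    qed
    then have "(\<Sum>k. ennreal (2 powr (real k * - b) * W k z)) \<le> (\<Sum>k. ennreal (F m z powr p) * ennreal (2 powr (- min \<alpha> b * \<bar>real k - t\<bar>)))"
      by (intro suminf_le) (auto simp: ennreal_mult[symmetric] intro!: ennreal_leI)
    also have "\<dots> = ennreal (F m z powr p) * (\<Sum>k. ennreal (2 powr (- min \<alpha> b * \<bar>real k - t\<bar>)))" by simp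
    also have "\<dots> \<le> ennreal (F m z powr p) * ennreal (geo_const (min \<alpha> b))"
      using \<alpha> b by (intro mult_left_mono sum_two_sided_geometric) auto
    finally show ?thesis by (simp add: mult.commute)
  qed
  have "(\<integral>\<^sup>+x. ennreal (u x powr q) \<partial>M) \<le> (\<integral>\<^sup>+x. (\<Sum>k. ennreal (C * 2 powr (real k * ((\<epsilon> + \<beta>) * s))) * V k x) \<partial>M)"
    by (intro nn_integral_mono pw)
  also have "\<dots> = (\<Sum>k. ennreal (C * 2 powr (real k * ((\<epsilon> + \<beta>) * s))) * (\<integral>\<^sup>+x. V k x \<partial>M))"
    using Vm by (simp add: nn_integral_suminf nn_integral_cmult)
  also have "\<dots> \<le> (\<Sum>k. ennreal (C * c) * (\<integral>\<^sup>+x. ennreal (2 powr (real k * - b) * W k x) \<partial>M))"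
  proof (intro suminf_le)
    fix k
    have "(\<integral>\<^sup>+x. V k x \<partial>M) = emeasure N (S k) * (\<integral>\<^sup>+x. ennreal (W k x) \<partial>M)"
      unfolding V_def by (rule integral_piece_transport[OF m_in Wmeas S_sets])
    also have "\<dots> \<le> ennreal (c * 2 powr (- real k)) * (\<integral>\<^sup>+x. ennreal (W k x) \<partial>M)"
      by (intro mult_right_mono S_small) auto
    finally have "ennreal (C * 2 powr (real k * ((\<epsilon> + \<beta>) * s))) * (\<integral>\<^sup>+x. V k x \<partial>M)
        \<le> ennreal (C * 2 powr (real k * ((\<epsilon> + \<beta>) * s))) * (ennreal (c * 2 powr (- real k)) * (\<integral>\<^sup>+x. ennreal (W k x) \<partial>M))"
      by (intro mult_left_mono) auto
    also have "\<dots> = ennreal (C * c * (2 powr (real k * ((\<epsilon> + \<beta>) * s)) * 2 powr (- real k))) * (\<integral>\<^sup>+x. ennreal (W k x) \<partial>M)"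
      using C0 c0 by (subst mult.assoc[symmetric], subst ennreal_mult[symmetric]) (auto simp: ac_simps)
    also have "2 powr (real k * ((\<epsilon> + \<beta>) * s)) * 2 powr (- real k) = 2 powr (real k * - b)"
      unfolding powr_add[symmetric] b_eq[symmetric] by (simp add: algebra_simps)
    also have "ennreal (C * c * 2 powr (real k * - b)) * (\<integral>\<^sup>+x. ennreal (W k x) \<partial>M)
        = ennreal (C * c) * (ennreal (2 powr (real k * - b)) * (\<integral>\<^sup>+x. ennreal (W k x) \<partial>M))"
      using C0 c0 by (subst mult.assoc[symmetric], subst ennreal_mult[symmetric]) auto
    also have "ennreal (2 powr (real k * - b)) * (\<integral>\<^sup>+x. ennreal (W k x) \<partial>M) = (\<integral>\<^sup>+x. ennreal (2 powr (real k * - b) * W k x) \<partial>M)"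
      using Wmeas W0 by (subst nn_integral_cmult[symmetric]) (auto simp: ennreal_mult)
    finally show "ennreal (C * 2 powr (real k * ((\<epsilon> + \<beta>) * s))) * (\<integral>\<^sup>+x. V k x \<partial>M)
        \<le> ennreal (C * c) * (\<integral>\<^sup>+x. ennreal (2 powr (real k * - b) * W k x) \<partial>M)" .
  qed auto
  also have "\<dots> = ennreal (C * c) * (\<Sum>k. \<integral>\<^sup>+x. ennreal (2 powr (real k * - b) * W k x) \<partial>M)" by simp
  also have "(\<Sum>k. \<integral>\<^sup>+x. ennreal (2 powr (real k * - b) * W k x) \<partial>M) = (\<integral>\<^sup>+x. (\<Sum>k. ennreal (2 powr (real k * - b) * W k x)) \<partial>M)"
    using Wmeas W0 by (intro nn_integral_suminf[symmetric]) (auto simp: ennreal_mult)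
  also have "\<dots> \<le> (\<integral>\<^sup>+x. ennreal (geo_const (min \<alpha> b)) * ennreal (F m x powr p) \<partial>M)"
    by (intro nn_integral_mono sumW)
  also have "\<dots> = ennreal (geo_const (min \<alpha> b)) * (\<integral>\<^sup>+x. ennreal (F m x powr p) \<partial>M)"
    by (rule nn_integral_cmult[OF Fm_powr_meas])
  also have "\<dots> \<le> ennreal (geo_const (min \<alpha> b)) * 1"
    unfolding p_def by (intro mult_left_mono F_norm m_in) auto
  also have "ennreal (C * c) * (ennreal (geo_const (min \<alpha> b)) * 1) = ennreal (C * c * geo_const (min \<alpha> b))"
    using C0 c0 geo_const_pos[of "min \<alpha> b"] \<alpha> b by (simp add: ennreal_mult[symmetric])
  finally show ?thesis by (simp add: mult_left_mono \<alpha>_def b_def)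
qed

lemma average_measurable: "average \<in> borel_measurable M"
proof -
  have "(\<lambda>p. ennreal (\<Prod>i=1..m. F i (\<phi> i (fst p) (snd p)))) \<in> borel_measurable (M \<Otimes>\<^sub>M N)"
    using measurable_comp_\<phi>[OF _ F_meas] by (intro measurable_compose[OF borel_measurable_prod measurable_ennreal]) auto
  then show ?thesis unfolding average_def[abs_def]
    by (intro N.borel_measurable_nn_integral) (simp add: case_prod_beta)
qed

text \<open>
The bound at \<open>p_star\<close> applied to the functions that are \<open>n\<close> where the average is infinite and 0
elsewhere.
\<close>

lemma AE_average_finite: "AE x in M. average x < \<infinity>"
proof -
  let ?A = "{x \<in> space M. average x = \<infinity>}"
  have A: "?A \<in> sets M" using average_measurable by measurable
  have ps: "0 < p_star m r"
    using m r0 unfolding p_star_def by (intro divide_pos_pos sum_pos) auto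
  have "(\<Sum>i=1..m. 1 / r i) > 0" using m r0 by (intro sum_pos) auto
  then have p1: "1 \<le> p_star m r" using r_sum by (simp add: p_star_def)
  have le: "emeasure M ?A \<le> ennreal (inverse (real (Suc n)))" for n
  proof -
    let ?t = "real (Suc n) powr p_star m r"
    have "(\<integral>\<^sup>+x. ennreal ((real (Suc n) * indicator ?A x) powr p_star m r) \<partial>M) \<le> 1"
      by (intro trivial_bound) (auto split: split_indicator)
    also have "(\<integral>\<^sup>+x. ennreal ((real (Suc n) * indicator ?A x) powr p_star m r) \<partial>M)
        = (\<integral>\<^sup>+x. ennreal ?t * indicator ?A x \<partial>M)"
      using ps by (intro nn_integral_cong) (auto split: split_indicator)
    also have "\<dots> = ennreal ?t * emeasure M ?A" using A by (rule nn_integral_cmult_indicator)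
    finally have 1: "ennreal ?t * emeasure M ?A \<le> 1" .
    have "emeasure M ?A = ennreal (1 / ?t) * (ennreal ?t * emeasure M ?A)"
      by (subst mult.assoc[symmetric], subst ennreal_mult[symmetric]) auto
    also have "\<dots> \<le> ennreal (1 / ?t) * 1" using 1 by (intro mult_left_mono) auto
    also have "\<dots> \<le> ennreal (inverse (real (Suc n)))"
    proof -
      have "real (Suc n) powr 1 \<le> ?t" using p1 by (intro powr_mono) auto
      then have "1 / ?t \<le> 1 / real (Suc n)" by (intro divide_left_mono) auto
      then show ?thesis by (simp add: ennreal_leI inverse_eq_divide)
    qed
    finally show ?thesis .
  qed
  have "(\<lambda>n. ennreal (inverse (real (Suc n)))) \<longlonglongrightarrow> ennreal 0"
    by (intro tendsto_ennrealI LIMSEQ_inverse_real_of_nat)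
  then have "emeasure M ?A \<le> ennreal 0" by (rule LIMSEQ_le_const) (use le in auto)
  then have "emeasure M ?A = 0" by simp
  then show ?thesis using A
    by (intro AE_I[of _ _ ?A]) (auto simp: less_top[symmetric])
qed

end

section \<open>Polynomials over a ring with an ultrametric absolute value\<close>

locale nonarch_ring = cring R for R (structure) +
  fixes v :: "'a \<Rightarrow> real"
  assumes v_nonneg: "x \<in> carrier R \<Longrightarrow> 0 \<le> v x"
    and v_eq_0: "x \<in> carrier R \<Longrightarrow> v x = 0 \<longleftrightarrow> x = \<zero>"
    and v_one: "v \<one> = 1"
    and v_mult: "x \<in> carrier R \<Longrightarrow> y \<in> carrier R \<Longrightarrow> v (x \<otimes> y) = v x * v y"
    and v_add: "x \<in> carrier R \<Longrightarrow> y \<in> carrier R \<Longrightarrow> v (x \<oplus> y) \<le> max (v x) (v y)"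
begin

lemma v_zero: "v \<zero> = 0" using v_eq_0[of \<zero>] by simp

lemma v_a_inv: "x \<in> carrier R \<Longrightarrow> v (\<ominus> x) = v x"
proof -
  assume x: "x \<in> carrier R"
  have "v (\<ominus> \<one>) * v (\<ominus> \<one>) = v (\<ominus> \<one> \<otimes> \<ominus> \<one>)" by (simp add: v_mult)
  also have "\<ominus> \<one> \<otimes> \<ominus> \<one> = \<one>" by algebra
  finally have "v (\<ominus> \<one>) * v (\<ominus> \<one>) = 1" by (simp add: v_one)
  then have 1: "v (\<ominus> \<one>) = 1" using v_nonneg[of "\<ominus> \<one>"] by (simp add: square_eq_1_iff)
  have "v (\<ominus> x) = v (\<ominus> \<one> \<otimes> x)" using x by algebra
  also have "\<dots> = v x" using x 1 by (simp add: v_mult)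
  finally show ?thesis .
qed

lemma v_diff: "x \<in> carrier R \<Longrightarrow> y \<in> carrier R \<Longrightarrow> v (x \<ominus> y) \<le> max (v x) (v y)"
  using v_add[of x "\<ominus> y"] by (simp add: a_minus_def v_a_inv)

lemma v_diff_commute: "x \<in> carrier R \<Longrightarrow> y \<in> carrier R \<Longrightarrow> v (x \<ominus> y) = v (y \<ominus> x)"
proof -
  assume xy: "x \<in> carrier R" "y \<in> carrier R"
  have "x \<ominus> y = \<ominus> (y \<ominus> x)" using xy by algebra
  then show ?thesis using xy by (simp add: v_a_inv)
qed

lemma v_triangle:
  "x \<in> carrier R \<Longrightarrow> y \<in> carrier R \<Longrightarrow> z \<in> carrier R \<Longrightarrow> v (x \<ominus> z) \<le> max (v (x \<ominus> y)) (v (y \<ominus> z))"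
proof -
  assume xyz: "x \<in> carrier R" "y \<in> carrier R" "z \<in> carrier R"
  have "x \<ominus> z = (x \<ominus> y) \<oplus> (y \<ominus> z)" using xyz by algebra
  then show ?thesis using xyz v_add[of "x \<ominus> y" "y \<ominus> z"] by simp
qed

lemma minus_minus_cancel: "x \<in> carrier R \<Longrightarrow> z \<in> carrier R \<Longrightarrow> x \<ominus> (x \<ominus> z) = z"
  by algebra

lemma minus_plus_cancel: "x \<in> carrier R \<Longrightarrow> z \<in> carrier R \<Longrightarrow> (x \<ominus> z) \<oplus> z = x"
  by algebra

text \<open>
Coefficient lists with the constant coefficient first, so that Horner's scheme, the derivative and
synthetic division are all primitive recursive.
\<close>

primrec poly_val :: "'a list \<Rightarrow> 'a \<Rightarrow> 'a" where
  "poly_val [] x = \<zero>"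
| "poly_val (b # q) x = b \<oplus> x \<otimes> poly_val q x"

primrec poly_deriv :: "'a list \<Rightarrow> 'a \<Rightarrow> 'a" where
  "poly_deriv [] x = \<zero>"
| "poly_deriv (b # q) x = poly_val q x \<oplus> x \<otimes> poly_deriv q x"

text \<open>
Synthetic division: the coefficients of the quotient of \<open>P(x) - P(z)\<close> by \<open>x - z\<close>.
\<close>

primrec diff_quot :: "'a \<Rightarrow> 'a list \<Rightarrow> 'a list" where
  "diff_quot z [] = []"
| "diff_quot z (b # q) = (if q = [] then [] else poly_val q z # diff_quot z q)"

text \<open>
For lists of different lengths the value is a default, cut off at the end of the shorter list.
\<close>

fun coeff_add :: "'a list \<Rightarrow> 'a list \<Rightarrow> 'a list" where
  "coeff_add (a # p) (b # q) = (a \<oplus> b) # coeff_add p q"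
| "coeff_add p q = []"

primrec deriv_coeffs :: "'a list \<Rightarrow> 'a list" where
  "deriv_coeffs [] = []"
| "deriv_coeffs (b # q) = (if q = [] then [] else coeff_add q (\<zero> # deriv_coeffs q))"

lemma poly_val_closed [simp, intro]: "set p \<subseteq> carrier R \<Longrightarrow> x \<in> carrier R \<Longrightarrow> poly_val p x \<in> carrier R"
  by (induction p) auto

lemma poly_deriv_closed [simp, intro]: "set p \<subseteq> carrier R \<Longrightarrow> x \<in> carrier R \<Longrightarrow> poly_deriv p x \<in> carrier R"
  by (induction p) auto

lemma diff_quot_closed: "set p \<subseteq> carrier R \<Longrightarrow> z \<in> carrier R \<Longrightarrow> set (diff_quot z p) \<subseteq> carrier R"
  by (induction p) auto

lemma length_diff_quot [simp]: "length (diff_quot z p) = length p - 1"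
  by (induction p) auto

lemma last_diff_quot: "set p \<subseteq> carrier R \<Longrightarrow> z \<in> carrier R \<Longrightarrow> 2 \<le> length p \<Longrightarrow> last (diff_quot z p) = last p"
proof (induction p)
  case (Cons b q)
  show ?case
  proof (cases "2 \<le> length q")
    case True
    then have "diff_quot z q \<noteq> []" by (metis One_nat_def Suc_1 diff_is_0_eq length_0_conv length_diff_quot not_less_eq_eq)
    then show ?thesis using Cons True by auto
  next
    case False
    then obtain c where "q = [c]" using Cons.prems by (cases q) (auto simp: Suc_le_eq)
    then show ?thesis using Cons.prems by simp
  qed
qed simp

lemma poly_val_diff:
  assumes "set p \<subseteq> carrier R" "y \<in> carrier R" "z \<in> carrier R"
  shows "poly_val p y \<ominus> poly_val p z = (y \<ominus> z) \<otimes> poly_val (diff_quot z p) y"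
  using assms(1)
proof (induction p)
  case Nil
  then show ?case using assms(2,3) by (simp add: a_minus_def)
next
  case (Cons b q)
  show ?case
  proof (cases "q = []")
    case True
    then show ?thesis using Cons.prems assms(2,3) by simp algebra
  next
    case False
    have c: "b \<in> carrier R" "poly_val q y \<in> carrier R" "poly_val q z \<in> carrier R" "poly_val (diff_quot z q) y \<in> carrier R"
      using Cons.prems assms(2,3) diff_quot_closed[of q z] by auto
    have "poly_val (b # q) y \<ominus> poly_val (b # q) z = y \<otimes> (poly_val q y \<ominus> poly_val q z) \<oplus> (y \<ominus> z) \<otimes> poly_val q z"
      using c assms(2,3) by simp algebra
    also have "poly_val q y \<ominus> poly_val q z = (y \<ominus> z) \<otimes> poly_val (diff_quot z q) y" using Cons by simp
    also have "y \<otimes> ((y \<ominus> z) \<otimes> poly_val (diff_quot z q) y) \<oplus> (y \<ominus> z) \<otimes> poly_val q z = (y \<ominus> z) \<otimes> (poly_val q z \<oplus> y \<otimes> poly_val (diff_quot z q) y)"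
      using c assms(2,3) by algebra
    finally show ?thesis using False by simp
  qed
qed

lemma poly_deriv_diff_quot:
  assumes "set p \<subseteq> carrier R" "y \<in> carrier R" "z \<in> carrier R"
  shows "poly_deriv p y = poly_val (diff_quot z p) y \<oplus> (y \<ominus> z) \<otimes> poly_deriv (diff_quot z p) y"
  using assms(1)
proof (induction p)
  case Nil
  then show ?case using assms(2,3) by simp
next
  case (Cons b q)
  show ?case
  proof (cases "q = []")
    case True
    then show ?thesis using Cons.prems assms(2,3) by simp
  next
    case False
    have q: "b \<in> carrier R" "set q \<subseteq> carrier R" using Cons.prems by auto
    have c: "b \<in> carrier R" "poly_val q y \<in> carrier R" "poly_val q z \<in> carrier R" "poly_val (diff_quot z q) y \<in> carrier R" "poly_deriv (diff_quot z q) y \<in> carrier R"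
      using q diff_quot_closed[OF q(2) assms(3)] assms(2,3) by simp_all
    have d: "poly_val q y = poly_val q z \<oplus> (y \<ominus> z) \<otimes> poly_val (diff_quot z q) y"
    proof -
      have "poly_val q y = poly_val q z \<oplus> (poly_val q y \<ominus> poly_val q z)" using c by algebra
      also have "poly_val q y \<ominus> poly_val q z = (y \<ominus> z) \<otimes> poly_val (diff_quot z q) y" using Cons.prems assms(2,3) by (intro poly_val_diff) auto
      finally show ?thesis .
    qed
    have "poly_deriv (b # q) y = poly_val q y \<oplus> y \<otimes> (poly_val (diff_quot z q) y \<oplus> (y \<ominus> z) \<otimes> poly_deriv (diff_quot z q) y)"
      using Cons.IH[OF q(2)] by simp
    also have "\<dots> = (poly_val q z \<oplus> y \<otimes> poly_val (diff_quot z q) y) \<oplus> (y \<ominus> z) \<otimes> (poly_val (diff_quot z q) y \<oplus> y \<otimes> poly_deriv (diff_quot z q) y)"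
      unfolding d using c assms(2,3) by algebra
    finally show ?thesis using False by simp
  qed
qed

lemma length_coeff_add [simp]: "length (coeff_add p q) = min (length p) (length q)"
  by (induction p q rule: coeff_add.induct) auto

lemma coeff_add_closed: "set p \<subseteq> carrier R \<Longrightarrow> set q \<subseteq> carrier R \<Longrightarrow> set (coeff_add p q) \<subseteq> carrier R"
  by (induction p q rule: coeff_add.induct) auto

lemma poly_val_coeff_add:
  assumes x: "x \<in> carrier R"
  shows "set p \<subseteq> carrier R \<Longrightarrow> set q \<subseteq> carrier R \<Longrightarrow> length p = length q \<Longrightarrow> poly_val (coeff_add p q) x = poly_val p x \<oplus> poly_val q x"
proof (induction p q rule: coeff_add.induct)
  case (1 a p b q)
  have c: "a \<in> carrier R" "b \<in> carrier R" "poly_val p x \<in> carrier R" "poly_val q x \<in> carrier R" using 1 x by auto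
  have "poly_val (coeff_add (a # p) (b # q)) x = (a \<oplus> b) \<oplus> x \<otimes> (poly_val p x \<oplus> poly_val q x)" using 1 by simp
  also have "\<dots> = (a \<oplus> x \<otimes> poly_val p x) \<oplus> (b \<oplus> x \<otimes> poly_val q x)" using c x by algebra
  finally show ?case by simp
qed auto

lemma last_coeff_add: "length p = length q \<Longrightarrow> p \<noteq> [] \<Longrightarrow> last (coeff_add p q) = last p \<oplus> last q"
proof (induction p q rule: coeff_add.induct)
  case (1 a p b q)
  then show ?case by (cases p; cases q) auto
qed auto

lemma length_deriv_coeffs [simp]: "length (deriv_coeffs p) = length p - 1"
  by (induction p) auto

lemma deriv_coeffs_closed: "set p \<subseteq> carrier R \<Longrightarrow> set (deriv_coeffs p) \<subseteq> carrier R"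
  by (induction p) (auto dest!: subsetD[OF coeff_add_closed, rotated 2])

lemma poly_val_deriv_coeffs:
  assumes x: "x \<in> carrier R"
  shows "set p \<subseteq> carrier R \<Longrightarrow> poly_val (deriv_coeffs p) x = poly_deriv p x"
proof (induction p)
  case (Cons b q)
  show ?case
  proof (cases "q = []")
    case False
    have "poly_val (coeff_add q (\<zero> # deriv_coeffs q)) x = poly_val q x \<oplus> poly_val (\<zero> # deriv_coeffs q) x"
      using Cons.prems deriv_coeffs_closed[of q] x False by (intro poly_val_coeff_add) auto
    then have "poly_val (deriv_coeffs (b # q)) x = poly_val q x \<oplus> poly_val (\<zero> # deriv_coeffs q) x" using False by simp
    also have "\<dots> = poly_deriv (b # q) x" using Cons x by simp
    finally show ?thesis .
  qed (use x in simp)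
qed simp

lemma last_deriv_coeffs: "set p \<subseteq> carrier R \<Longrightarrow> 2 \<le> length p \<Longrightarrow> last (deriv_coeffs p) = add_pow R (length p - 1) (last p)"
proof (induction p)
  case (Cons b q)
  then have q: "q \<noteq> []" by auto
  then have "last q \<in> set q" by simp
  then have q: "q \<noteq> []" "last q \<in> carrier R" using Cons.prems(1) q by auto
  have "last (coeff_add q (\<zero> # deriv_coeffs q)) = last q \<oplus> last (\<zero> # deriv_coeffs q)"
    using q(1) by (intro last_coeff_add) (auto simp: Suc_le_eq)
  then have "last (deriv_coeffs (b # q)) = last q \<oplus> last (\<zero> # deriv_coeffs q)" using q by simp
  also have "last (\<zero> # deriv_coeffs q) = add_pow R (length q - 1) (last q)"
  proof (cases "2 \<le> length q")
    case True
    then have "deriv_coeffs q \<noteq> []" by (metis One_nat_def Suc_1 diff_is_0_eq length_0_conv length_deriv_coeffs not_less_eq_eq)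
    then show ?thesis using Cons True by simp
  next
    case False
    moreover have "0 < length q" using q(1) by simp
    ultimately have "length q = 1" by linarith
    then show ?thesis by (cases q) auto
  qed
  also have "last q \<oplus> add_pow R (length q - 1) (last q) = add_pow R (Suc (length q - 1)) (last q)"
    unfolding add.nat_pow_Suc using q(2) by (intro a_comm add.nat_pow_closed)
  finally show ?case using q by (cases "length q") auto
qed simp

lemma v_poly_val_le:
  assumes x: "x \<in> carrier R" "v x \<le> 1"
  shows "set p \<subseteq> carrier R \<Longrightarrow> 0 \<le> B \<Longrightarrow> (\<And>c. c \<in> set p \<Longrightarrow> v c \<le> B) \<Longrightarrow> v (poly_val p x) \<le> B"
proof (induction p)
  case (Cons b q)
  have c: "b \<in> carrier R" "poly_val q x \<in> carrier R" using Cons.prems x by auto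
  have "v (x \<otimes> poly_val q x) \<le> 1 * B"
    unfolding v_mult[OF x(1) c(2)] using Cons x c by (intro mult_mono v_nonneg) auto
  moreover have "v b \<le> B" using Cons.prems(3)[of b] by simp
  ultimately have "max (v b) (v (x \<otimes> poly_val q x)) \<le> B" by simp
  then show ?case using v_add[of b "x \<otimes> poly_val q x"] c x by (auto intro: order_trans)
qed (simp add: v_zero)

lemma v_coeff_coeff_add_le:
  "set p \<subseteq> carrier R \<Longrightarrow> set q \<subseteq> carrier R \<Longrightarrow> (\<And>c. c \<in> set p \<union> set q \<Longrightarrow> v c \<le> B) \<Longrightarrow> c \<in> set (coeff_add p q) \<Longrightarrow> v c \<le> B"
proof (induction p q rule: coeff_add.induct)
  case (1 a p b q)
  have ab: "a \<in> carrier R" "b \<in> carrier R" "set p \<subseteq> carrier R" "set q \<subseteq> carrier R" using 1(2,3) by simp_all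
  have "max (v a) (v b) \<le> B" using 1(4)[of a] 1(4)[of b] by simp
  with v_add[OF ab(1,2)] have "v (a \<oplus> b) \<le> B" by (rule order_trans)
  moreover have "v c \<le> B" if "c \<in> set (coeff_add p q)"
    using ab 1(4) that by (intro 1(1)) auto
  ultimately show ?case using 1(5) by auto
qed auto

lemma v_coeff_deriv_coeffs_le:
  "set p \<subseteq> carrier R \<Longrightarrow> 0 \<le> B \<Longrightarrow> (\<And>c. c \<in> set p \<Longrightarrow> v c \<le> B) \<Longrightarrow> c \<in> set (deriv_coeffs p) \<Longrightarrow> v c \<le> B"
proof (induction p arbitrary: c)
  case (Cons b q)
  show ?case
  proof (cases "q = []")
    case False
    then have "c \<in> set (coeff_add q (\<zero> # deriv_coeffs q))" using Cons.prems by simp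
    then show ?thesis using Cons deriv_coeffs_closed[of q]
      by (elim v_coeff_coeff_add_le[rotated 3]) (auto simp: v_zero)
  qed (use Cons in simp)
qed simp

text \<open>
Over an algebraic closure, \<open>P' / P\<close> is the sum of the reciprocals of \<open>y - a\<close> over the roots \<open>a\<close>, so that
\<open>\<bar>P(y)\<bar> \<le> \<rho> \<bar>P'(y)\<bar>\<close> puts \<open>y\<close> within distance \<open>\<rho>\<close> of one of the at most \<open>n\<close> roots.  The following induction on the
degree reaches the same count without roots: if \<open>z\<close> is a point of \<open>Y\<close> at which \<open>\<bar>P\<bar>\<close> is smallest, the
other points satisfy the hypothesis for the difference quotient of \<open>P\<close> at \<open>z\<close>.
\<close>

lemma card_separated_le:
  assumes "set cs \<subseteq> carrier R" "length cs \<le> Suc n" "0 < \<rho>" "finite Y" "Y \<subseteq> carrier R"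
    and "\<And>y z. y \<in> Y \<Longrightarrow> z \<in> Y \<Longrightarrow> y \<noteq> z \<Longrightarrow> \<rho> < v (y \<ominus> z)"
    and "\<And>y. y \<in> Y \<Longrightarrow> poly_deriv cs y \<noteq> \<zero>"
    and "\<And>y. y \<in> Y \<Longrightarrow> v (poly_val cs y) \<le> \<rho> * v (poly_deriv cs y)"
  shows "card Y \<le> n"
  using assms
proof (induction n arbitrary: cs Y)
  case 0
  have "Y = {}"
  proof (rule ccontr)
    assume "Y \<noteq> {}"
    then obtain y where y: "y \<in> Y" by auto
    have "poly_deriv cs y = \<zero>"
      using 0(1,2,5) y by (cases cs) auto
    then show False using 0(7) y by blast
  qed
  then show ?case by simp
next
  case (Suc n)
  note cs = Suc.prems(1) and len = Suc.prems(2) and \<rho> = Suc.prems(3) and fin = Suc.prems(4) and Y = Suc.prems(5)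
    and sep = Suc.prems(6) and nz = Suc.prems(7) and le = Suc.prems(8)
  show ?case
  proof (cases "Y = {}")
    case False
    obtain z where z: "z \<in> Y" "\<And>y. y \<in> Y \<Longrightarrow> v (poly_val cs z) \<le> v (poly_val cs y)"
      using arg_min_if_finite(1)[OF fin False, of "\<lambda>y. v (poly_val cs y)"] arg_min_least[OF fin False, of _ "\<lambda>y. v (poly_val cs y)"]
      by blast
    have zc: "z \<in> carrier R" using z Y by auto
    have "card (Y - {z}) \<le> n"
    proof (rule Suc.IH)
      show "set (diff_quot z cs) \<subseteq> carrier R" by (rule diff_quot_closed[OF cs zc])
      show "length (diff_quot z cs) \<le> Suc n" using len by simp
      fix y assume y: "y \<in> Y - {z}"
      then have yc: "y \<in> carrier R" using Y by auto
      let ?t = "v (y \<ominus> z)" and ?R = "v (poly_val (diff_quot z cs) y)" and ?R' = "v (poly_deriv (diff_quot z cs) y)"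
      have cl: "poly_val (diff_quot z cs) y \<in> carrier R" "poly_deriv (diff_quot z cs) y \<in> carrier R" "y \<ominus> z \<in> carrier R"
        using diff_quot_closed[OF cs zc] yc zc by auto
      have t: "\<rho> < ?t" using sep y z(1) by auto
      have "?t * ?R = v (poly_val cs y \<ominus> poly_val cs z)" unfolding poly_val_diff[OF cs yc zc] using cl by (simp add: v_mult)
      also have "\<dots> \<le> max (v (poly_val cs y)) (v (poly_val cs z))" using cs yc zc by (intro v_diff) auto
      also have "\<dots> = v (poly_val cs y)" using z(2)[of y] y by auto
      also have "\<dots> \<le> \<rho> * v (poly_deriv cs y)" using le y by auto
      finally have 1: "?t * ?R \<le> \<rho> * v (poly_deriv cs y)" .
      have 2: "v (poly_deriv cs y) \<le> max ?R (?t * ?R')"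
        unfolding poly_deriv_diff_quot[OF cs yc zc] using cl v_add[of "poly_val (diff_quot z cs) y" "(y \<ominus> z) \<otimes> poly_deriv (diff_quot z cs) y"] by (simp add: v_mult)
      have pos: "0 < v (poly_deriv cs y)"
        using nz[of y] y v_eq_0[of "poly_deriv cs y"] v_nonneg[of "poly_deriv cs y"] cs yc by (auto simp: less_le)
      have R0: "0 \<le> ?R" "0 \<le> ?R'" using cl by (auto intro: v_nonneg)
      have 3: "?R < ?t * ?R'"
      proof (rule ccontr)
        assume "\<not> ?R < ?t * ?R'"
        then have a: "v (poly_deriv cs y) \<le> ?R" using 2 by auto
        then have "?t * ?R \<le> \<rho> * ?R" using 1 \<rho> by (meson less_imp_le mult_left_mono order_trans)
        then have "?R \<le> 0" using t by (simp add: mult_le_cancel_right)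
        then show False using a pos by simp
      qed
      then have "?t * ?R' > 0" using R0 by simp
      then have R': "0 < ?R'" using R0 by (auto simp: zero_less_mult_iff)
      then show "poly_deriv (diff_quot z cs) y \<noteq> \<zero>" using v_zero by auto
      have "v (poly_deriv cs y) \<le> ?t * ?R'" using 2 3 by simp
      then have "\<rho> * v (poly_deriv cs y) \<le> \<rho> * (?t * ?R')" using \<rho> by simp
      then have "?t * ?R \<le> \<rho> * (?t * ?R')" using 1 by (rule order_trans[rotated])
      then show "?R \<le> \<rho> * ?R'" using t \<rho> by (simp add: mult.left_commute)
    qed (use \<rho> fin Y sep in auto)
    then show ?thesis using z(1) fin by (simp add: card_Diff_singleton)
  qed simp
qed

end

section \<open>Balls, Haar measure and sublevel sets of polynomials\<close>

text \<open>
The properties of p-adic numbers and of Haar measure that the estimates need: the absolute value is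
discrete, there is a countable dense set, each ball of radius \<open>p\<close> to the power \<open>- j\<close> around 0 is the disjoint union of \<open>p\<close>
balls of the next smaller radius (expansion by digits), and \<open>\<nu>\<close> is a translation invariant Borel
measure.
\<close>

locale padic_haar = nonarch_ring +
  fixes p :: nat and Q :: "'a set" and \<nu> :: "'a measure"
  assumes p: "2 \<le> p"
    and v_values: "x \<in> carrier R \<Longrightarrow> v x = 0 \<or> (\<exists>n::int. v x = real p powi n)"
    and Q: "countable Q" "Q \<subseteq> carrier R"
    and Q_dense: "x \<in> carrier R \<Longrightarrow> 0 < e \<Longrightarrow> \<exists>z\<in>Q. v (x \<ominus> z) \<le> e"
    and digits: "\<And>j::nat. \<exists>D\<subseteq>carrier R. finite D \<and> card D = p \<and>
        (\<forall>x\<in>carrier R. v x \<le> (1 / p) ^ j \<longleftrightarrow> (\<exists>a\<in>D. v (x \<ominus> a) \<le> (1 / p) ^ Suc j)) \<and>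
        (\<forall>a\<in>D. \<forall>b\<in>D. a \<noteq> b \<longrightarrow> (1 / p) ^ Suc j < v (a \<ominus> b))"
    and space_\<nu>: "space \<nu> = carrier R"
    and sets_\<nu>: "sets \<nu> = sigma_sets (carrier R) {U. U \<subseteq> carrier R \<and>
        (\<forall>x\<in>U. \<exists>e>0. \<forall>y\<in>carrier R. v (y \<ominus> x) < e \<longrightarrow> y \<in> U)}"
    and \<nu>_translate: "a \<in> carrier R \<Longrightarrow> E \<in> sets \<nu> \<Longrightarrow> emeasure \<nu> ((\<lambda>x. a \<oplus> x) ` E) = emeasure \<nu> E"
    and \<nu>_unit: "emeasure \<nu> {x \<in> carrier R. v x \<le> 1} = 1"
begin

definition vball :: "'a \<Rightarrow> real \<Rightarrow> 'a set" where "vball z e = {x \<in> carrier R. v (x \<ominus> z) \<le> e}"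

definition padic_open_set :: "'a set \<Rightarrow> bool" where
  "padic_open_set U \<longleftrightarrow> U \<subseteq> carrier R \<and> (\<forall>x\<in>U. \<exists>e>0. \<forall>y\<in>carrier R. v (y \<ominus> x) < e \<longrightarrow> y \<in> U)"

lemma sets_\<nu>_open: "sets \<nu> = sigma_sets (carrier R) {U. padic_open_set U}"
  by (simp add: sets_\<nu> padic_open_set_def)

lemma open_sets: "padic_open_set U \<Longrightarrow> U \<in> sets \<nu>"
  by (auto simp: sets_\<nu>_open)

abbreviation \<delta> :: "nat \<Rightarrow> real" where "\<delta> j \<equiv> (1 / real p) ^ j"

lemma \<delta>_pos: "0 < \<delta> j" using p by simp

lemma \<delta>_antimono: "i \<le> j \<Longrightarrow> \<delta> j \<le> \<delta> i" using p by (intro power_decreasing) auto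

lemma \<delta>_small: "0 < e \<Longrightarrow> \<exists>j. \<delta> j < e"
  using real_arch_pow_inv[of e "1 / real p"] p by auto

lemma v_minus_self: "x \<in> carrier R \<Longrightarrow> v (x \<ominus> x) = 0"
  using v_zero by (simp add: a_minus_def r_neg)

lemma vball_carrier: "vball z e \<subseteq> carrier R" by (auto simp: vball_def)

lemma v_triangle_le:
  "x \<in> carrier R \<Longrightarrow> y \<in> carrier R \<Longrightarrow> z \<in> carrier R \<Longrightarrow> v (x \<ominus> y) \<le> e \<Longrightarrow> v (y \<ominus> z) \<le> e \<Longrightarrow> v (x \<ominus> z) \<le> e"
  using v_triangle[of x y z] by (auto intro: order_trans)

lemma vball_eq:
  assumes "x \<in> carrier R" "z \<in> carrier R" "v (x \<ominus> z) \<le> e"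
  shows "vball x e = vball z e"
  using assms v_triangle_le[of _ x z e] v_triangle_le[of _ z x e] v_diff_commute[of x z] by (auto simp: vball_def)

lemma open_vball: "z \<in> carrier R \<Longrightarrow> 0 < e \<Longrightarrow> padic_open_set (vball z e)"
  unfolding padic_open_set_def
proof (intro conjI ballI vball_carrier)
  fix x assume z: "z \<in> carrier R" "0 < e" and x: "x \<in> vball z e"
  then have "\<forall>y\<in>carrier R. v (y \<ominus> x) < e \<longrightarrow> y \<in> vball z e"
    using v_triangle_le[of _ x z e] by (auto simp: vball_def)
  then show "\<exists>e'>0. \<forall>y\<in>carrier R. v (y \<ominus> x) < e' \<longrightarrow> y \<in> vball z e" using z by auto
qed

lemma vball_sets [measurable]: "z \<in> carrier R \<Longrightarrow> 0 < e \<Longrightarrow> vball z e \<in> sets \<nu>"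
  by (intro open_sets open_vball)

lemma translate_vball:
  assumes "z \<in> carrier R"
  shows "(\<lambda>x. z \<oplus> x) ` vball \<zero> e = vball z e"
proof (intro Set.set_eqI iffI)
  fix x assume "x \<in> (\<lambda>x. z \<oplus> x) ` vball \<zero> e"
  then obtain y where y: "y \<in> carrier R" "v (y \<ominus> \<zero>) \<le> e" "x = z \<oplus> y" by (auto simp: vball_def)
  have "z \<oplus> y \<ominus> z = y \<ominus> \<zero>" using y(1) assms by algebra
  then show "x \<in> vball z e" using y assms by (simp add: vball_def)
next
  fix x assume x: "x \<in> vball z e"
  then have c: "x \<in> carrier R" by (simp add: vball_def)
  have "x = z \<oplus> (x \<ominus> z)" "x \<ominus> z = (x \<ominus> z) \<ominus> \<zero>" using c assms by algebra+
  then show "x \<in> (\<lambda>x. z \<oplus> x) ` vball \<zero> e" using x c assms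
    by (intro image_eqI[of _ _ "x \<ominus> z"]) (auto simp: vball_def)
qed

lemma emeasure_vball_translate: "z \<in> carrier R \<Longrightarrow> 0 < e \<Longrightarrow> emeasure \<nu> (vball z e) = emeasure \<nu> (vball \<zero> e)"
  using \<nu>_translate[of z "vball \<zero> e"] by (simp add: translate_vball vball_sets)

lemma minus_zero: "x \<in> carrier R \<Longrightarrow> x \<ominus> \<zero> = x" by algebra

text \<open>
The \<open>p\<close> balls of radius \<open>\<delta> (Suc j)\<close> that make up a ball of radius \<open>\<delta> j\<close> are translates of each other.
\<close>

lemma emeasure_vball0: "emeasure \<nu> (vball \<zero> (\<delta> j)) = ennreal (\<delta> j)"
proof (induction j)
  case 0
  have "vball \<zero> 1 = {x \<in> carrier R. v x \<le> 1}" by (auto simp: vball_def minus_zero)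
  then show ?case using \<nu>_unit by simp
next
  case (Suc j)
  from digits[of j] obtain D where D': "D \<subseteq> carrier R" "finite D \<and> card D = p \<and>
      (\<forall>x\<in>carrier R. v x \<le> \<delta> j \<longleftrightarrow> (\<exists>a\<in>D. v (x \<ominus> a) \<le> \<delta> (Suc j))) \<and>
      (\<forall>a\<in>D. \<forall>b\<in>D. a \<noteq> b \<longrightarrow> \<delta> (Suc j) < v (a \<ominus> b))"
    by (elim exE) (erule conjE, rule that)
  note D = D'(1) conjunct1[OF D'(2)] conjunct1[OF conjunct2[OF D'(2)]]
  have cov: "v x \<le> \<delta> j \<longleftrightarrow> (\<exists>a\<in>D. v (x \<ominus> a) \<le> \<delta> (Suc j))" if "x \<in> carrier R" for x
    using conjunct1[OF conjunct2[OF conjunct2[OF D'(2)]]] that by (rule bspec)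
  have sep: "\<delta> (Suc j) < v (a \<ominus> b)" if "a \<in> D" "b \<in> D" "a \<noteq> b" for a b
    using conjunct2[OF conjunct2[OF conjunct2[OF D'(2)]]] that by blast
  have un: "vball \<zero> (\<delta> j) = (\<Union>a\<in>D. vball a (\<delta> (Suc j)))"
    using cov by (auto simp: vball_def minus_zero simp del: power_Suc)
  have disj: "disjoint_family_on (\<lambda>a. vball a (\<delta> (Suc j))) D"
    unfolding disjoint_family_on_def
  proof (intro ballI impI)
    fix a b assume ab: "a \<in> D" "b \<in> D" "a \<noteq> b"
    show "vball a (\<delta> (Suc j)) \<inter> vball b (\<delta> (Suc j)) = {}"
    proof (rule ccontr)
      assume "\<not> ?thesis"
      then obtain x where x: "x \<in> carrier R" "v (x \<ominus> a) \<le> \<delta> (Suc j)" "v (x \<ominus> b) \<le> \<delta> (Suc j)"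
        by (auto simp: vball_def simp del: power_Suc)
      then have "v (a \<ominus> b) \<le> \<delta> (Suc j)"
        using ab D v_triangle_le[of a x b "\<delta> (Suc j)"] v_diff_commute[of a x] by (auto simp del: power_Suc)
      then show False using sep[OF ab] by simp
    qed
  qed
  have meas: "vball a (\<delta> (Suc j)) \<in> sets \<nu>" if "a \<in> D" for a
    using that D \<delta>_pos[of "Suc j"] by (intro vball_sets) auto
  have "ennreal (\<delta> j) = (\<Sum>a\<in>D. emeasure \<nu> (vball a (\<delta> (Suc j))))"
    unfolding Suc[symmetric] un using meas disj D by (intro sum_emeasure[symmetric]) (auto simp del: power_Suc)
  also have "\<dots> = (\<Sum>a\<in>D. emeasure \<nu> (vball \<zero> (\<delta> (Suc j))))"
    using D \<delta>_pos[of "Suc j"] by (intro sum.cong refl emeasure_vball_translate) auto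
  also have "\<dots> = of_nat p * emeasure \<nu> (vball \<zero> (\<delta> (Suc j)))" using D by simp
  finally have eq: "of_nat p * emeasure \<nu> (vball \<zero> (\<delta> (Suc j))) = ennreal (\<delta> j)" ..
  have "ennreal (\<delta> (Suc j)) = ennreal (1 / p) * (ennreal p * emeasure \<nu> (vball \<zero> (\<delta> (Suc j))))"
    using eq by (simp add: ennreal_of_nat_eq_real_of_nat ennreal_mult[symmetric])
  also have "\<dots> = emeasure \<nu> (vball \<zero> (\<delta> (Suc j)))"
    using p by (subst mult.assoc[symmetric], subst ennreal_mult[symmetric]) auto
  finally show ?case ..
qed

lemma emeasure_vball: "z \<in> carrier R \<Longrightarrow> emeasure \<nu> (vball z (\<delta> j)) = ennreal (\<delta> j)"
  using emeasure_vball_translate[OF _ \<delta>_pos] emeasure_vball0 by simp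

definition Z :: "'a set" where "Z = {x \<in> carrier R. v x \<le> 1}"

lemma Z_eq: "Z = vball \<zero> 1" by (auto simp: Z_def vball_def minus_zero)

lemma Z_sets [measurable]: "Z \<in> sets \<nu>" by (simp add: Z_eq vball_sets)

lemma emeasure_Z: "emeasure \<nu> Z = 1" using \<nu>_unit by (simp add: Z_def)

text \<open>
A ball of radius \<open>\<rho> < 1\<close> is also the ball of radius \<open>\<delta> j\<close> for the largest \<open>\<delta> j \<le> \<rho>\<close>, because the absolute value is
discrete; for \<open>\<rho> \<ge> 1\<close> the measure 1 of \<open>Z\<close> suffices.  This is where the constants become independent of \<open>p\<close>.
\<close>

lemma emeasure_Z_vball_le:
  assumes z: "z \<in> carrier R" and \<rho>: "0 < \<rho>"
  shows "emeasure \<nu> (Z \<inter> vball z \<rho>) \<le> ennreal \<rho>"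
proof (cases "1 \<le> \<rho>")
  case True
  have "emeasure \<nu> (Z \<inter> vball z \<rho>) \<le> emeasure \<nu> Z" by (intro emeasure_mono) auto
  also have "\<dots> \<le> ennreal \<rho>" using True by (simp add: emeasure_Z ennreal_1[symmetric] del: ennreal_1)
  finally show ?thesis .
next
  case False
  define j where "j = (LEAST j. \<delta> j \<le> \<rho>)"
  have ex: "\<exists>j. \<delta> j \<le> \<rho>" using \<delta>_small[OF \<rho>] less_imp_le by blast
  have j: "\<delta> j \<le> \<rho>" unfolding j_def using ex by (rule LeastI_ex)
  have "j \<noteq> 0" using j False by (metis power_0)
  then obtain i where i: "j = Suc i" by (cases j) auto
  have \<rho>i: "\<rho> < \<delta> i" using not_less_Least[of i "\<lambda>j. \<delta> j \<le> \<rho>"] i by (auto simp: j_def not_le)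
  have "vball z \<rho> \<subseteq> vball z (\<delta> j)"
  proof
    fix x assume x: "x \<in> vball z \<rho>"
    then have c: "x \<in> carrier R" "x \<ominus> z \<in> carrier R" using z by (auto simp: vball_def)
    have "v (x \<ominus> z) \<le> \<delta> j"
    proof (cases "v (x \<ominus> z) = 0")
      case True then show ?thesis using \<delta>_pos[of j] by simp
    next
      case False
      then obtain n :: int where n: "v (x \<ominus> z) = real p powi n" using v_values[OF c(2)] by auto
      have "real p powi n < \<delta> i" using x n \<rho>i by (simp add: vball_def)
      also have "\<delta> i = real p powi (- int i)" by (simp add: power_int_minus power_one_over inverse_eq_divide)
      finally have lt: "real p powi n < real p powi (- int i)" .
      have "n < - int i"
      proof (rule ccontr)
        assume "\<not> n < - int i"
        then have "real p powi (- int i) \<le> real p powi n" using p by (intro power_int_increasing) auto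
        then show False using lt by simp
      qed
      then have "real p powi n \<le> real p powi (- int j)" using p i by (intro power_int_increasing) auto
      then show ?thesis unfolding n by (simp add: power_int_minus power_one_over inverse_eq_divide)
    qed
    then show "x \<in> vball z (\<delta> j)" using c by (simp add: vball_def)
  qed
  then have "emeasure \<nu> (Z \<inter> vball z \<rho>) \<le> emeasure \<nu> (vball z (\<delta> j))"
    using z \<delta>_pos by (intro emeasure_mono vball_sets) auto
  also have "\<dots> \<le> ennreal \<rho>" using j by (simp add: emeasure_vball[OF z] ennreal_leI)
  finally show ?thesis .
qed

lemma countable_cover:
  assumes "x \<in> carrier R"
  obtains z where "z \<in> Q" "x \<in> vball z (\<delta> j)"
  using Q_dense[OF assms \<delta>_pos[of j]] assms by (auto simp: vball_def)

lemma Q_carrier: "z \<in> Q \<Longrightarrow> z \<in> carrier R" using Q by auto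

lemma sigma_finite_\<nu>: "sigma_finite_measure \<nu>"
proof
  show "\<exists>A. countable A \<and> A \<subseteq> sets \<nu> \<and> \<Union> A = space \<nu> \<and> (\<forall>a\<in>A. emeasure \<nu> a \<noteq> \<infinity>)"
  proof (intro exI conjI)
    show "countable ((\<lambda>z. vball z (\<delta> 0)) ` Q)" using Q by auto
    show "(\<lambda>z. vball z (\<delta> 0)) ` Q \<subseteq> sets \<nu>" using Q_carrier \<delta>_pos[of 0] by (auto intro!: vball_sets)
    show "\<Union> ((\<lambda>z. vball z (\<delta> 0)) ` Q) = space \<nu>"
    proof (rule equalityI)
      show "\<Union> ((\<lambda>z. vball z (\<delta> 0)) ` Q) \<subseteq> space \<nu>" using vball_carrier by (auto simp: space_\<nu>)
      show "space \<nu> \<subseteq> \<Union> ((\<lambda>z. vball z (\<delta> 0)) ` Q)"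
      proof
        fix x assume "x \<in> space \<nu>"
        then obtain z where "z \<in> Q" "x \<in> vball z (\<delta> 0)" using countable_cover[of x 0] by (auto simp: space_\<nu>)
        then show "x \<in> \<Union> ((\<lambda>z. vball z (\<delta> 0)) ` Q)" by blast
      qed
    qed
    show "\<forall>a\<in>(\<lambda>z. vball z (\<delta> 0)) ` Q. emeasure \<nu> a \<noteq> \<infinity>"
      using emeasure_vball[OF Q_carrier, of _ 0] by auto
  qed
qed

lemma open_as_union:
  assumes "padic_open_set U"
  shows "U = (\<Union>b\<in>{(z, j). z \<in> Q \<and> vball z (\<delta> j) \<subseteq> U}. vball (fst b) (\<delta> (snd b)))"
proof (intro Set.set_eqI iffI)
  fix x assume x: "x \<in> U"
  then have xc: "x \<in> carrier R" using assms by (auto simp: padic_open_set_def)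
  obtain e where e: "e > 0" "\<And>y. y \<in> carrier R \<Longrightarrow> v (y \<ominus> x) < e \<Longrightarrow> y \<in> U"
    using assms x unfolding padic_open_set_def by blast
  obtain j where j: "\<delta> j < e" using \<delta>_small[OF e(1)] by auto
  obtain z where z: "z \<in> Q" "x \<in> vball z (\<delta> j)" using countable_cover[OF xc] .
  have "vball z (\<delta> j) = vball x (\<delta> j)" using z xc Q_carrier by (intro vball_eq[symmetric]) (auto simp: vball_def)
  then have "vball z (\<delta> j) \<subseteq> U" using e j by (auto simp: vball_def)
  then show "x \<in> (\<Union>b\<in>{(z, j). z \<in> Q \<and> vball z (\<delta> j) \<subseteq> U}. vball (fst b) (\<delta> (snd b)))" using z by force
qed auto

lemma measurable_vballI:
  assumes f: "f \<in> space L \<rightarrow> carrier R"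
    and vball: "\<And>z j. z \<in> carrier R \<Longrightarrow> f -` vball z (\<delta> j) \<inter> space L \<in> sets L"
  shows "f \<in> L \<rightarrow>\<^sub>M \<nu>"
proof (rule measurable_sigma_sets[OF sets_\<nu>_open _ f])
  show "{U. padic_open_set U} \<subseteq> Pow (carrier R)" by (auto simp: padic_open_set_def)
  fix U assume "U \<in> {U. padic_open_set U}"
  then have U: "padic_open_set U" by simp
  let ?I = "{(z, j). z \<in> Q \<and> vball z (\<delta> j) \<subseteq> U}"
  have "countable ?I" by (rule countable_subset[of _ "Q \<times> UNIV"]) (use Q in auto)
  moreover have "f -` U \<inter> space L = (\<Union>b\<in>?I. f -` vball (fst b) (\<delta> (snd b)) \<inter> space L)"
    using open_as_union[OF U] by blast
  ultimately show "f -` U \<inter> space L \<in> sets L"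
    using vball Q_carrier by (simp only:, intro sets.countable_UN'') auto
qed

text \<open>
The carrier is not a topological type, so continuity is spelled out.
\<close>

definition v_continuous :: "('a \<Rightarrow> 'a) \<Rightarrow> bool" where
  "v_continuous f \<longleftrightarrow> f \<in> carrier R \<rightarrow> carrier R \<and>
    (\<forall>x\<in>carrier R. \<forall>e>0. \<exists>e'>0. \<forall>y\<in>carrier R. v (y \<ominus> x) \<le> e' \<longrightarrow> v (f y \<ominus> f x) \<le> e)"

lemma v_continuous_measurable:
  assumes "v_continuous f" shows "f \<in> \<nu> \<rightarrow>\<^sub>M \<nu>"
proof (rule measurable_vballI)
  show "f \<in> space \<nu> \<rightarrow> carrier R" using assms by (auto simp: v_continuous_def space_\<nu>)
  fix z and j :: nat assume z: "z \<in> carrier R"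
  have "padic_open_set (f -` vball z (\<delta> j) \<inter> space \<nu>)"
    unfolding padic_open_set_def
  proof (intro conjI ballI)
    fix x assume x: "x \<in> f -` vball z (\<delta> j) \<inter> space \<nu>"
    then have xc: "x \<in> carrier R" by (simp add: space_\<nu>)
    then obtain e where e: "e > 0" "\<And>y. y \<in> carrier R \<Longrightarrow> v (y \<ominus> x) \<le> e \<Longrightarrow> v (f y \<ominus> f x) \<le> \<delta> j"
      using assms \<delta>_pos[of j] unfolding v_continuous_def by meson
    have fc: "f y \<in> carrier R" if "y \<in> carrier R" for y using assms that by (auto simp: v_continuous_def)
    have "y \<in> f -` vball z (\<delta> j) \<inter> space \<nu>" if y: "y \<in> carrier R" "v (y \<ominus> x) < e" for y
      using v_triangle_le[OF fc[OF y(1)] fc[OF xc] z, of "\<delta> j"] e(2)[OF y(1)] y x fc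
      by (auto simp: vball_def space_\<nu>)
    then show "\<exists>e>0. \<forall>y\<in>carrier R. v (y \<ominus> x) < e \<longrightarrow> y \<in> f -` vball z (\<delta> j) \<inter> space \<nu>" using e(1) by auto
  qed (auto simp: space_\<nu>)
  then show "f -` vball z (\<delta> j) \<inter> space \<nu> \<in> sets \<nu>" by (rule open_sets)
qed

lemma v_continuous_poly_val:
  assumes "set cs \<subseteq> carrier R" shows "v_continuous (poly_val cs)"
  using assms
proof (induction cs)
  case Nil
  then show ?case by (auto simp: v_continuous_def v_minus_self intro: exI[of _ 1])
next
  case (Cons b q)
  have q: "b \<in> carrier R" "set q \<subseteq> carrier R" "v_continuous (poly_val q)" using Cons by auto
  show ?case unfolding v_continuous_def
  proof (intro conjI ballI allI impI)
    show "poly_val (b # q) \<in> carrier R \<rightarrow> carrier R" using q by auto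
    fix x e :: real assume "0 < e" fix x assume x: "x \<in> carrier R"
    define m where "m = max 1 (v x)"
    define m' where "m' = max 1 (v (poly_val q x))"
    have m: "1 \<le> m" "v x \<le> m" "1 \<le> m'" "v (poly_val q x) \<le> m'" by (auto simp: m_def m'_def)
    have "\<exists>e'>0. \<forall>y\<in>carrier R. v (y \<ominus> x) \<le> e' \<longrightarrow> v (poly_val q y \<ominus> poly_val q x) \<le> e / m"
      using q(3) x \<open>0 < e\<close> m(1) unfolding v_continuous_def by simp
    then obtain e1 where e1: "e1 > 0" "\<And>y. y \<in> carrier R \<Longrightarrow> v (y \<ominus> x) \<le> e1 \<Longrightarrow> v (poly_val q y \<ominus> poly_val q x) \<le> e / m"
      by blast
    define e2 where "e2 = min e1 (min 1 (e / m'))"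
    have "v (poly_val (b # q) y \<ominus> poly_val (b # q) x) \<le> e" if y: "y \<in> carrier R" "v (y \<ominus> x) \<le> e2" for y
    proof -
      have c: "poly_val q x \<in> carrier R" "poly_val q y \<in> carrier R" using q x y by auto
      have vy: "v y \<le> m"
      proof -
        have "y = (y \<ominus> x) \<oplus> x" using x y(1) by algebra
        then have "v y \<le> max (v (y \<ominus> x)) (v x)" using v_add[of "y \<ominus> x" x] x y(1) by simp
        also have "\<dots> \<le> m" using y(2) by (auto simp: e2_def m_def)
        finally show ?thesis .
      qed
      have eq: "poly_val (b # q) y \<ominus> poly_val (b # q) x = y \<otimes> (poly_val q y \<ominus> poly_val q x) \<oplus> (y \<ominus> x) \<otimes> poly_val q x"
        using q(1) c x y(1) by simp algebra
      have e12: "v (y \<ominus> x) \<le> e1" "v (y \<ominus> x) \<le> e / m'" using y(2) by (auto simp: e2_def)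
      have "v y * v (poly_val q y \<ominus> poly_val q x) \<le> m * (e / m)"
        using vy e1(2)[OF y(1) e12(1)] y c m by (intro mult_mono v_nonneg) auto
      then have "v (y \<otimes> (poly_val q y \<ominus> poly_val q x)) \<le> m * (e / m)" using y c by (simp add: v_mult)
      moreover have "v (y \<ominus> x) * v (poly_val q x) \<le> (e / m') * m'"
        using e12 x c m y \<open>0 < e\<close> by (intro mult_mono v_nonneg) auto
      then have "v ((y \<ominus> x) \<otimes> poly_val q x) \<le> (e / m') * m'" using y x c by (simp add: v_mult)
      ultimately have "max (v (y \<otimes> (poly_val q y \<ominus> poly_val q x))) (v ((y \<ominus> x) \<otimes> poly_val q x)) \<le> e" using m by auto
      moreover have "v (y \<otimes> (poly_val q y \<ominus> poly_val q x) \<oplus> (y \<ominus> x) \<otimes> poly_val q x)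
          \<le> max (v (y \<otimes> (poly_val q y \<ominus> poly_val q x))) (v ((y \<ominus> x) \<otimes> poly_val q x))"
        using c x y(1) by (intro v_add) auto
      ultimately show ?thesis unfolding eq by (rule order_trans[rotated])
    qed
    moreover have "0 < e2" using e1 \<open>0 < e\<close> m by (simp add: e2_def)
    ultimately show "\<exists>e'>0. \<forall>y\<in>carrier R. v (y \<ominus> x) \<le> e' \<longrightarrow> v (poly_val (b # q) y \<ominus> poly_val (b # q) x) \<le> e" by blast
  qed
qed

lemma poly_val_measurable: "set cs \<subseteq> carrier R \<Longrightarrow> poly_val cs \<in> \<nu> \<rightarrow>\<^sub>M \<nu>"
  by (intro v_continuous_measurable v_continuous_poly_val)

lemma v_measurable: "v \<in> borel_measurable \<nu>"
proof (rule borel_measurableI_le)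
  fix t
  have "padic_open_set {x \<in> carrier R. v x \<le> t}" if "0 < t"
  proof -
    have "{x \<in> carrier R. v x \<le> t} = vball \<zero> t" by (auto simp: vball_def minus_zero)
    then show ?thesis using open_vball[of \<zero> t] that by simp
  qed
  moreover have "{x \<in> carrier R. v x \<le> 0} = (\<Inter>j. vball \<zero> (\<delta> j))"
  proof (intro Set.set_eqI iffI)
    fix x assume "x \<in> {x \<in> carrier R. v x \<le> 0}"
    then show "x \<in> (\<Inter>j. vball \<zero> (\<delta> j))" using \<delta>_pos by (auto simp: vball_def minus_zero intro: order_trans less_imp_le)
  next
    fix x assume "x \<in> (\<Inter>j. vball \<zero> (\<delta> j))"
    then have x: "x \<in> carrier R" "\<And>j. v x \<le> \<delta> j" by (auto simp: vball_def minus_zero)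
    then show "x \<in> {x \<in> carrier R. v x \<le> 0}" using \<delta>_small[of "v x"] by (force simp: not_le[symmetric])
  qed
  then have "{x \<in> carrier R. v x \<le> 0} \<in> sets \<nu>"
    using \<delta>_pos by (simp only:) (intro sets.countable_INT, auto intro!: vball_sets)
  moreover have "{x \<in> carrier R. v x \<le> t} = {}" if "t < 0" using that v_nonneg by force
  then have "{x \<in> carrier R. v x \<le> t} \<in> sets \<nu>" if "t < 0" using that by (simp only:) simp
  ultimately have "{x \<in> carrier R. v x \<le> t} \<in> sets \<nu>"
    using open_sets by (cases t "0::real" rule: linorder_cases) auto
  then show "{x \<in> space \<nu>. v x \<le> t} \<in> sets \<nu>" by (simp add: space_\<nu>)
qed

lemma v_poly_val_measurable [measurable]: "set cs \<subseteq> carrier R \<Longrightarrow> (\<lambda>x. v (poly_val cs x)) \<in> borel_measurable \<nu>"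
  by (rule measurable_compose[OF poly_val_measurable v_measurable])

text \<open>
Fix a point \<open>z\<close> of the sublevel set.  For the other points, \<open>\<bar>y - z\<bar> \<bar>R(y)\<bar> < b * \<rho> ^ Suc n\<close> by the
ultrametric inequality, where \<open>R\<close> is the difference quotient at \<open>z\<close>.  So either \<open>y\<close> lies within \<open>\<rho>\<close> of
\<open>z\<close>, or it lies in the corresponding sublevel set of \<open>R\<close>.
\<close>

lemma sublevel_estimate:
  assumes "set cs \<subseteq> carrier R" "length cs = Suc n" "0 < b" "b \<le> v (last cs)" "0 < \<rho>"
  shows "emeasure \<nu> {y \<in> Z. v (poly_val cs y) < b * \<rho> ^ n} \<le> ennreal (real n * \<rho>)"
  using assms
proof (induction n arbitrary: cs)
  case 0
  then obtain c where c: "cs = [c]" "c \<in> carrier R" by (cases cs) auto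
  have "{y \<in> Z. v (poly_val cs y) < b * \<rho> ^ 0} = {}" using c 0 by (auto simp: Z_def)
  then show ?case by (simp only: emeasure_empty zero_le)
next
  case (Suc n)
  show ?case
  proof (cases "{y \<in> Z. v (poly_val cs y) < b * \<rho> ^ Suc n} = {}")
    case True
    then show ?thesis by (simp only: emeasure_empty zero_le)
  next
    case False
    then obtain z where z: "z \<in> carrier R" "v (poly_val cs z) < b * \<rho> ^ Suc n" by (auto simp: Z_def simp del: power_Suc)
    let ?R = "diff_quot z cs"
    have Rc: "set ?R \<subseteq> carrier R" using Suc.prems z by (intro diff_quot_closed) auto
    have sub: "{y \<in> Z. v (poly_val cs y) < b * \<rho> ^ Suc n} \<subseteq> (Z \<inter> vball z \<rho>) \<union> {y \<in> Z. v (poly_val ?R y) < b * \<rho> ^ n}"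
    proof
      fix y assume y: "y \<in> {y \<in> Z. v (poly_val cs y) < b * \<rho> ^ Suc n}"
      then have yc: "y \<in> carrier R" by (simp add: Z_def)
      have "v (y \<ominus> z) * v (poly_val ?R y) = v (poly_val cs y \<ominus> poly_val cs z)"
        using Suc.prems(1) yc z Rc by (simp add: poly_val_diff v_mult)
      also have "\<dots> \<le> max (v (poly_val cs y)) (v (poly_val cs z))" using Suc.prems(1) yc z by (intro v_diff) auto
      also have "\<dots> < b * \<rho> ^ Suc n" using y z by simp
      finally have lt: "v (y \<ominus> z) * v (poly_val ?R y) < \<rho> * (b * \<rho> ^ n)" by (simp add: ac_simps)
      show "y \<in> (Z \<inter> vball z \<rho>) \<union> {y \<in> Z. v (poly_val ?R y) < b * \<rho> ^ n}"
      proof (rule ccontr)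
        assume "\<not> ?thesis"
        then have "\<rho> \<le> v (y \<ominus> z)" "b * \<rho> ^ n \<le> v (poly_val ?R y)" using y yc by (auto simp: vball_def)
        then have "\<rho> * (b * \<rho> ^ n) \<le> v (y \<ominus> z) * v (poly_val ?R y)"
          using Suc.prems yc z by (intro mult_mono v_nonneg) auto
        then show False using lt by simp
      qed
    qed
    have [measurable]: "Z \<inter> vball z \<rho> \<in> sets \<nu>" "{y \<in> Z. v (poly_val ?R y) < b * \<rho> ^ n} \<in> sets \<nu>"
    proof -
      show "Z \<inter> vball z \<rho> \<in> sets \<nu>" using z Suc.prems by (intro sets.Int vball_sets) auto
      have "{y \<in> Z. v (poly_val ?R y) < b * \<rho> ^ n} = Z \<inter> {y \<in> space \<nu>. v (poly_val ?R y) < b * \<rho> ^ n}"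
        by (auto simp: Z_def space_\<nu>)
      also have "\<dots> \<in> sets \<nu>" using v_poly_val_measurable[OF Rc] by measurable
      finally show "{y \<in> Z. v (poly_val ?R y) < b * \<rho> ^ n} \<in> sets \<nu>" .
    qed
    have "emeasure \<nu> {y \<in> Z. v (poly_val cs y) < b * \<rho> ^ Suc n}
       \<le> emeasure \<nu> ((Z \<inter> vball z \<rho>) \<union> {y \<in> Z. v (poly_val ?R y) < b * \<rho> ^ n})"
      using sub by (intro emeasure_mono) auto
    also have "\<dots> \<le> emeasure \<nu> (Z \<inter> vball z \<rho>) + emeasure \<nu> {y \<in> Z. v (poly_val ?R y) < b * \<rho> ^ n}"
      by (intro emeasure_subadditive) measurable
    also have "\<dots> \<le> ennreal \<rho> + ennreal (real n * \<rho>)"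
    proof (intro add_mono)
      show "emeasure \<nu> (Z \<inter> vball z \<rho>) \<le> ennreal \<rho>" using z Suc.prems by (intro emeasure_Z_vball_le)
      show "emeasure \<nu> {y \<in> Z. v (poly_val ?R y) < b * \<rho> ^ n} \<le> ennreal (real n * \<rho>)"
        using Suc.prems Rc z last_diff_quot[of cs z] by (intro Suc.IH) auto
    qed
    also have "\<dots> = ennreal (real (Suc n) * \<rho>)"
      using Suc.prems by (subst ennreal_plus[symmetric]) (auto simp: algebra_simps)
    finally show ?thesis .
  qed
qed

text \<open>
A maximal \<open>\<rho>\<close>-separated subset with \<open>\<rho> = \<epsilon> / c0\<close> has at most \<open>n\<close> points by \<open>card_separated_le\<close>, and the
balls of radius \<open>\<rho>\<close> around them cover the set.
\<close>

lemma inverse_image_estimate: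
  assumes cs: "set cs \<subseteq> carrier R" "length cs \<le> Suc n" and c0: "0 < c0" and \<epsilon>: "0 < \<epsilon>"
    and w: "w \<in> carrier R" and T: "T \<subseteq> Z" "\<And>y. y \<in> T \<Longrightarrow> c0 \<le> v (poly_deriv cs y)"
  shows "emeasure \<nu> {y \<in> T. v (poly_val cs y \<ominus> w) \<le> \<epsilon>} \<le> ennreal (real n * (\<epsilon> / c0))"
proof (cases cs)
  case Nil
  then have "T = {}" using T(2) c0 by (force simp: v_zero)
  then show ?thesis by simp
next
  case (Cons b q)
  define \<rho> where "\<rho> = \<epsilon> / c0"
  have \<rho>: "0 < \<rho>" using c0 \<epsilon> by (simp add: \<rho>_def)
  define cs' where "cs' = (b \<ominus> w) # q"
  have cs': "set cs' \<subseteq> carrier R" "length cs' \<le> Suc n" using cs w Cons by (auto simp: cs'_def)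
  have pv': "poly_val cs' y = poly_val cs y \<ominus> w" and pd': "poly_deriv cs' y = poly_deriv cs y" if "y \<in> carrier R" for y
  proof -
    have c: "b \<in> carrier R" "poly_val q y \<in> carrier R" using cs Cons that by auto
    show "poly_val cs' y = poly_val cs y \<ominus> w" using c w that by (simp add: cs'_def Cons) algebra
    show "poly_deriv cs' y = poly_deriv cs y" by (simp add: cs'_def Cons)
  qed
  let ?F = "{y \<in> T. v (poly_val cs y \<ominus> w) \<le> \<epsilon>}"
  define sep where "sep = (\<lambda>Y. finite Y \<and> Y \<subseteq> ?F \<and> (\<forall>y\<in>Y. \<forall>z\<in>Y. y \<noteq> z \<longrightarrow> \<rho> < v (y \<ominus> z)))"
  have Tc: "T \<subseteq> carrier R" using T by (auto simp: Z_def)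
  have bound: "card Y \<le> n" if "sep Y" for Y
  proof (rule card_separated_le[OF cs' \<rho>])
    show "finite Y" "Y \<subseteq> carrier R" using that Tc by (auto simp: sep_def)
    fix y assume y: "y \<in> Y"
    then have yT: "y \<in> T" "y \<in> carrier R" "v (poly_val cs y \<ominus> w) \<le> \<epsilon>" using that Tc by (auto simp: sep_def)
    then show "poly_deriv cs' y \<noteq> \<zero>" using T(2)[of y] c0 pd' v_zero by auto
    have "v (poly_val cs' y) \<le> \<rho> * c0" using yT pv' c0 by (simp add: \<rho>_def)
    also have "\<dots> \<le> \<rho> * v (poly_deriv cs' y)" using T(2)[OF yT(1)] pd' yT \<rho> by (intro mult_left_mono) auto
    finally show "v (poly_val cs' y) \<le> \<rho> * v (poly_deriv cs' y)" .
  next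
    fix y z assume "y \<in> Y" "z \<in> Y" "y \<noteq> z"
    then show "\<rho> < v (y \<ominus> z)" using that by (auto simp: sep_def)
  qed
  have "sep {}" by (simp add: sep_def)
  then obtain Y where Y: "sep Y" "\<And>Y'. sep Y' \<Longrightarrow> card Y' \<le> card Y"
    using ex_has_greatest_nat[of sep "{}" card "Suc n"] bound by (metis le_imp_less_Suc)
  have Yc: "Y \<subseteq> carrier R" "finite Y" using Y Tc by (auto simp: sep_def)
  have cover: "?F \<subseteq> (\<Union>y\<in>Y. Z \<inter> vball y \<rho>)"
  proof
    fix x assume x: "x \<in> ?F"
    then have xc: "x \<in> carrier R" using Tc by auto
    show "x \<in> (\<Union>y\<in>Y. Z \<inter> vball y \<rho>)"
    proof (rule ccontr)
      assume neg: "\<not> ?thesis"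
      then have far: "\<rho> < v (x \<ominus> y)" if "y \<in> Y" for y using that x T xc by (force simp: vball_def)
      then have "x \<notin> Y" using v_minus_self[OF xc] \<rho> by force
      have far': "\<rho> < v (y \<ominus> x)" if "y \<in> Y" for y
        using far[OF that] v_diff_commute[OF xc, of y] Yc(1) that by auto
      have "sep (insert x Y)"
        unfolding sep_def
      proof (intro conjI ballI impI)
        show "finite (insert x Y)" using Yc by simp
        show "insert x Y \<subseteq> ?F" using x Y(1) by (simp add: sep_def)
        fix y z assume yz: "y \<in> insert x Y" "z \<in> insert x Y" "y \<noteq> z"
        consider "y = x" "z \<in> Y" | "z = x" "y \<in> Y" | "y \<in> Y" "z \<in> Y" using yz by auto
        then show "\<rho> < v (y \<ominus> z)"
        proof cases
          case 3
          then show ?thesis using Y(1) yz(3) unfolding sep_def by blast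
        qed (simp_all add: far far')
      qed
      then have "card (insert x Y) \<le> card Y" by (rule Y(2))
      then show False using \<open>x \<notin> Y\<close> Yc by simp
    qed
  qed
  have meas: "Z \<inter> vball y \<rho> \<in> sets \<nu>" if "y \<in> Y" for y
    using that Yc \<rho> by (intro sets.Int Z_sets vball_sets) auto
  have "emeasure \<nu> ?F \<le> emeasure \<nu> (\<Union>y\<in>Y. Z \<inter> vball y \<rho>)"
    using meas Yc by (intro emeasure_mono cover sets.finite_UN)
  also have "\<dots> \<le> (\<Sum>y\<in>Y. emeasure \<nu> (Z \<inter> vball y \<rho>))"
    using meas Yc by (intro emeasure_subadditive_finite) auto
  also have "\<dots> \<le> (\<Sum>y\<in>Y. ennreal \<rho>)"
    using Yc \<rho> by (intro sum_mono emeasure_Z_vball_le) auto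
  also have "\<dots> = ennreal (real (card Y) * \<rho>)"
    using \<rho> by (simp add: ennreal_mult ennreal_of_nat_eq_real_of_nat)
  also have "\<dots> \<le> ennreal (real n * \<rho>)"
    using bound[OF Y(1)] \<rho> by (intro ennreal_leI mult_right_mono) auto
  finally show ?thesis by (simp add: \<rho>_def)
qed

end

section \<open>Change of variables for Borel sets\<close>

context padic_haar begin

text \<open>
The unions of balls of radius \<open>\<delta> j\<close>.
\<close>

definition saturated :: "nat \<Rightarrow> 'a set \<Rightarrow> bool" where
  "saturated j E \<longleftrightarrow> E \<subseteq> carrier R \<and> (\<forall>x\<in>E. vball x (\<delta> j) \<subseteq> E)"

lemma vball_mono: "e \<le> e' \<Longrightarrow> vball x e \<subseteq> vball x e'" by (auto simp: vball_def)

lemma saturated_mono: "saturated i E \<Longrightarrow> i \<le> j \<Longrightarrow> saturated j E"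
  unfolding saturated_def using vball_mono[OF \<delta>_antimono] by blast

lemma vball_sym: "x \<in> carrier R \<Longrightarrow> y \<in> vball x e \<Longrightarrow> x \<in> vball y e"
  using v_diff_commute[of x y] by (auto simp: vball_def)

lemma saturated_compl: "saturated j E \<Longrightarrow> saturated j (carrier R - E)"
  unfolding saturated_def using vball_sym vball_carrier by blast

lemma saturated_sets: "saturated j E \<Longrightarrow> E \<in> sets \<nu>"
proof -
  assume E: "saturated j E"
  have "padic_open_set E" unfolding padic_open_set_def
  proof (intro conjI ballI)
    fix x assume "x \<in> E"
    then have "\<forall>y\<in>carrier R. v (y \<ominus> x) < \<delta> j \<longrightarrow> y \<in> E" using E by (force simp: saturated_def vball_def)
    then show "\<exists>e>0. \<forall>y\<in>carrier R. v (y \<ominus> x) < e \<longrightarrow> y \<in> E" using \<delta>_pos by blast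
  qed (use E in \<open>simp add: saturated_def\<close>)
  then show ?thesis by (rule open_sets)
qed

lemma saturated_UN:
  "finite I \<Longrightarrow> (\<And>i. i \<in> I \<Longrightarrow> \<exists>j. saturated j (E i)) \<Longrightarrow> \<exists>j. saturated j (\<Union>i\<in>I. E i)"
proof (induction I rule: finite_induct)
  case empty
  then show ?case by (simp add: saturated_def)
next
  case (insert i I)
  then obtain j j' where "saturated j (E i)" "saturated j' (\<Union>i\<in>I. E i)" by (metis insertCI)
  then have "saturated (max j j') (E i)" "saturated (max j j') (\<Union>i\<in>I. E i)"
    by (auto intro: saturated_mono)
  then have "saturated (max j j') (\<Union>i\<in>insert i I. E i)" unfolding saturated_def by blast
  then show ?case by blast
qed

text \<open>
The sets that can be approximated in the sum of both measures form a sigma-algebra, and an open set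
is the increasing union of the saturated sets of its points at which a whole ball fits in.
\<close>

lemma approximation_by_saturated:
  assumes fin: "finite_measure \<mu>1" "finite_measure \<mu>2" and sets: "sets \<mu>1 = sets \<nu>" "sets \<mu>2 = sets \<nu>"
    and E: "E \<in> sets \<nu>" and e: "0 < e"
  shows "\<exists>j E'. saturated j E' \<and> measure \<mu>1 (sym_diff E E') + measure \<mu>2 (sym_diff E E') < e"
proof -
  interpret m1: finite_measure \<mu>1 by (rule fin)
  interpret m2: finite_measure \<mu>2 by (rule fin)
  define D where "D = (\<lambda>A. measure \<mu>1 A + measure \<mu>2 A)"
  have D_mono: "D A \<le> D B" if "A \<subseteq> B" "B \<in> sets \<nu>" for A B
    unfolding D_def using that by (intro add_mono m1.finite_measure_mono m2.finite_measure_mono) (auto simp: sets)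
  have D_Un: "D (A \<union> B) \<le> D A + D B" if "A \<in> sets \<nu>" "B \<in> sets \<nu>" for A B
    unfolding D_def using measure_Un_le[of A \<mu>1 B] measure_Un_le[of A \<mu>2 B] that
    by (simp add: sets)
  have D_UN: "D (\<Union>i\<in>I. A i) \<le> (\<Sum>i\<in>I. D (A i))" if "finite I" "\<And>i. i \<in> I \<Longrightarrow> A i \<in> sets \<nu>" for A and I :: "nat set"
    unfolding D_def sum.distrib
    using that by (intro add_mono measure_UNION_le) (auto simp: sets)
  have D_lim: "\<exists>n. D (A - B n) < e" if "range B \<subseteq> sets \<nu>" "incseq B" "(\<Union>n. B n) = A" "0 < e" for A B e
  proof -
    have A: "A \<in> sets \<nu>" using that by auto
    have "(\<lambda>n. measure \<mu>1 (B n) + measure \<mu>2 (B n)) \<longlonglongrightarrow> measure \<mu>1 A + measure \<mu>2 A"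
      using that(1,2) unfolding that(3)[symmetric]
      by (intro tendsto_add m1.finite_Lim_measure_incseq m2.finite_Lim_measure_incseq) (auto simp: sets)
    then have "eventually (\<lambda>n. measure \<mu>1 A + measure \<mu>2 A - e < measure \<mu>1 (B n) + measure \<mu>2 (B n)) sequentially"
      using that(4) by (intro order_tendstoD) auto
    then obtain n where n: "measure \<mu>1 A + measure \<mu>2 A - e < measure \<mu>1 (B n) + measure \<mu>2 (B n)"
      by (auto simp: eventually_sequentially)
    have "B n \<subseteq> A" "B n \<in> sets \<nu>" using that by auto
    then have "D (A - B n) = (measure \<mu>1 A - measure \<mu>1 (B n)) + (measure \<mu>2 A - measure \<mu>2 (B n))"
      using A unfolding D_def by (simp add: m1.finite_measure_Diff m2.finite_measure_Diff sets)
    then show ?thesis using n by (intro exI[of _ n]) simp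
  qed
  have "E \<in> sigma_sets (carrier R) {U. padic_open_set U}" using E by (simp add: sets_\<nu>_open)
  then have "\<forall>e>0. \<exists>j E'. saturated j E' \<and> D (sym_diff E E') < e"
  proof (induction rule: sigma_sets.induct)
    case (Basic U)
    then have U: "padic_open_set U" by simp
    then have Uc: "U \<subseteq> carrier R" by (simp add: padic_open_set_def)
    define B where "B = (\<lambda>j. {x \<in> U. vball x (\<delta> j) \<subseteq> U})"
    have sat: "saturated j (B j)" for j
      unfolding saturated_def
    proof (intro conjI ballI)
      show "B j \<subseteq> carrier R" using Uc by (auto simp: B_def)
      fix x assume x: "x \<in> B j"
      show "vball x (\<delta> j) \<subseteq> B j"
      proof
        fix y assume y: "y \<in> vball x (\<delta> j)"
        then have "vball y (\<delta> j) = vball x (\<delta> j)" using x Uc by (intro vball_eq) (auto simp: B_def vball_def)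
        then show "y \<in> B j" using x y by (auto simp: B_def)
      qed
    qed
    have inc: "incseq B"
      unfolding incseq_def B_def using vball_mono[OF \<delta>_antimono] by blast
    have un: "(\<Union>n. B n) = U"
    proof (rule Set.set_eqI)
      fix x
      show "x \<in> (\<Union>n. B n) \<longleftrightarrow> x \<in> U"
      proof
        assume x: "x \<in> U"
        then obtain e where e: "e > 0" "\<And>y. y \<in> carrier R \<Longrightarrow> v (y \<ominus> x) < e \<Longrightarrow> y \<in> U"
          using U unfolding padic_open_set_def by blast
        obtain j where "\<delta> j < e" using \<delta>_small[OF e(1)] by auto
        then have "vball x (\<delta> j) \<subseteq> U" using e(2) by (auto simp: vball_def)
        then show "x \<in> (\<Union>n. B n)" using x by (auto simp: B_def)
      qed (auto simp: B_def)
    qed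
    show ?case
    proof (intro allI impI)
      fix e :: real assume "0 < e"
      then obtain n where "D (U - B n) < e" using D_lim[OF _ inc un] saturated_sets[OF sat] by blast
      moreover have "sym_diff U (B n) = U - B n" using un by auto
      ultimately show "\<exists>j E'. saturated j E' \<and> D (sym_diff U E') < e" using sat by metis
    qed
  next
    case Empty
    have "saturated 0 {}" "D (sym_diff {} {}) = 0" by (auto simp: saturated_def D_def)
    then show ?case by metis
  next
    case (Compl A)
    have A: "A \<subseteq> carrier R" using Compl(1) by (auto dest: sigma_sets_into_sp[rotated] simp: padic_open_set_def)
    show ?case
    proof (intro allI impI)
      fix e :: real assume "0 < e"
      then obtain j E' where E': "saturated j E'" "D (sym_diff A E') < e" using Compl(2) by blast
      have "sym_diff (carrier R - A) (carrier R - E') = sym_diff A E'"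
        using A E'(1) by (auto simp: saturated_def)
      then show "\<exists>j E'. saturated j E' \<and> D (sym_diff (carrier R - A) E') < e"
        using E' saturated_compl by metis
    qed
  next
    case (Union A)
    have A: "A i \<in> sets \<nu>" for i using Union(1) by (simp add: sets_\<nu>_open)
    show ?case
    proof (intro allI impI)
      fix e :: real assume e: "0 < e"
      define B where "B = (\<lambda>n. \<Union>i<n. A i)"
      have "incseq B" unfolding incseq_def B_def by (auto intro: less_le_trans)
      moreover have "range B \<subseteq> sets \<nu>" using A by (auto simp: B_def)
      moreover have "(\<Union>n. B n) = (\<Union>i. A i)" by (auto simp: B_def)
      ultimately obtain n where n: "D ((\<Union>i. A i) - B n) < e / 2" using D_lim[of B "\<Union>i. A i" "e / 2"] e by auto
      define e' where "e' = e / (2 * (real n + 1))"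
      have e': "0 < e'" using e by (simp add: e'_def)
      then have "\<forall>i. \<exists>E'. (\<exists>j. saturated j E') \<and> D (sym_diff (A i) E') < e'" using Union(2) by blast
      then obtain E' where E': "\<And>i. \<exists>j. saturated j (E' i)" "\<And>i. D (sym_diff (A i) (E' i)) < e'" by metis
      have E's: "E' i \<in> sets \<nu>" for i using E'(1)[of i] saturated_sets by blast
      obtain j where j: "saturated j (\<Union>i<n. E' i)" using saturated_UN[of "{..<n}" E'] E'(1) by auto
      have sub: "sym_diff (\<Union>i. A i) (\<Union>i<n. E' i) \<subseteq> ((\<Union>i. A i) - B n) \<union> (\<Union>i<n. sym_diff (A i) (E' i))"
        by (auto simp: B_def)
      have m1: "(\<Union>i. A i) - B n \<in> sets \<nu>" "(\<Union>i<n. sym_diff (A i) (E' i)) \<in> sets \<nu>"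
        using A E's by (auto simp: B_def)
      have "D (sym_diff (\<Union>i. A i) (\<Union>i<n. E' i)) \<le> D (((\<Union>i. A i) - B n) \<union> (\<Union>i<n. sym_diff (A i) (E' i)))"
        using m1 by (intro D_mono sub) auto
      also have "\<dots> \<le> D ((\<Union>i. A i) - B n) + D (\<Union>i<n. sym_diff (A i) (E' i))" using m1 by (rule D_Un)
      also have "D (\<Union>i<n. sym_diff (A i) (E' i)) \<le> (\<Sum>i<n. D (sym_diff (A i) (E' i)))"
        using A E's by (intro D_UN) auto
      also have "\<dots> \<le> (\<Sum>i<n. e')" using E'(2) less_imp_le by (intro sum_mono) blast
      also have "(\<Sum>i<n. e') \<le> e / 2" using e by (simp add: e'_def field_simps)
      finally have "D (sym_diff (\<Union>i. A i) (\<Union>i<n. E' i)) < e" using n by simp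
      then show "\<exists>j E'. saturated j E' \<and> D (sym_diff (\<Union>i. A i) E') < e" using j by metis
    qed
  qed
  then show ?thesis using e by (simp add: D_def)
qed

text \<open>
A saturated set is a countable disjoint union of balls, so it satisfies the inequality; a Borel subset of a
saturated set of finite measure inherits it by approximation with respect to both measures, and
an exhaustion by finite unions of unit balls gives the general case.
\<close>

lemma measure_le_of_balls:
  assumes fin: "finite_measure \<mu>" and sets: "sets \<mu> = sets \<nu>" and C: "0 \<le> C"
    and balls: "\<And>z j. z \<in> carrier R \<Longrightarrow> emeasure \<mu> (vball z (\<delta> j)) \<le> ennreal C * emeasure \<nu> (vball z (\<delta> j))"
    and E: "E \<in> sets \<nu>"
  shows "emeasure \<mu> E \<le> ennreal C * emeasure \<nu> E"
proof -
  interpret m: finite_measure \<mu> by (rule fin)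
  have sat_le: "emeasure \<mu> A \<le> ennreal C * emeasure \<nu> A" if A: "saturated j A" for A j
  proof -
    define BB where "BB = {b \<in> (\<lambda>z. vball z (\<delta> j)) ` Q. b \<subseteq> A}"
    have cnt: "countable BB" using Q(1) by (auto simp: BB_def)
    have bs: "\<exists>z\<in>carrier R. b = vball z (\<delta> j)" if "b \<in> BB" for b using that Q_carrier by (auto simp: BB_def)
    then have bm: "b \<in> sets \<nu>" if "b \<in> BB" for b using that \<delta>_pos vball_sets by metis
    have disj: "disjoint_family_on (\<lambda>b. b) BB"
      unfolding disjoint_family_on_def
    proof (intro ballI impI)
      fix a b assume ab: "a \<in> BB" "b \<in> BB" "a \<noteq> b"
      then obtain z w where zw: "z \<in> carrier R" "w \<in> carrier R" "a = vball z (\<delta> j)" "b = vball w (\<delta> j)"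
        using bs by metis
      show "a \<inter> b = {}"
      proof (rule ccontr)
        assume "a \<inter> b \<noteq> {}"
        then obtain x where x: "x \<in> vball z (\<delta> j)" "x \<in> vball w (\<delta> j)" using zw by auto
        then have "x \<in> carrier R" "v (x \<ominus> z) \<le> \<delta> j" "v (x \<ominus> w) \<le> \<delta> j" by (auto simp: vball_def)
        then have "vball x (\<delta> j) = vball z (\<delta> j)" "vball x (\<delta> j) = vball w (\<delta> j)"
          using vball_eq zw by blast+
        then show False using ab(3) zw by simp
      qed
    qed
    have un: "(\<Union>b\<in>BB. b) = A"
    proof (rule Set.set_eqI)
      fix x
      show "x \<in> (\<Union>b\<in>BB. b) \<longleftrightarrow> x \<in> A"
      proof
        assume x: "x \<in> A"
        then have xc: "x \<in> carrier R" "vball x (\<delta> j) \<subseteq> A" using A by (auto simp: saturated_def)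
        obtain z where z: "z \<in> Q" "x \<in> vball z (\<delta> j)" using countable_cover[OF xc(1)] .
        then have "vball x (\<delta> j) = vball z (\<delta> j)" using xc Q_carrier by (intro vball_eq) (auto simp: vball_def)
        then have "vball z (\<delta> j) \<in> BB" using z xc by (auto simp: BB_def)
        then show "x \<in> (\<Union>b\<in>BB. b)" using z by blast
      qed (auto simp: BB_def)
    qed
    have "emeasure \<mu> A = (\<integral>\<^sup>+b. emeasure \<mu> b \<partial>count_space BB)"
      unfolding un[symmetric] using bm sets disj cnt by (intro emeasure_UN_countable) auto
    also have "\<dots> \<le> (\<integral>\<^sup>+b. ennreal C * emeasure \<nu> b \<partial>count_space BB)"
      using bs balls by (intro nn_integral_mono) fastforce
    also have "\<dots> = ennreal C * (\<integral>\<^sup>+b. emeasure \<nu> b \<partial>count_space BB)" by (intro nn_integral_cmult) auto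
    also have "(\<integral>\<^sup>+b. emeasure \<nu> b \<partial>count_space BB) = emeasure \<nu> A"
      unfolding un[symmetric] using bm disj cnt by (intro emeasure_UN_countable[symmetric]) auto
    finally show ?thesis .
  qed
  have bounded_case: "emeasure \<mu> A \<le> ennreal C * emeasure \<nu> A"
    if A: "A \<in> sets \<nu>" "A \<subseteq> XX" and XX: "saturated i XX" "emeasure \<nu> XX < \<infinity>" for A XX i
  proof (rule ennreal_le_epsilon)
    fix e :: real assume e: "0 < e"
    define e' where "e' = e / (C + 1)"
    have "C * e' + e' = e' * (C + 1)" by (simp add: algebra_simps)
    then have e': "0 < e'" "C * e' + e' = e" using e C by (auto simp: e'_def)
    have XXs: "XX \<in> sets \<nu>" by (rule saturated_sets[OF XX(1)])
    define \<mu>2 where "\<mu>2 = density \<nu> (indicator XX)"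
    have \<mu>2: "emeasure \<mu>2 Y = emeasure \<nu> (XX \<inter> Y)" if "Y \<in> sets \<nu>" for Y
      unfolding \<mu>2_def using that XXs by (simp add: emeasure_density_const[symmetric] emeasure_density nn_integral_indicator indicator_inter_arith[symmetric])
    have \<mu>2s: "sets \<mu>2 = sets \<nu>" by (simp add: \<mu>2_def)
    have "finite_measure \<mu>2"
    proof
      have "emeasure \<mu>2 (space \<mu>2) \<le> emeasure \<nu> XX"
        using \<mu>2[of "space \<nu>"] XXs by (simp add: \<mu>2_def emeasure_mono)
      then show "emeasure \<mu>2 (space \<mu>2) \<noteq> \<infinity>" using XX(2) by auto
    qed
    then interpret m2: finite_measure \<mu>2 .
    obtain j E' where E': "saturated j E'" "measure \<mu> (sym_diff A E') + measure \<mu>2 (sym_diff A E') < e'"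
      using approximation_by_saturated[OF fin m2.finite_measure_axioms sets \<mu>2s A(1) e'(1)] by blast
    have E's: "E' \<in> sets \<nu>" by (rule saturated_sets[OF E'(1)])
    define G where "G = E' \<inter> XX"
    have "saturated (max i j) E'" "saturated (max i j) XX"
      using saturated_mono[OF E'(1), of "max i j"] saturated_mono[OF XX(1), of "max i j"] by auto
    then have G: "saturated (max i j) G" unfolding saturated_def G_def by blast
    have Gs: "G \<in> sets \<nu>" by (rule saturated_sets[OF G])
    have "measure \<mu> (sym_diff A E') \<le> e'" "measure \<mu>2 (sym_diff A E') \<le> e'"
      using E'(2) measure_nonneg[of \<mu> "sym_diff A E'"] measure_nonneg[of \<mu>2 "sym_diff A E'"] by linarith+
    then have small: "emeasure \<mu> (sym_diff A E') \<le> ennreal e'" "emeasure \<mu>2 (sym_diff A E') \<le> ennreal e'"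
      by (auto simp: m.emeasure_eq_measure m2.emeasure_eq_measure intro: ennreal_leI)
    have "emeasure \<mu> A \<le> emeasure \<mu> (G \<union> sym_diff A E')"
      using A E's Gs sets by (intro emeasure_mono) (auto simp: G_def)
    also have "\<dots> \<le> emeasure \<mu> G + emeasure \<mu> (sym_diff A E')"
      using A E's Gs sets by (intro emeasure_subadditive) auto
    also have "\<dots> \<le> ennreal C * emeasure \<nu> G + ennreal e'" by (intro add_mono sat_le[OF G] small)
    also have "emeasure \<nu> G \<le> emeasure \<nu> (A \<union> (XX \<inter> sym_diff A E'))"
      using A E's XXs by (intro emeasure_mono) (auto simp: G_def)
    also have "\<dots> \<le> emeasure \<nu> A + emeasure \<nu> (XX \<inter> sym_diff A E')"
      using A E's XXs by (intro emeasure_subadditive) auto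
    also have "emeasure \<nu> (XX \<inter> sym_diff A E') \<le> ennreal e'"
      using small(2) \<mu>2[of "sym_diff A E'"] A E's by auto
    finally have "emeasure \<mu> A \<le> ennreal C * (emeasure \<nu> A + ennreal e') + ennreal e'"
      by (simp add: mult_left_mono add_mono)
    also have "\<dots> = ennreal C * emeasure \<nu> A + ennreal (C * e' + e')"
    proof -
      have "ennreal C * ennreal e' + ennreal e' = ennreal (C * e' + e')"
        using C e'(1) by (simp add: ennreal_mult)
      then show ?thesis by (simp only: distrib_left add.assoc)
    qed
    finally show "emeasure \<mu> A \<le> ennreal C * emeasure \<nu> A + ennreal e" by (simp add: e'(2))
  qed
  have "Q \<noteq> {}" using countable_cover[OF zero_closed] by blast
  define q where "q = from_nat_into Q"
  have q: "q n \<in> Q" "range q = Q" for n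
    unfolding q_def using \<open>Q \<noteq> {}\<close> Q(1) by (auto intro: from_nat_into simp: range_from_nat_into)
  define XX where "XX = (\<lambda>n. \<Union>i<n. vball (q i) (\<delta> 0))"
  have XXsat: "saturated 0 (XX n)" for n
    unfolding saturated_def
  proof (intro conjI ballI)
    show "XX n \<subseteq> carrier R" using vball_carrier by (auto simp: XX_def)
    fix x assume "x \<in> XX n"
    then obtain i where i: "i < n" "x \<in> vball (q i) (\<delta> 0)" by (auto simp: XX_def)
    then have "vball x (\<delta> 0) = vball (q i) (\<delta> 0)" using Q_carrier q by (intro vball_eq) (auto simp: vball_def)
    then show "vball x (\<delta> 0) \<subseteq> XX n" using i by (auto simp: XX_def)
  qed
  have Xfin: "emeasure \<nu> (XX n) < \<infinity>" for n
  proof -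
    have "emeasure \<nu> (XX n) \<le> (\<Sum>i<n. emeasure \<nu> (vball (q i) (\<delta> 0)))"
      unfolding XX_def using q Q_carrier \<delta>_pos by (intro emeasure_subadditive_finite) (auto intro!: vball_sets)
    also have "\<dots> = (\<Sum>i<n. ennreal (\<delta> 0))" using q Q_carrier by (intro sum.cong refl emeasure_vball) auto
    also have "\<dots> < \<infinity>" by (simp add: ennreal_of_nat_eq_real_of_nat)
    finally show ?thesis .
  qed
  have XE: "E \<inter> XX n \<in> sets \<nu>" for n using E saturated_sets[OF XXsat] by auto
  have un: "(\<Union>n. E \<inter> XX n) = E"
  proof (rule Set.set_eqI)
    fix x
    show "x \<in> (\<Union>n. E \<inter> XX n) \<longleftrightarrow> x \<in> E"
    proof
      assume x: "x \<in> E"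
      then have "x \<in> carrier R" using sets.sets_into_space[OF E] by (auto simp: space_\<nu>)
      then obtain z where z: "z \<in> Q" "x \<in> vball z (\<delta> 0)" using countable_cover by metis
      then obtain i where "z = q i" using q(2) by auto
      then have "x \<in> XX (Suc i)" using z by (auto simp: XX_def)
      then show "x \<in> (\<Union>n. E \<inter> XX n)" using x by blast
    qed auto
  qed
  have inc: "incseq (\<lambda>n. E \<inter> XX n)" unfolding incseq_def XX_def by (auto intro: less_le_trans)
  have "range (\<lambda>n. E \<inter> XX n) \<subseteq> sets \<mu>" using XE by (auto simp: sets)
  then have "(SUP n. emeasure \<mu> (E \<inter> XX n)) = emeasure \<mu> (\<Union>n. E \<inter> XX n)"
    using inc by (rule SUP_emeasure_incseq)
  then have "emeasure \<mu> E = (SUP n. emeasure \<mu> (E \<inter> XX n))" by (simp only: un)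
  also have "\<dots> \<le> ennreal C * emeasure \<nu> E"
  proof (rule SUP_least)
    fix n
    have "emeasure \<mu> (E \<inter> XX n) \<le> ennreal C * emeasure \<nu> (E \<inter> XX n)"
      by (rule bounded_case[OF XE _ XXsat Xfin]) auto
    also have "\<dots> \<le> ennreal C * emeasure \<nu> E" using E by (intro mult_left_mono emeasure_mono) auto
    finally show "emeasure \<mu> (E \<inter> XX n) \<le> ennreal C * emeasure \<nu> E" .
  qed
  finally show ?thesis .
qed

lemma minus_poly_val_in_vball_iff:
  assumes "x \<in> carrier R" "w \<in> carrier R" "u \<in> carrier R"
  shows "x \<ominus> u \<in> vball w e \<longleftrightarrow> u \<in> vball (x \<ominus> w) e"
proof -
  have "(x \<ominus> u) \<ominus> w = (x \<ominus> w) \<ominus> u" using assms by algebra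
  then have "v ((x \<ominus> u) \<ominus> w) = v (u \<ominus> (x \<ominus> w))" using v_diff_commute[of "x \<ominus> w" u] assms by simp
  then show ?thesis using assms by (simp add: vball_def)
qed

lemma minus_poly_val_measurable:
  assumes cs: "set cs \<subseteq> carrier R" and x: "x \<in> carrier R"
  shows "(\<lambda>y. x \<ominus> poly_val cs y) \<in> \<nu> \<rightarrow>\<^sub>M \<nu>"
proof (rule measurable_vballI)
  show "(\<lambda>y. x \<ominus> poly_val cs y) \<in> space \<nu> \<rightarrow> carrier R" using cs x by (auto simp: space_\<nu>)
  fix w and j :: nat assume w: "w \<in> carrier R"
  have "(\<lambda>y. x \<ominus> poly_val cs y) -` vball w (\<delta> j) \<inter> space \<nu> = poly_val cs -` vball (x \<ominus> w) (\<delta> j) \<inter> space \<nu>"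
    using minus_poly_val_in_vball_iff[OF x w] cs by (auto simp: space_\<nu>)
  also have "\<dots> \<in> sets \<nu>"
    using x w \<delta>_pos by (intro measurable_sets[OF poly_val_measurable[OF cs]] vball_sets) auto
  finally show "(\<lambda>y. x \<ominus> poly_val cs y) -` vball w (\<delta> j) \<inter> space \<nu> \<in> sets \<nu>" .
qed

text \<open>
The change of variables as an inequality: the image of the measure on \<open>T\<close> under \<open>y \<mapsto> x - P(y)\<close> satisfies it
for balls by \<open>inverse_image_estimate\<close>.
\<close>

lemma transport_le:
  assumes cs: "set cs \<subseteq> carrier R" "length cs \<le> Suc n" and c0: "0 < c0"
    and T: "T \<in> sets \<nu>" "T \<subseteq> Z" "\<And>y. y \<in> T \<Longrightarrow> c0 \<le> v (poly_deriv cs y)"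
    and x: "x \<in> carrier R" and g: "(g :: 'a \<Rightarrow> ennreal) \<in> borel_measurable \<nu>"
  shows "(\<integral>\<^sup>+y\<in>T. g (x \<ominus> poly_val cs y) \<partial>\<nu>) \<le> ennreal (real n / c0) * (\<integral>\<^sup>+y. g y \<partial>\<nu>)"
proof -
  let ?f = "\<lambda>y. x \<ominus> poly_val cs y"
  have f: "?f \<in> restrict_space \<nu> T \<rightarrow>\<^sub>M \<nu>"
    by (rule measurable_restrict_space1[OF minus_poly_val_measurable[OF cs(1) x]])
  define \<mu> where "\<mu> = distr (restrict_space \<nu> T) \<nu> ?f"
  have Tsp: "T \<inter> space \<nu> \<in> sets \<nu>" using T(1) by auto
  have em: "emeasure \<mu> A = emeasure \<nu> {y \<in> T. ?f y \<in> A}" if A: "A \<in> sets \<nu>" for A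
  proof -
    have "emeasure \<mu> A = emeasure (restrict_space \<nu> T) (?f -` A \<inter> space (restrict_space \<nu> T))"
      unfolding \<mu>_def by (rule emeasure_distr[OF f A])
    also have "\<dots> = emeasure \<nu> (?f -` A \<inter> space (restrict_space \<nu> T))"
      using Tsp by (intro emeasure_restrict_space) (auto simp: space_restrict_space)
    also have "?f -` A \<inter> space (restrict_space \<nu> T) = {y \<in> T. ?f y \<in> A}"
      using T(1) sets.sets_into_space[OF T(1)] by (auto simp: space_restrict_space)
    finally show ?thesis .
  qed
  have fin: "finite_measure \<mu>"
  proof
    have "emeasure \<mu> (space \<mu>) \<le> emeasure \<nu> Z"
      using em[OF sets.top] T by (auto simp: \<mu>_def intro!: emeasure_mono)
    also have "\<dots> < \<infinity>" by (simp add: emeasure_Z)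
    finally show "emeasure \<mu> (space \<mu>) \<noteq> \<infinity>" by simp
  qed
  have balls: "emeasure \<mu> (vball w (\<delta> j)) \<le> ennreal (real n / c0) * emeasure \<nu> (vball w (\<delta> j))"
    if w: "w \<in> carrier R" for w j
  proof -
    have Tc: "T \<subseteq> carrier R" using T(2) by (auto simp: Z_def)
    have "{y \<in> T. ?f y \<in> vball w (\<delta> j)} = {y \<in> T. v (poly_val cs y \<ominus> (x \<ominus> w)) \<le> \<delta> j}"
    proof (intro Collect_cong conj_cong refl)
      fix y assume "y \<in> T"
      then have "poly_val cs y \<in> carrier R" using cs Tc by auto
      then show "?f y \<in> vball w (\<delta> j) \<longleftrightarrow> v (poly_val cs y \<ominus> (x \<ominus> w)) \<le> \<delta> j"
        using minus_poly_val_in_vball_iff[OF x w, of "poly_val cs y" "\<delta> j"] by (simp add: vball_def)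
    qed
    then have "emeasure \<mu> (vball w (\<delta> j)) = emeasure \<nu> {y \<in> T. v (poly_val cs y \<ominus> (x \<ominus> w)) \<le> \<delta> j}"
      using em[OF vball_sets[OF w \<delta>_pos]] by simp
    also have "\<dots> \<le> ennreal (real n * (\<delta> j / c0))"
      using x w by (intro inverse_image_estimate cs c0 \<delta>_pos T) auto
    also have "\<dots> = ennreal (real n / c0) * emeasure \<nu> (vball w (\<delta> j))"
      unfolding emeasure_vball[OF w] using c0 by (subst ennreal_mult[symmetric]) auto
    finally show ?thesis .
  qed
  have le: "\<mu> \<le> scale_measure (ennreal (real n / c0)) \<nu>"
  proof (subst le_measure)
    show "sets \<mu> = sets (scale_measure (ennreal (real n / c0)) \<nu>)" by (simp add: \<mu>_def)
    show "\<forall>A\<in>sets \<mu>. emeasure \<mu> A \<le> emeasure (scale_measure (ennreal (real n / c0)) \<nu>) A"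
      using measure_le_of_balls[OF fin _ _ balls] c0 by (auto simp: \<mu>_def)
  qed
  have "(\<integral>\<^sup>+y\<in>T. g (?f y) \<partial>\<nu>) = (\<integral>\<^sup>+y. g (?f y) \<partial>restrict_space \<nu> T)"
    using Tsp by (simp add: nn_integral_restrict_space)
  also have "\<dots> = (\<integral>\<^sup>+y. g y \<partial>\<mu>)" unfolding \<mu>_def using g by (intro nn_integral_distr[OF f, symmetric]) simp
  also have "\<dots> \<le> (\<integral>\<^sup>+y. g y \<partial>scale_measure (ennreal (real n / c0)) \<nu>)"
    by (rule nn_integral_mono_measure[OF _ le]) (simp add: \<mu>_def)
  also have "\<dots> = ennreal (real n / c0) * (\<integral>\<^sup>+y. g y \<partial>\<nu>)" by (rule nn_integral_scale_measure[OF g])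
  finally show ?thesis .
qed

lemma translation_invariance:
  assumes w: "w \<in> carrier R" and g: "(g :: 'a \<Rightarrow> ennreal) \<in> borel_measurable \<nu>"
  shows "(\<integral>\<^sup>+x. g (x \<ominus> w) \<partial>\<nu>) = (\<integral>\<^sup>+x. g x \<partial>\<nu>)"
proof -
  have f: "(\<lambda>x. x \<ominus> w) \<in> \<nu> \<rightarrow>\<^sub>M \<nu>"
  proof (rule v_continuous_measurable)
    have "(y \<ominus> w) \<ominus> (x \<ominus> w) = y \<ominus> x" if "x \<in> carrier R" "y \<in> carrier R" for x y
      using that w by algebra
    then show "v_continuous (\<lambda>x. x \<ominus> w)" using w by (auto simp: v_continuous_def)
  qed
  have "distr \<nu> \<nu> (\<lambda>x. x \<ominus> w) = \<nu>"
  proof (rule measure_eqI)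
    fix A assume "A \<in> sets (distr \<nu> \<nu> (\<lambda>x. x \<ominus> w))"
    then have A: "A \<in> sets \<nu>" by simp
    then have Ac: "A \<subseteq> carrier R" using sets.sets_into_space[OF A] by (simp add: space_\<nu>)
    have "(\<lambda>x. x \<ominus> w) -` A \<inter> space \<nu> = (\<lambda>x. w \<oplus> x) ` A"
    proof (intro Set.set_eqI iffI)
      fix x assume x: "x \<in> (\<lambda>x. x \<ominus> w) -` A \<inter> space \<nu>"
      then have xc: "x \<in> carrier R" by (simp add: space_\<nu>)
      have "x = w \<oplus> (x \<ominus> w)" using xc w by algebra
      then show "x \<in> (\<lambda>x. w \<oplus> x) ` A" using x by blast
    next
      fix x assume "x \<in> (\<lambda>x. w \<oplus> x) ` A"
      then obtain a where a: "a \<in> A" "a \<in> carrier R" "x = w \<oplus> a" using Ac by auto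
      have "(w \<oplus> a) \<ominus> w = a" using a(2) w by algebra
      then show "x \<in> (\<lambda>x. x \<ominus> w) -` A \<inter> space \<nu>" using a w by (simp add: space_\<nu>)
    qed
    then show "emeasure (distr \<nu> \<nu> (\<lambda>x. x \<ominus> w)) A = emeasure \<nu> A"
      using \<nu>_translate[OF w A] by (simp add: emeasure_distr[OF f A])
  qed simp
  then show ?thesis using nn_integral_distr[OF f, of g] g by simp
qed

text \<open>
On the ball of radius \<open>\<delta> j\<close> around \<open>q \<in> Q\<close>, membership of \<open>x - P(y)\<close> in a ball of that radius is the same as that of
\<open>q - P(y)\<close>, so the inverse image is a countable union of rectangles.
\<close>

lemma joint_measurable:
  assumes cs: "set cs \<subseteq> carrier R"
  shows "(\<lambda>(x, y). x \<ominus> poly_val cs y) \<in> \<nu> \<Otimes>\<^sub>M restrict_space \<nu> Z \<rightarrow>\<^sub>M \<nu>"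
proof (rule measurable_vballI)
  let ?N = "restrict_space \<nu> Z"
  have sp: "space ?N = Z" using Z_sets sets.sets_into_space by (fastforce simp: space_restrict_space)
  have Zc: "Z \<subseteq> carrier R" by (auto simp: Z_def)
  show "(\<lambda>(x, y). x \<ominus> poly_val cs y) \<in> space (\<nu> \<Otimes>\<^sub>M ?N) \<rightarrow> carrier R"
    using cs Zc by (auto simp: space_pair_measure sp space_\<nu>)
  fix w and j :: nat assume w: "w \<in> carrier R"
  define P where "P = (\<lambda>q. (\<lambda>y. q \<ominus> poly_val cs y) -` vball w (\<delta> j) \<inter> space ?N)"
  have eq: "(\<lambda>(x, y). x \<ominus> poly_val cs y) -` vball w (\<delta> j) \<inter> space (\<nu> \<Otimes>\<^sub>M ?N) = (\<Union>q\<in>Q. vball q (\<delta> j) \<times> P q)"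
  proof (rule Set.set_eqI)
    fix xy :: "'a \<times> 'a"
    obtain x y where xy: "xy = (x, y)" by (cases xy)
    have key: "x \<ominus> poly_val cs y \<in> vball w (\<delta> j) \<longleftrightarrow> q \<ominus> poly_val cs y \<in> vball w (\<delta> j)"
      if c: "q \<in> Q" "x \<in> vball q (\<delta> j)" "y \<in> Z" for q
    proof -
      have cc: "x \<in> carrier R" "q \<in> carrier R" "poly_val cs y \<in> carrier R"
        using c Q_carrier cs Zc by (auto simp: vball_def)
      have "(x \<ominus> poly_val cs y) \<ominus> (q \<ominus> poly_val cs y) = x \<ominus> q" using cc by algebra
      then have "v ((x \<ominus> poly_val cs y) \<ominus> (q \<ominus> poly_val cs y)) \<le> \<delta> j" using c by (simp add: vball_def)
      then have "vball (x \<ominus> poly_val cs y) (\<delta> j) = vball (q \<ominus> poly_val cs y) (\<delta> j)" using cc by (intro vball_eq) auto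
      moreover have "a \<in> vball w (\<delta> j) \<longleftrightarrow> w \<in> vball a (\<delta> j)" if "a \<in> carrier R" for a
        using vball_sym[OF w] vball_sym[OF that] by blast
      ultimately show ?thesis using cc by simp
    qed
    show "xy \<in> (\<lambda>(x, y). x \<ominus> poly_val cs y) -` vball w (\<delta> j) \<inter> space (\<nu> \<Otimes>\<^sub>M ?N) \<longleftrightarrow> xy \<in> (\<Union>q\<in>Q. vball q (\<delta> j) \<times> P q)"
    proof
      assume a: "xy \<in> (\<lambda>(x, y). x \<ominus> poly_val cs y) -` vball w (\<delta> j) \<inter> space (\<nu> \<Otimes>\<^sub>M ?N)"
      then have b: "x \<in> carrier R" "y \<in> Z" "x \<ominus> poly_val cs y \<in> vball w (\<delta> j)"
        by (auto simp: xy space_pair_measure sp space_\<nu>)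
      obtain q where q: "q \<in> Q" "x \<in> vball q (\<delta> j)" using countable_cover[OF b(1)] .
      then have "y \<in> P q" using key b by (simp add: P_def sp)
      then show "xy \<in> (\<Union>q\<in>Q. vball q (\<delta> j) \<times> P q)" using q by (auto simp: xy)
    next
      assume "xy \<in> (\<Union>q\<in>Q. vball q (\<delta> j) \<times> P q)"
      then obtain q where q: "q \<in> Q" "x \<in> vball q (\<delta> j)" "y \<in> P q" by (auto simp: xy)
      then show "xy \<in> (\<lambda>(x, y). x \<ominus> poly_val cs y) -` vball w (\<delta> j) \<inter> space (\<nu> \<Otimes>\<^sub>M ?N)"
        using key[of q] vball_carrier by (auto simp: xy space_pair_measure sp space_\<nu> P_def)
    qed
  qed
  have "P q \<in> sets ?N" if "q \<in> Q" for q
    unfolding P_def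
    by (rule measurable_sets[OF measurable_restrict_space1[OF minus_poly_val_measurable[OF cs]]])
       (use that Q_carrier w \<delta>_pos vball_sets in auto)
  then show "(\<lambda>(x, y). x \<ominus> poly_val cs y) -` vball w (\<delta> j) \<inter> space (\<nu> \<Otimes>\<^sub>M ?N) \<in> sets (\<nu> \<Otimes>\<^sub>M ?N)"
    unfolding eq using Q Q_carrier \<delta>_pos by (intro sets.countable_UN'' pair_measureI vball_sets) auto
qed

end

section \<open>The scales around the critical points\<close>

context padic_haar begin

text \<open>
The factor 2 makes the inequality hold everywhere on \<open>Z\<close> for \<open>k = 0\<close>, because \<open>B\<close> bounds the
derivatives there.  Linear polynomials have no critical points and are left out.
\<close>

definition near_critical :: "nat \<Rightarrow> (nat \<Rightarrow> nat) \<Rightarrow> real \<Rightarrow> (nat \<Rightarrow> 'a list) \<Rightarrow> nat \<Rightarrow> 'a set" where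
  "near_critical m d B cs k =
     {y \<in> Z. \<exists>i\<in>{1..m}. 2 \<le> d i \<and> v (poly_deriv (cs i) y) < 2 * B * 2 powr (- (real k * (real (d i) - 1)))}"

definition scale_const :: "nat \<Rightarrow> (nat \<Rightarrow> nat) \<Rightarrow> real \<Rightarrow> real" where
  "scale_const m d B = B\<^sup>2 * (\<Sum>i=1..m. 2 * (real (d i))\<^sup>2 * 2 ^ d i)"

text \<open>
The derivative of \<open>P\<^sub>i\<close> has degree \<open>d i - 1\<close> and a leading coefficient of absolute value at least
\<open>1 / (d i * B)\<close>, so the sublevel estimate with \<open>\<rho>\<close> a multiple of \<open>2 powr - k\<close> bounds the measure of
\<open>near_critical m d B cs k\<close>.  On the difference of two successive sets of this kind the derivatives have
the lower bounds needed for the change of variables.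
\<close>

lemma averaging_family_instance:
  fixes F :: "nat \<Rightarrow> 'a \<Rightarrow> real"
  assumes m: "1 \<le> m" and d: "\<And>i. i \<in> {1..m} \<Longrightarrow> 1 \<le> d i" and dm: "2 \<le> d m"
    and r: "\<And>i. i \<in> {1..m} \<Longrightarrow> 1 < r i" and r_sum: "(\<Sum>i=1..m. 1 / r i) \<le> 1"
    and B: "1 \<le> B" and v_nat: "\<And>n. 1 \<le> n \<Longrightarrow> 1 / real n \<le> v (add_pow R n \<one>)"
    and cs: "\<And>i. i \<in> {1..m} \<Longrightarrow> set (cs i) \<subseteq> carrier R" "\<And>i. i \<in> {1..m} \<Longrightarrow> length (cs i) = Suc (d i)"
    and coeff: "\<And>i c. i \<in> {1..m} \<Longrightarrow> c \<in> set (cs i) \<Longrightarrow> v c \<le> B"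
    and lead: "\<And>i. i \<in> {1..m} \<Longrightarrow> 1 / B \<le> v (last (cs i))"
    and F_meas: "\<And>i. i \<in> {1..m} \<Longrightarrow> F i \<in> borel_measurable \<nu>"
    and F_nonneg: "\<And>i x. 0 \<le> F i x"
    and F_norm: "\<And>i. i \<in> {1..m} \<Longrightarrow> (\<integral>\<^sup>+x. ennreal (F i x powr r i) \<partial>\<nu>) \<le> 1"
  shows "averaging_family \<nu> (restrict_space \<nu> Z) m d r (scale_const m d B)
     (\<lambda>k. near_critical m d B cs k - near_critical m d B cs (Suc k)) (\<lambda>i x y. x \<ominus> poly_val (cs i) y) F"
proof -
  let ?U = "near_critical m d B cs"
  let ?c = "scale_const m d B"
  let ?N = "restrict_space \<nu> Z"
  have ZZ: "Z \<inter> space \<nu> \<in> sets \<nu>" by auto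
  have Zc: "Z \<subseteq> carrier R" by (auto simp: Z_def)
  have spN: "space ?N = Z" using Zc by (auto simp: space_restrict_space space_\<nu>)
  have m_in: "m \<in> {1..m}" using m by simp
  have term_le: "2 * (real (d i))\<^sup>2 * 2 ^ d i \<le> (\<Sum>i=1..m. 2 * (real (d i))\<^sup>2 * 2 ^ d i)" if "i \<in> {1..m}" for i
    using that by (intro member_le_sum) auto
  have c_ge: "B\<^sup>2 * (2 * (real (d i))\<^sup>2 * 2 ^ d i) \<le> ?c" if "i \<in> {1..m}" for i
    unfolding scale_const_def using term_le[OF that] by (intro mult_left_mono) auto
  have poly_deriv_le: "v (poly_deriv (cs i) y) \<le> B" if i: "i \<in> {1..m}" and y: "y \<in> Z" for i y
  proof -
    have yc: "y \<in> carrier R" "v y \<le> 1" using y by (auto simp: Z_def)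
    have "v (poly_val (deriv_coeffs (cs i)) y) \<le> B"
      using v_coeff_deriv_coeffs_le[OF cs(1)[OF i], of B] coeff[OF i] B
      by (intro v_poly_val_le[OF yc] deriv_coeffs_closed cs i) auto
    then show ?thesis using poly_val_deriv_coeffs[OF yc(1) cs(1)[OF i]] by simp
  qed
  have v_poly_deriv_meas: "(\<lambda>y. v (poly_deriv (cs i) y)) \<in> borel_measurable \<nu>" if i: "i \<in> {1..m}" for i
  proof -
    have "(\<lambda>y. v (poly_val (deriv_coeffs (cs i)) y)) \<in> borel_measurable \<nu>"
      by (intro v_poly_val_measurable deriv_coeffs_closed cs i)
    then show ?thesis
      by (rule measurable_cong[THEN iffD1, rotated]) (simp add: space_\<nu> poly_val_deriv_coeffs[OF _ cs(1)[OF i]])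
  qed
  define V where "V = (\<lambda>k i. {y \<in> Z. v (poly_deriv (cs i) y) < 2 * B * 2 powr (- (real k * (real (d i) - 1)))})"
  define I where "I = {i \<in> {1..m}. 2 \<le> d i}"
  have I: "finite I" "I \<subseteq> {1..m}" by (auto simp: I_def)
  have V_sets: "V k i \<in> sets \<nu>" if "i \<in> {1..m}" for k i
  proof -
    have "V k i = Z \<inter> {y \<in> space \<nu>. v (poly_deriv (cs i) y) < 2 * B * 2 powr (- (real k * (real (d i) - 1)))}"
      using Zc by (auto simp: V_def space_\<nu>)
    also have "\<dots> \<in> sets \<nu>" using v_poly_deriv_meas[OF that] by measurable
    finally show ?thesis .
  qed
  have U_eq: "?U k = (\<Union>i\<in>I. V k i)" for k by (auto simp: near_critical_def V_def I_def)
  have U_sets: "?U k \<in> sets \<nu>" for k unfolding U_eq using I V_sets by (intro sets.finite_UN) blast+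
  have UZ: "?U k \<subseteq> Z" for k by (auto simp: near_critical_def)
  have V_le: "emeasure \<nu> (V k i) \<le> ennreal (B\<^sup>2 * (2 * (real (d i))\<^sup>2 * 2 ^ d i) * 2 powr (- real k))" if i: "i \<in> I" for k i
  proof -
    have i': "i \<in> {1..m}" "2 \<le> d i" using i by (auto simp: I_def)
    define n where "n = d i - 1"
    have n: "1 \<le> n" "d i = Suc n" using i' by (auto simp: n_def)
    define t where "t = 2 powr (- real k)"
    define \<rho> where "\<rho> = 2 * real (d i) * B\<^sup>2 * t"
    define b where "b = 1 / (real (d i) * B)"
    have pos: "0 < t" "0 < b" "0 < \<rho>" using B n by (auto simp: t_def b_def \<rho>_def)
    have lastc: "last (cs i) \<in> carrier R"
      using cs[OF i'(1)] by (metis Suc_not_Zero last_in_set length_0_conv subsetD)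
    have "last (deriv_coeffs (cs i)) = add_pow R (d i) (last (cs i))"
      using last_deriv_coeffs[OF cs(1)[OF i'(1)]] cs(2)[OF i'(1)] n by simp
    also have "\<dots> = add_pow R (d i) \<one> \<otimes> last (cs i)" using lastc by (simp add: add_pow_ldistr)
    finally have "v (last (deriv_coeffs (cs i))) = v (add_pow R (d i) \<one>) * v (last (cs i))"
      using lastc by (simp add: v_mult)
    moreover have "1 / real (d i) * (1 / B) \<le> v (add_pow R (d i) \<one>) * v (last (cs i))"
      using v_nat[of "d i"] lead[OF i'(1)] B n lastc by (intro mult_mono v_nonneg) auto
    ultimately have last: "b \<le> v (last (deriv_coeffs (cs i)))" by (simp add: b_def)
    have "b * (2 * real (d i) * B\<^sup>2) = 2 * B"
      using B i'(2) by (simp add: b_def power2_eq_square)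
    then have "2 * B * t ^ n = b * (2 * real (d i) * B\<^sup>2) * t ^ n" by simp
    also have "2 * real (d i) * B\<^sup>2 \<le> (2 * real (d i) * B\<^sup>2) ^ n"
    proof (rule self_le_power)
      have "1 \<le> B\<^sup>2" using B by (simp add: one_le_power)
      then show "1 \<le> 2 * real (d i) * B\<^sup>2" using n mult_mono[of 1 "2 * real (d i)" 1 "B\<^sup>2"] by simp
    qed (use n in simp)
    finally have key: "2 * B * t ^ n \<le> b * \<rho> ^ n"
      using pos by (simp add: \<rho>_def power_mult_distrib mult_right_mono mult_left_mono mult.assoc)
    have tn: "2 powr (- (real k * (real (d i) - 1))) = t ^ n"
      using n by (simp add: t_def powr_realpow[symmetric] powr_powr)
    have "V k i \<subseteq> {y \<in> Z. v (poly_val (deriv_coeffs (cs i)) y) < b * \<rho> ^ n}"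
      using key Zc unfolding V_def tn by (auto simp: poly_val_deriv_coeffs[OF _ cs(1)[OF i'(1)]] subset_iff)
    moreover have "{y \<in> Z. v (poly_val (deriv_coeffs (cs i)) y) < b * \<rho> ^ n} \<in> sets \<nu>"
    proof -
      have "{y \<in> Z. v (poly_val (deriv_coeffs (cs i)) y) < b * \<rho> ^ n} = Z \<inter> {y \<in> space \<nu>. v (poly_val (deriv_coeffs (cs i)) y) < b * \<rho> ^ n}"
        using Zc by (auto simp: space_\<nu>)
      also have "\<dots> \<in> sets \<nu>" using v_poly_val_measurable[OF deriv_coeffs_closed[OF cs(1)[OF i'(1)]]] by measurable
      finally show ?thesis .
    qed
    ultimately have "emeasure \<nu> (V k i) \<le> emeasure \<nu> {y \<in> Z. v (poly_val (deriv_coeffs (cs i)) y) < b * \<rho> ^ n}"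
      by (rule emeasure_mono)
    also have "\<dots> \<le> ennreal (real n * \<rho>)"
      using cs(2)[OF i'(1)] n pos last by (intro sublevel_estimate deriv_coeffs_closed cs i') auto
    also have "\<dots> \<le> ennreal (B\<^sup>2 * (2 * (real (d i))\<^sup>2 * 2 ^ d i) * 2 powr (- real k))"
    proof (intro ennreal_leI)
      have "real n * \<rho> = (B\<^sup>2 * t) * (2 * (real n * real (d i)))" by (simp add: \<rho>_def)
      also have "\<dots> \<le> (B\<^sup>2 * t) * (2 * (real (d i) * real (d i) * 2 ^ d i))"
      proof (intro mult_left_mono)
        have "real n * real (d i) \<le> real (d i) * real (d i) * 1" using n by (simp add: mult_right_mono)
        also have "\<dots> \<le> real (d i) * real (d i) * 2 ^ d i" by (intro mult_left_mono) auto
        finally show "real n * real (d i) \<le> real (d i) * real (d i) * 2 ^ d i" .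
      qed (use pos in auto)
      finally show "real n * \<rho> \<le> B\<^sup>2 * (2 * (real (d i))\<^sup>2 * 2 ^ d i) * 2 powr (- real k)"
        by (simp add: t_def power2_eq_square ac_simps)
    qed
    finally show ?thesis .
  qed
  have U_le: "emeasure \<nu> (?U k) \<le> ennreal (?c * 2 powr (- real k))" for k
  proof -
    have "emeasure \<nu> (?U k) \<le> (\<Sum>i\<in>I. emeasure \<nu> (V k i))"
      unfolding U_eq using I V_sets by (intro emeasure_subadditive_finite) auto
    also have "\<dots> \<le> (\<Sum>i\<in>I. ennreal (B\<^sup>2 * (2 * (real (d i))\<^sup>2 * 2 ^ d i) * 2 powr (- real k)))"
      by (intro sum_mono V_le)
    also have "\<dots> \<le> (\<Sum>i=1..m. ennreal (B\<^sup>2 * (2 * (real (d i))\<^sup>2 * 2 ^ d i) * 2 powr (- real k)))"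
      using I by (intro sum_mono2) auto
    also have "\<dots> = ennreal (\<Sum>i=1..m. B\<^sup>2 * (2 * (real (d i))\<^sup>2 * 2 ^ d i) * 2 powr (- real k))"
      by (intro sum_ennreal) auto
    also have "(\<Sum>i=1..m. B\<^sup>2 * (2 * (real (d i))\<^sup>2 * 2 ^ d i) * 2 powr (- real k)) = ?c * 2 powr (- real k)"
      by (simp add: scale_const_def sum_distrib_left sum_distrib_right)
    finally show ?thesis .
  qed
  have c1: "1 \<le> ?c"
  proof -
    have "1 * (1 * 1) \<le> B\<^sup>2 * ((2 * (real (d m))\<^sup>2) * 2 ^ d m)"
    proof (intro mult_mono)
      show "1 \<le> B\<^sup>2" using B by (simp add: one_le_power)
      have "1 \<le> (real (d m))\<^sup>2" using dm by (simp add: one_le_power)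
      then show "1 \<le> 2 * (real (d m))\<^sup>2" by linarith
    qed auto
    also have "\<dots> \<le> ?c" by (rule c_ge[OF m_in])
    finally show ?thesis by simp
  qed
  have U0: "?U 0 = Z"
  proof
    show "Z \<subseteq> ?U 0"
    proof
      fix y assume y: "y \<in> Z"
      have "v (poly_deriv (cs m) y) < 2 * B" using poly_deriv_le[OF m_in y] B by simp
      then show "y \<in> ?U 0" using y m_in dm by (auto simp: near_critical_def)
    qed
  qed (rule UZ)
  have S_sets: "?U k - ?U (Suc k) \<in> sets \<nu>" for k using U_sets by auto
  have S_eq: "emeasure ?N A = emeasure \<nu> A" if "A \<subseteq> Z" for A
    using ZZ that by (intro emeasure_restrict_space) auto
  have restr: "(\<integral>\<^sup>+y\<in>A. f y \<partial>?N) = (\<integral>\<^sup>+y\<in>A. f y \<partial>\<nu>)" if "A \<subseteq> Z" for A and f :: "'a \<Rightarrow> ennreal"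
    unfolding nn_integral_restrict_space[OF ZZ]
    using that by (intro nn_integral_cong) (auto split: split_indicator)
  show ?thesis
  proof (rule averaging_family.intro)
    show "sigma_finite_measure \<nu>" by (rule sigma_finite_\<nu>)
    show "prob_space ?N" by (rule prob_spaceI) (simp add: spN S_eq emeasure_Z)
    show "1 \<le> m" by (rule m)
    show "1 \<le> d i" if "i \<in> {1..m}" for i using d[OF that] .
    show "1 < r i" if "i \<in> {1..m}" for i using r[OF that] .
    show "(\<Sum>i=1..m. 1 / r i) \<le> 1" by (rule r_sum)
    show "1 \<le> ?c" by (rule c1)
    show "(\<lambda>(x, y). x \<ominus> poly_val (cs i) y) \<in> \<nu> \<Otimes>\<^sub>M ?N \<rightarrow>\<^sub>M \<nu>" if "i \<in> {1..m}" for i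
      by (rule joint_measurable[OF cs(1)[OF that]])
    show "(\<integral>\<^sup>+x. g (x \<ominus> poly_val (cs i) y) \<partial>\<nu>) = integral\<^sup>N \<nu> g"
      if "i \<in> {1..m}" "g \<in> borel_measurable \<nu>" "y \<in> space ?N" for i and g :: "'a \<Rightarrow> ennreal" and y
      using translation_invariance[OF poly_val_closed[OF cs(1)[OF that(1)]] that(2)] that(3) Zc by (auto simp: spN)
    show "?U k - ?U (Suc k) \<in> sets ?N" for k
      using S_sets UZ ZZ by (subst sets_restrict_space_iff) auto
    show "emeasure ?N (?U k - ?U (Suc k)) \<le> ennreal (?c * 2 powr (- real k))" for k
    proof -
      have "emeasure ?N (?U k - ?U (Suc k)) = emeasure \<nu> (?U k - ?U (Suc k))" using UZ by (intro S_eq) auto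
      also have "\<dots> \<le> emeasure \<nu> (?U k)" using U_sets by (intro emeasure_mono) auto
      also have "\<dots> \<le> ennreal (?c * 2 powr (- real k))" by (rule U_le)
      finally show ?thesis .
    qed
    show "AE y in ?N. \<exists>k. y \<in> ?U k - ?U (Suc k)"
    proof (rule AE_I)
      let ?W = "\<Inter>k. ?U k"
      have W: "?W \<in> sets \<nu>" using U_sets by auto
      show "{y \<in> space ?N. \<not> (\<exists>k. y \<in> ?U k - ?U (Suc k))} \<subseteq> ?W"
      proof
        fix y assume y: "y \<in> {y \<in> space ?N. \<not> (\<exists>k. y \<in> ?U k - ?U (Suc k))}"
        have "y \<in> ?U k" for k
        proof (induction k)
          case 0 then show ?case using y by (simp add: U0 spN)
        next
          case (Suc k) then show ?case using y by auto
        qed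
        then show "y \<in> ?W" by blast
      qed
      have le: "emeasure \<nu> ?W \<le> ennreal (?c * 2 powr (- real k))" for k
      proof -
        have "emeasure \<nu> ?W \<le> emeasure \<nu> (?U k)" using U_sets by (intro emeasure_mono) auto
        also have "\<dots> \<le> ennreal (?c * 2 powr (- real k))" by (rule U_le)
        finally show ?thesis .
      qed
      have "(\<lambda>k. ?c * 2 powr (- real k)) \<longlonglongrightarrow> ?c * 0"
      proof (intro tendsto_mult tendsto_const)
        have "(\<lambda>k. (1 / 2 :: real) ^ k) \<longlonglongrightarrow> 0" by (intro LIMSEQ_power_zero) auto
        then show "(\<lambda>k. 2 powr (- real k)) \<longlonglongrightarrow> (0 :: real)"
          by (simp add: powr_minus powr_realpow power_one_over inverse_eq_divide)
      qed
      then have "(\<lambda>k. ennreal (?c * 2 powr (- real k))) \<longlonglongrightarrow> ennreal 0" by (intro tendsto_ennrealI) simp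
      then have "emeasure \<nu> ?W \<le> ennreal 0" by (rule LIMSEQ_le_const) (use le in auto)
      then have "emeasure \<nu> ?W = 0" by simp
      moreover have WZ: "?W \<subseteq> Z" using UZ by auto
      ultimately show "emeasure ?N ?W = 0" by (simp add: S_eq)
      show "?W \<in> sets ?N" using W WZ ZZ by (subst sets_restrict_space_iff) auto
    qed
    show "(\<integral>\<^sup>+y\<in>?U k - ?U (Suc k). g (x \<ominus> poly_val (cs i) y) \<partial>?N)
        \<le> ennreal (?c * 2 powr (real k * (real (d i) - 1))) * integral\<^sup>N \<nu> g"
      if i: "i \<in> {1..m}" and g: "g \<in> borel_measurable \<nu>" and x: "x \<in> space \<nu>" for i and g :: "'a \<Rightarrow> ennreal" and k x
    proof -
      let ?S = "?U k - ?U (Suc k)"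
      define n where "n = d i - 1"
      have n: "d i = Suc n" using d[OF i] by (simp add: n_def)
      have SZ: "?S \<subseteq> Z" using UZ by auto
      \<comment> \<open>A common lower bound for linear polynomials, whose derivative is at least \<open>1 / B\<close>, and for the others.\<close>
      define c0 where "c0 = 1 / (B * 2 ^ n * 2 powr (real k * real n))"
      have c0: "0 < c0" using B by (simp add: c0_def)
      have lower: "c0 \<le> v (poly_deriv (cs i) y)" if y: "y \<in> ?S" for y
      proof (cases "2 \<le> d i")
        case True
        have "\<not> v (poly_deriv (cs i) y) < 2 * B * 2 powr (- (real (Suc k) * (real (d i) - 1)))"
          using y i True SZ by (auto simp: near_critical_def)
        then have "2 * B * 2 powr (- (real (Suc k) * (real (d i) - 1))) \<le> v (poly_deriv (cs i) y)" by simp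
        moreover have "c0 \<le> 2 * B * 2 powr (- (real (Suc k) * (real (d i) - 1)))"
        proof -
          have "2 powr (- (real (Suc k) * (real (d i) - 1))) = 1 / (2 ^ n * 2 powr (real k * real n))"
          proof -
            have "- (real (Suc k) * (real (d i) - 1)) = - (real n + real k * real n)" by (simp add: n algebra_simps)
            then show ?thesis by (simp only: powr_minus powr_add powr_realpow[symmetric] zero_less_numeral inverse_eq_divide)
          qed
          moreover have "1 / B \<le> 2 * B"
          proof -
            have "1 / B \<le> 1 / 1" using B by (intro divide_left_mono) auto
            then show ?thesis using B by linarith
          qed
          then have "1 / B * (1 / (2 ^ n * 2 powr (real k * real n))) \<le> 2 * B * (1 / (2 ^ n * 2 powr (real k * real n)))"
            by (intro mult_right_mono) auto
          ultimately show ?thesis by (simp add: c0_def mult.assoc)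
        qed
        ultimately show ?thesis by simp
      next
        case False
        then have "n = 0" using n by simp
        then have "length (cs i) = 2" using cs(2)[OF i] n by simp
        then obtain a b where ab: "cs i = [a, b]" by (metis One_nat_def Suc_1 length_0_conv length_Suc_conv)
        have "a \<in> carrier R" "b \<in> carrier R" "y \<in> carrier R" using ab cs(1)[OF i] y SZ Zc by auto
        then have "poly_deriv (cs i) y = b" by (simp add: ab)
        then show ?thesis using lead[OF i] \<open>n = 0\<close> by (simp add: c0_def ab)
      qed
      have "(\<integral>\<^sup>+y\<in>?S. g (x \<ominus> poly_val (cs i) y) \<partial>?N) = (\<integral>\<^sup>+y\<in>?S. g (x \<ominus> poly_val (cs i) y) \<partial>\<nu>)" by (rule restr[OF SZ])
      also have "\<dots> \<le> ennreal (real (d i) / c0) * integral\<^sup>N \<nu> g"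
        using x cs[OF i] by (intro transport_le c0 S_sets SZ lower g) (auto simp: space_\<nu>)
      also have "\<dots> \<le> ennreal (?c * 2 powr (real k * (real (d i) - 1))) * integral\<^sup>N \<nu> g"
      proof (intro mult_right_mono ennreal_leI)
        have "real (d i) / c0 = real (d i) * B * 2 ^ n * 2 powr (real k * (real (d i) - 1))"
          by (simp add: c0_def n)
        also have "real (d i) * B * 2 ^ n \<le> (2 * (real (d i))\<^sup>2) * B\<^sup>2 * 2 ^ d i"
        proof (intro mult_mono)
          have "real (d i) * 1 \<le> real (d i) * (2 * real (d i))" using n by (intro mult_left_mono) auto
          then show "real (d i) \<le> 2 * (real (d i))\<^sup>2" by (simp add: power2_eq_square)
          have "B * 1 \<le> B * B" using B by (intro mult_left_mono) auto
          then show "B \<le> B\<^sup>2" by (simp add: power2_eq_square)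
          show "(2::real) ^ n \<le> 2 ^ d i" using n by (intro power_increasing) auto
        qed (use B in auto)
        also have "\<dots> \<le> ?c" using c_ge[OF i] by (simp add: ac_simps)
        finally show "real (d i) / c0 \<le> ?c * 2 powr (real k * (real (d i) - 1))" by (simp add: mult_right_mono)
      qed auto
      finally show ?thesis .
    qed
    show "F i \<in> borel_measurable \<nu>" if "i \<in> {1..m}" for i using F_meas[OF that] .
    show "0 \<le> F i x" for i x by (rule F_nonneg)
    show "(\<integral>\<^sup>+x. ennreal (F i x powr r i) \<partial>\<nu>) \<le> 1" if "i \<in> {1..m}" for i using F_norm[OF that] .
  qed
qed

end

section \<open>The field of p-adic numbers\<close>

context
  fixes p :: nat
  assumes p: "Factorial_Ring.prime p"
begin

abbreviation nrm :: "rat \<Rightarrow> real" where "nrm \<equiv> rat_padic_abs p"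

lemma p_gt_1: "1 < real p" using prime_gt_1_nat[OF p] by simp

lemma p_int: "Factorial_Ring.prime (int p)" using p by simp

lemma mult_distrib:
  "a \<noteq> 0 \<Longrightarrow> b \<noteq> 0 \<Longrightarrow> multiplicity (int p) (a * b) = multiplicity (int p) a + multiplicity (int p) b"
  using p_int by (intro prime_elem_multiplicity_mult_distrib) auto

lemma nrm_fract:
  assumes "a \<noteq> 0" "b \<noteq> 0"
  shows "nrm (of_int a / of_int b) = real p powi (int (multiplicity (int p) b) - int (multiplicity (int p) a))"
proof -
  let ?x = "of_int a / of_int b :: rat"
  obtain n e where ne: "quotient_of ?x = (n, e)" by (cases "quotient_of ?x")
  have e: "e > 0" using quotient_of_denom_pos[OF ne] .
  have x: "?x = of_int n / of_int e" by (rule quotient_of_div[OF ne])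
  have x0: "?x \<noteq> 0" using assms by simp
  then have n: "n \<noteq> 0" using x by auto
  have "of_int a * of_int e = (of_int n * of_int b :: rat)"
    using x assms e by (simp add: field_simps)
  then have "a * e = n * b" by (simp only: of_int_mult[symmetric] of_int_eq_iff)
  then have "multiplicity (int p) (a * e) = multiplicity (int p) (n * b)" by simp
  then have "multiplicity (int p) a + multiplicity (int p) e = multiplicity (int p) n + multiplicity (int p) b"
    using assms e n by (simp add: mult_distrib)
  then have "int (multiplicity (int p) e) - int (multiplicity (int p) n)
     = int (multiplicity (int p) b) - int (multiplicity (int p) a)" by linarith
  then show ?thesis using x0 ne by (simp add: rat_padic_abs_def)
qed

lemma nrm_0 [simp]: "nrm 0 = 0" by (simp add: rat_padic_abs_def)

lemma rat_as_fract: obtains a b :: int where "(x :: rat) = of_int a / of_int b" "b \<noteq> 0"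
  using quotient_of_div[of x] quotient_of_denom_pos[of x] by (metis less_irrefl surj_pair)

lemma nrm_pos: "x \<noteq> 0 \<Longrightarrow> 0 < nrm x"
  using p_gt_1 by (simp add: rat_padic_abs_def)

lemma nrm_nonneg: "0 \<le> nrm x"
  using nrm_pos[of x] by (cases "x = 0") auto

lemma nrm_values: "nrm x = 0 \<or> (\<exists>n::int. nrm x = real p powi n)"
  by (auto simp: rat_padic_abs_def)

lemma nrm_mult: "nrm (x * y) = nrm x * nrm y"
proof (cases "x = 0 \<or> y = 0")
  case False
  obtain a b where x: "x = of_int a / of_int b" "b \<noteq> 0" by (rule rat_as_fract)
  obtain c d where y: "y = of_int c / of_int d" "d \<noteq> 0" by (rule rat_as_fract)
  have ac: "a \<noteq> 0" "c \<noteq> 0" using False x y by auto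
  have xy: "x * y = of_int (a * c) / of_int (b * d)" using x y by simp
  have "nrm (x * y) = real p powi ((int (multiplicity (int p) b) - int (multiplicity (int p) a))
      + (int (multiplicity (int p) d) - int (multiplicity (int p) c)))"
    unfolding xy using ac x(2) y(2) by (subst nrm_fract) (auto simp: mult_distrib algebra_simps)
  also have "\<dots> = nrm x * nrm y"
    unfolding x y using ac x(2) y(2) p_gt_1 by (simp add: nrm_fract power_int_add)
  finally show ?thesis .
qed auto

lemma nrm_1 [simp]: "nrm 1 = 1" by (simp add: rat_padic_abs_def)

lemma nrm_minus: "nrm (- x) = nrm x"
proof -
  have "nrm (- 1) * nrm (- 1) = 1" by (simp flip: nrm_mult)
  then have "nrm (- 1) = 1" using nrm_nonneg[of "- 1"] by (simp add: square_eq_1_iff)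
  then show ?thesis using nrm_mult[of "- 1" x] by simp
qed

lemma nrm_add: "nrm (x + y) \<le> max (nrm x) (nrm y)"
proof (cases "x = 0 \<or> y = 0 \<or> x + y = 0")
  case False
  obtain a b where x: "x = of_int a / of_int b" "b \<noteq> 0" by (rule rat_as_fract)
  obtain c d where y: "y = of_int c / of_int d" "d \<noteq> 0" by (rule rat_as_fract)
  define a' c' e where "a' = a * d" and "c' = c * b" and "e = b * d"
  have e: "e \<noteq> 0" using x y by (simp add: e_def)
  have x': "x = of_int a' / of_int e" and y': "y = of_int c' / of_int e"
    using x y by (auto simp: a'_def c'_def e_def)
  have s: "x + y = of_int (a' + c') / of_int e" unfolding x' y' by (simp add: add_divide_distrib)
  have nz: "a' \<noteq> 0" "c' \<noteq> 0" "a' + c' \<noteq> 0" using False x' y' s by auto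
  let ?m = "multiplicity (int p)"
  have "int p ^ min (?m a') (?m c') dvd a'" "int p ^ min (?m a') (?m c') dvd c'"
    by (auto intro: multiplicity_dvd')
  then have "int p ^ min (?m a') (?m c') dvd a' + c'" by simp
  then have "min (?m a') (?m c') \<le> ?m (a' + c')"
    using nz p_int by (intro multiplicity_geI) (auto simp: not_prime_unit)
  then have "?m a' \<le> ?m (a' + c') \<or> ?m c' \<le> ?m (a' + c')" by linarith
  then show ?thesis
  proof
    assume "?m a' \<le> ?m (a' + c')"
    then have "nrm (of_int (a' + c') / of_int e) \<le> nrm (of_int a' / of_int e)"
      using nz e p_gt_1 by (subst (1 2) nrm_fract) (auto intro!: power_int_increasing simp del: of_int_add)
    then have "nrm (x + y) \<le> nrm x" unfolding s by (simp only: x')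
    then show ?thesis by simp
  next
    assume "?m c' \<le> ?m (a' + c')"
    then have "nrm (of_int (a' + c') / of_int e) \<le> nrm (of_int c' / of_int e)"
      using nz e p_gt_1 by (subst (1 2) nrm_fract) (auto intro!: power_int_increasing simp del: of_int_add)
    then have "nrm (x + y) \<le> nrm y" unfolding s by (simp only: y')
    then show ?thesis by simp
  qed
qed (use nrm_nonneg in \<open>auto simp: le_max_iff_disj\<close>)

lemma nrm_diff: "nrm (x - y) \<le> max (nrm x) (nrm y)"
  using nrm_add[of x "- y"] by (simp add: nrm_minus)

lemma nrm_diff_commute: "nrm (x - y) = nrm (y - x)"
  using nrm_minus[of "x - y"] by simp

lemma nrm_add_le_sum: "nrm (x + y) \<le> nrm x + nrm y"
  using nrm_add[of x y] nrm_nonneg[of x] nrm_nonneg[of y] by linarith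

lemma abs_nrm_diff_le: "\<bar>nrm x - nrm y\<bar> \<le> nrm (x - y)"
  using nrm_add_le_sum[of "x - y" y] nrm_add_le_sum[of "y - x" x] nrm_diff_commute[of x y] by simp

lemma nrm_of_int_le_1: "nrm (of_int a) \<le> 1"
proof (cases "a = 0")
  case False
  then have "nrm (of_int a / of_int 1) = real p powi (- int (multiplicity (int p) a))"
    by (subst nrm_fract) auto
  also have "\<dots> \<le> real p powi 0" using p_gt_1 by (intro power_int_increasing) auto
  finally show ?thesis by simp
qed simp

lemma nrm_of_int_unit: "\<not> int p dvd a \<Longrightarrow> nrm (of_int a) = 1"
proof -
  assume a: "\<not> int p dvd a"
  then have "a \<noteq> 0" by auto
  then have "nrm (of_int a / of_int 1) = real p powi (- int (multiplicity (int p) a))"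
    by (subst nrm_fract) auto
  then show ?thesis using a by (simp add: not_dvd_imp_multiplicity_0)
qed

lemma nrm_p: "nrm (of_nat p) = 1 / real p"
proof -
  have "nrm (of_int (int p) / of_int 1) = real p powi (- int (multiplicity (int p) (int p)))"
    using p_gt_1 by (subst nrm_fract) auto
  also have "multiplicity (int p) (int p) = 1"
    using p_int by (intro multiplicity_self) (auto simp: not_prime_unit)
  finally show ?thesis by (simp add: power_int_minus divide_inverse)
qed

lemma nrm_power: "nrm (x ^ n) = nrm x ^ n"
  by (induction n) (auto simp: nrm_mult)

lemma nrm_of_int_dvd: "int p dvd a \<Longrightarrow> nrm (of_int a) \<le> 1 / real p"
proof -
  assume "int p dvd a"
  then obtain b where "a = int p * b" by auto
  then have "nrm (of_int a) = nrm (of_nat p) * nrm (of_int b)" by (simp add: nrm_mult[symmetric])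
  also have "\<dots> \<le> (1 / real p) * 1" unfolding nrm_p using p_gt_1 nrm_of_int_le_1[of b] by (intro mult_left_mono) auto
  finally show ?thesis by simp
qed

lemma nrm_of_nat_ge: "1 \<le> n \<Longrightarrow> 1 / real n \<le> nrm (of_nat n)"
proof -
  assume n: "1 \<le> n"
  have "nrm (of_int (int n) / of_int 1) = real p powi (- int (multiplicity (int p) (int n)))"
    using n by (subst nrm_fract) auto
  then have eq: "nrm (of_nat n) = 1 / real p ^ multiplicity (int p) (int n)"
    by (simp add: power_int_minus divide_inverse)
  have "int p ^ multiplicity (int p) (int n) dvd int n" by (rule multiplicity_dvd)
  then have "int p ^ multiplicity (int p) (int n) \<le> int n" using n by (intro zdvd_imp_le) auto
  then have "real p ^ multiplicity (int p) (int n) \<le> real n"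
    by (metis of_int_le_iff of_int_of_nat_eq of_int_power)
  then show ?thesis unfolding eq using p_gt_1 n by (intro divide_left_mono) auto
qed

text \<open>
Write \<open>q\<close> as \<open>u / w\<close> times the \<open>j\<close>-th power of \<open>p\<close> with \<open>w\<close> prime to \<open>p\<close>; the digit is \<open>u\<close> times an inverse of \<open>w\<close>
modulo \<open>p\<close>.
\<close>

lemma digit_exists:
  assumes q: "nrm q \<le> (1 / p) ^ j"
  shows "\<exists>a<p. nrm (q - of_nat a * of_nat p ^ j) \<le> (1 / p) ^ Suc j"
proof -
  have pp: "0 < p" using p_gt_1 by simp
  define q' where "q' = q / of_nat p ^ j"
  have q_eq: "q = q' * of_nat p ^ j" using pp by (simp add: q'_def)
  have Npj: "nrm (of_nat p ^ j) = (1 / p) ^ j" by (simp add: nrm_power nrm_p)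
  have "nrm q' * (1 / p) ^ j \<le> 1 * (1 / p) ^ j" using q unfolding q_eq nrm_mult Npj by simp
  then have q': "nrm q' \<le> 1" using pp by (simp add: mult_le_cancel_right)
  have "\<exists>a<p. nrm (q' - of_nat a) \<le> 1 / p"
  proof (cases "q' = 0")
    case True
    then show ?thesis using pp by (intro exI[of _ 0]) simp
  next
    case False
    obtain u w where uw: "quotient_of q' = (u, w)" by (cases "quotient_of q'")
    have w: "w > 0" "coprime u w" using quotient_of_denom_pos[OF uw] quotient_of_coprime[OF uw] by auto
    have qd: "q' = of_int u / of_int w" by (rule quotient_of_div[OF uw])
    have u: "u \<noteq> 0" using False qd by auto
    have pw: "\<not> int p dvd w"
    proof
      assume d: "int p dvd w"
      then have nu: "\<not> int p dvd u" using w(2) p_int by (meson coprime_common_divisor not_prime_unit)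
      have "nrm (of_int u) = nrm q' * nrm (of_int w)" using w unfolding qd by (simp flip: nrm_mult)
      then have "1 \<le> 1 * (1 / real p)"
        using nrm_of_int_unit[OF nu] nrm_of_int_dvd[OF d] q' nrm_nonneg[of "of_int w"]
        by (metis mult_mono nrm_nonneg zero_le_one)
      then show False using p_gt_1 by simp
    qed
    then have "coprime w (int p)" using p_int by (metis coprime_commute prime_imp_coprime)
    then obtain t t' where t: "t * w + t' * int p = 1" using bezout_int[of w "int p"] by auto
    define a where "a = nat ((u * t) mod int p)"
    have a: "int a = (u * t) mod int p" using pp by (simp add: a_def)
    have "a < p" using pp a by (metis of_nat_0_less_iff of_nat_less_iff pos_mod_bound)
    have d: "int p dvd u - int a * w"
    proof -
      have "u = u * (t * w + t' * int p)" using t by simp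
      also have "\<dots> = u * t * w + int p * (u * t')" by (simp add: algebra_simps)
      also have "u * t = int p * (u * t div int p) + int a" unfolding a by simp
      finally have "u - int a * w = int p * ((u * t div int p) * w + u * t')" by (simp add: algebra_simps)
      then show ?thesis by simp
    qed
    have "(q' - of_nat a) * of_int w = of_int (u - int a * w)"
      using w unfolding qd by (simp add: field_simps)
    then have "nrm (q' - of_nat a) * nrm (of_int w) = nrm (of_int (u - int a * w))" by (metis nrm_mult)
    then have "nrm (q' - of_nat a) \<le> 1 / p" using nrm_of_int_unit[OF pw] nrm_of_int_dvd[OF d] by simp
    then show ?thesis using \<open>a < p\<close> by blast
  qed
  then obtain a where a: "a < p" "nrm (q' - of_nat a) \<le> 1 / p" by blast
  have "q - of_nat a * of_nat p ^ j = (q' - of_nat a) * of_nat p ^ j" by (simp add: q_eq algebra_simps)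
  then have "nrm (q - of_nat a * of_nat p ^ j) = nrm (q' - of_nat a) * (1 / p) ^ j" by (simp add: nrm_mult Npj)
  also have "\<dots> \<le> (1 / p) * (1 / p) ^ j" using a by (intro mult_right_mono) auto
  finally show ?thesis using a(1) by auto
qed

abbreviation CR :: "(nat \<Rightarrow> rat) ring" where "CR \<equiv> padic_Cauchy_ring p"

lemma CR_simps: "carrier CR = {s. padic_Cauchy p s}" "s \<otimes>\<^bsub>CR\<^esub> t = (\<lambda>i. s i * t i)"
  "s \<oplus>\<^bsub>CR\<^esub> t = (\<lambda>i. s i + t i)" "\<one>\<^bsub>CR\<^esub> = (\<lambda>i. 1)" "\<zero>\<^bsub>CR\<^esub> = (\<lambda>i. 0)"
  by (auto simp: padic_Cauchy_ring_def)

lemma Cauchy_bounded: "padic_Cauchy p s \<Longrightarrow> \<exists>K>0. \<forall>i. nrm (s i) \<le> K"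
proof -
  assume "padic_Cauchy p s"
  then obtain M where M: "\<And>i j. i \<ge> M \<Longrightarrow> j \<ge> M \<Longrightarrow> nrm (s i - s j) < 1"
    unfolding padic_Cauchy_def by (metis zero_less_one)
  define K where "K = 1 + (\<Sum>i\<le>M. nrm (s i))"
  have le: "nrm (s i) \<le> (\<Sum>i\<le>M. nrm (s i))" if "i \<le> M" for i
    using that by (intro member_le_sum) (auto simp: nrm_nonneg)
  have "nrm (s i) \<le> K" for i
  proof (cases "i \<le> M")
    case True
    then show ?thesis using le[of i] by (simp add: K_def)
  next
    case False
    have "nrm (s i) \<le> nrm (s i - s M) + nrm (s M)" using nrm_add_le_sum[of "s i - s M" "s M"] by simp
    then show ?thesis using M[of i M] le[of M] False by (simp add: K_def)
  qed
  moreover have "0 < K" unfolding K_def using nrm_nonneg by (simp add: add_pos_nonneg sum_nonneg)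
  ultimately show ?thesis by blast
qed

lemma Cauchy_const: "padic_Cauchy p (\<lambda>i. c)" by (simp add: padic_Cauchy_def)

lemma Cauchy_add: "padic_Cauchy p s \<Longrightarrow> padic_Cauchy p t \<Longrightarrow> padic_Cauchy p (\<lambda>i. s i + t i)"
  unfolding padic_Cauchy_def
proof (intro allI impI)
  fix e :: real
  assume s: "\<forall>e>0. \<exists>M. \<forall>i\<ge>M. \<forall>j\<ge>M. nrm (s i - s j) < e" and t: "\<forall>e>0. \<exists>M. \<forall>i\<ge>M. \<forall>j\<ge>M. nrm (t i - t j) < e" and e: "0 < e"
  obtain M M' where M: "\<forall>i\<ge>M. \<forall>j\<ge>M. nrm (s i - s j) < e" "\<forall>i\<ge>M'. \<forall>j\<ge>M'. nrm (t i - t j) < e"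
    using s t e by meson
  have "nrm (s i + t i - (s j + t j)) < e" if "i \<ge> max M M'" "j \<ge> max M M'" for i j
  proof -
    have "nrm (s i - s j) < e" "nrm (t i - t j) < e" using M that by auto
    then show ?thesis using nrm_add[of "s i - s j" "t i - t j"] by (simp add: algebra_simps)
  qed
  then show "\<exists>M. \<forall>i\<ge>M. \<forall>j\<ge>M. nrm (s i + t i - (s j + t j)) < e" by blast
qed

lemma Cauchy_mult: "padic_Cauchy p s \<Longrightarrow> padic_Cauchy p t \<Longrightarrow> padic_Cauchy p (\<lambda>i. s i * t i)"
proof -
  assume s: "padic_Cauchy p s" and t: "padic_Cauchy p t"
  obtain K where K: "K > 0" "\<And>i. nrm (s i) \<le> K" using Cauchy_bounded[OF s] by auto
  obtain L where L: "L > 0" "\<And>i. nrm (t i) \<le> L" using Cauchy_bounded[OF t] by auto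
  show ?thesis unfolding padic_Cauchy_def
  proof (intro allI impI)
    fix e :: real assume e: "0 < e"
    have "0 < e / L" "0 < e / K" using e K L by auto
    then obtain M M' where M: "\<forall>i\<ge>M. \<forall>j\<ge>M. nrm (s i - s j) < e / L" "\<forall>i\<ge>M'. \<forall>j\<ge>M'. nrm (t i - t j) < e / K"
      using s t unfolding padic_Cauchy_def by meson
    have "nrm (s i * t i - s j * t j) < e" if "i \<ge> max M M'" "j \<ge> max M M'" for i j
    proof -
      have "nrm ((s i - s j) * t i) \<le> nrm (s i - s j) * L"
        unfolding nrm_mult by (intro mult_left_mono L nrm_nonneg)
      also have "\<dots> < e / L * L" using M that L by (intro mult_strict_right_mono) auto
      finally have 1: "nrm ((s i - s j) * t i) < e" using L by simp
      have "nrm (s j * (t i - t j)) \<le> K * nrm (t i - t j)"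
        unfolding nrm_mult by (intro mult_right_mono K nrm_nonneg)
      also have "\<dots> < K * (e / K)" using M that K by (intro mult_strict_left_mono) auto
      finally have 2: "nrm (s j * (t i - t j)) < e" using K by simp
      have "s i * t i - s j * t j = (s i - s j) * t i + s j * (t i - t j)" by (simp add: algebra_simps)
      then show ?thesis using 1 2 nrm_add[of "(s i - s j) * t i" "s j * (t i - t j)"] by simp
    qed
    then show "\<exists>M. \<forall>i\<ge>M. \<forall>j\<ge>M. nrm (s i * t i - s j * t j) < e" by blast
  qed
qed

lemma Cauchy_uminus: "padic_Cauchy p s \<Longrightarrow> padic_Cauchy p (\<lambda>i. - s i)"
  using Cauchy_mult[OF Cauchy_const[of "- 1"], of s] by simp

lemma cring_CR: "cring CR"
proof (rule cringI)
  show "abelian_group CR"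
  proof (rule abelian_groupI)
    fix s assume "s \<in> carrier CR"
    then show "\<exists>t\<in>carrier CR. t \<oplus>\<^bsub>CR\<^esub> s = \<zero>\<^bsub>CR\<^esub>"
      by (intro bexI[of _ "\<lambda>i. - s i"]) (auto simp: CR_simps Cauchy_uminus)
  qed (auto simp: CR_simps Cauchy_add Cauchy_const algebra_simps)
  show "comm_monoid CR"
    by (rule comm_monoidI) (auto simp: CR_simps Cauchy_mult Cauchy_const algebra_simps)
qed (auto simp: CR_simps algebra_simps)

lemma CR_a_inv: "s \<in> carrier CR \<Longrightarrow> \<ominus>\<^bsub>CR\<^esub> s = (\<lambda>i. - s i)"
proof -
  assume s: "s \<in> carrier CR"
  interpret cring CR by (rule cring_CR)
  show ?thesis
    by (rule minus_equality) (use s in \<open>auto simp: CR_simps Cauchy_uminus\<close>)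
qed

lemma null_Cauchy: "s \<in> padic_null p \<Longrightarrow> padic_Cauchy p s"
proof -
  assume s: "s \<in> padic_null p"
  show ?thesis unfolding padic_Cauchy_def
  proof (intro allI impI)
    fix e :: real assume "0 < e"
    then have "eventually (\<lambda>i. nrm (s i) < e) sequentially"
      using s by (intro order_tendstoD(2)[of _ 0]) (auto simp: padic_null_def)
    then obtain M where M: "\<And>i. i \<ge> M \<Longrightarrow> nrm (s i) < e" by (auto simp: eventually_sequentially)
    have "nrm (s i - s j) < e" if "i \<ge> M" "j \<ge> M" for i j
      using nrm_diff[of "s i" "s j"] M[OF that(1)] M[OF that(2)] by simp
    then show "\<exists>M. \<forall>i\<ge>M. \<forall>j\<ge>M. nrm (s i - s j) < e" by blast
  qed
qed

lemma null_ideal: "ideal (padic_null p) CR"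
proof (rule idealI)
  interpret cring CR by (rule cring_CR)
  show "ring CR" by (rule ring_axioms)
  have mult: "(\<lambda>i. x i * a i) \<in> padic_null p" if a: "a \<in> padic_null p" and x: "padic_Cauchy p x" for a x
  proof -
    obtain K where K: "K > 0" "\<And>i. nrm (x i) \<le> K" using Cauchy_bounded[OF x] by auto
    have "(\<lambda>i. K * nrm (a i)) \<longlonglongrightarrow> K * 0" using a unfolding padic_null_def by (intro tendsto_mult) auto
    then have lim: "(\<lambda>i. K * nrm (a i)) \<longlonglongrightarrow> 0" by simp
    have "(\<lambda>i. nrm (x i * a i)) \<longlonglongrightarrow> 0"
      by (rule tendsto_sandwich[OF _ _ tendsto_const lim])
         (auto simp: nrm_mult nrm_nonneg intro!: mult_right_mono K always_eventually)
    then show ?thesis by (simp add: padic_null_def)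
  qed
  show "x \<otimes>\<^bsub>CR\<^esub> a \<in> padic_null p" "a \<otimes>\<^bsub>CR\<^esub> x \<in> padic_null p" if "a \<in> padic_null p" "x \<in> carrier CR" for a x
    using mult[OF that(1), of x] that(2) by (simp_all add: CR_simps mult.commute)
  show "subgroup (padic_null p) (add_monoid CR)"
  proof
    show "padic_null p \<subseteq> carrier (add_monoid CR)" using null_Cauchy by (auto simp: CR_simps)
    show "\<one>\<^bsub>add_monoid CR\<^esub> \<in> padic_null p" by (simp add: CR_simps padic_null_def)
    fix x assume x: "x \<in> padic_null p"
    have "\<ominus>\<^bsub>CR\<^esub> x = (\<lambda>i. - x i)" using x null_Cauchy by (intro CR_a_inv) (simp add: CR_simps)
    then show "inv\<^bsub>add_monoid CR\<^esub> x \<in> padic_null p"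
      using x by (simp add: a_inv_def padic_null_def nrm_minus)
    fix y assume y: "y \<in> padic_null p"
    have "(\<lambda>i. nrm (x i) + nrm (y i)) \<longlonglongrightarrow> 0 + 0" using x y unfolding padic_null_def by (intro tendsto_add) auto
    then have lim: "(\<lambda>i. nrm (x i) + nrm (y i)) \<longlonglongrightarrow> 0" by simp
    have "(\<lambda>i. nrm (x i + y i)) \<longlonglongrightarrow> 0"
      by (rule tendsto_sandwich[OF _ _ tendsto_const lim]) (auto simp: nrm_nonneg nrm_add_le_sum)
    then show "x \<otimes>\<^bsub>add_monoid CR\<^esub> y \<in> padic_null p" by (simp add: CR_simps padic_null_def)
  qed
qed

text \<open>
The p-adic number represented by a Cauchy sequence.
\<close>

definition plim :: "(nat \<Rightarrow> rat) \<Rightarrow> (nat \<Rightarrow> rat) set" where "plim s = padic_null p +>\<^bsub>CR\<^esub> s"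

lemma plim_hom: "ring_hom_cring CR (Qp p) plim"
  using ideal.rcos_ring_hom_cring[OF null_ideal cring_CR] by (simp add: Qp_def plim_def[abs_def])

lemma Qp_cring: "cring (Qp p)"
  using ring_hom_cring.axioms(2)[OF plim_hom] .

lemma Qp_carrierE:
  assumes "x \<in> carrier (Qp p)" obtains s where "padic_Cauchy p s" "x = plim s"
  using assms by (auto simp: Qp_def FactRing_def A_RCOSETS_def' plim_def CR_simps)

lemma plim_carrier: "padic_Cauchy p s \<Longrightarrow> plim s \<in> carrier (Qp p)"
  by (auto simp: Qp_def FactRing_def A_RCOSETS_def' plim_def CR_simps)

lemma plim_add: "padic_Cauchy p s \<Longrightarrow> padic_Cauchy p t \<Longrightarrow> plim s \<oplus>\<^bsub>Qp p\<^esub> plim t = plim (\<lambda>i. s i + t i)"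
proof -
  interpret ring_hom_cring CR "Qp p" plim by (rule plim_hom)
  show "padic_Cauchy p s \<Longrightarrow> padic_Cauchy p t \<Longrightarrow> plim s \<oplus>\<^bsub>Qp p\<^esub> plim t = plim (\<lambda>i. s i + t i)"
    using hom_add[of s t] by (simp add: CR_simps)
qed

lemma plim_mult: "padic_Cauchy p s \<Longrightarrow> padic_Cauchy p t \<Longrightarrow> plim s \<otimes>\<^bsub>Qp p\<^esub> plim t = plim (\<lambda>i. s i * t i)"
proof -
  interpret ring_hom_cring CR "Qp p" plim by (rule plim_hom)
  show "padic_Cauchy p s \<Longrightarrow> padic_Cauchy p t \<Longrightarrow> plim s \<otimes>\<^bsub>Qp p\<^esub> plim t = plim (\<lambda>i. s i * t i)"
    using hom_mult[of s t] by (simp add: CR_simps)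
qed

lemma plim_one: "\<one>\<^bsub>Qp p\<^esub> = plim (\<lambda>i. 1)"
proof -
  interpret ring_hom_cring CR "Qp p" plim by (rule plim_hom)
  show ?thesis using hom_one by (simp add: CR_simps)
qed

lemma plim_zero: "\<zero>\<^bsub>Qp p\<^esub> = plim (\<lambda>i. 0)"
proof -
  interpret ring_hom_cring CR "Qp p" plim by (rule plim_hom)
  show ?thesis using hom_zero by (simp add: CR_simps)
qed

lemma plim_minus: "padic_Cauchy p s \<Longrightarrow> padic_Cauchy p t \<Longrightarrow> plim s \<ominus>\<^bsub>Qp p\<^esub> plim t = plim (\<lambda>i. s i - t i)"
proof -
  assume s: "padic_Cauchy p s" and t: "padic_Cauchy p t"
  interpret ring_hom_cring CR "Qp p" plim by (rule plim_hom)
  have "\<ominus>\<^bsub>Qp p\<^esub> plim t = plim (\<lambda>i. - t i)"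
    using hom_a_inv[of t] CR_a_inv[of t] t by (simp add: CR_simps)
  then show ?thesis unfolding a_minus_def using plim_add[OF s Cauchy_uminus[OF t]] by simp
qed

lemma Cauchy_abs_convergent: "padic_Cauchy p s \<Longrightarrow> \<exists>L. (\<lambda>i. nrm (s i)) \<longlonglongrightarrow> L"
proof -
  assume s: "padic_Cauchy p s"
  have "Cauchy (\<lambda>i. nrm (s i))"
  proof (rule metric_CauchyI)
    fix e :: real assume "0 < e"
    then obtain M where M: "\<And>i j. i \<ge> M \<Longrightarrow> j \<ge> M \<Longrightarrow> nrm (s i - s j) < e"
      using s unfolding padic_Cauchy_def by meson
    have "dist (nrm (s i)) (nrm (s j)) < e" if "i \<ge> M" "j \<ge> M" for i j
      using abs_nrm_diff_le[of "s i" "s j"] M[OF that] by (simp add: dist_real_def)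
    then show "\<exists>M. \<forall>i\<ge>M. \<forall>j\<ge>M. dist (nrm (s i)) (nrm (s j)) < e" by blast
  qed
  then show ?thesis using Cauchy_convergent convergent_def by blast
qed

lemma padic_abs_plim:
  assumes s: "padic_Cauchy p s"
  shows "(\<lambda>i. nrm (s i)) \<longlonglongrightarrow> padic_abs p (plim s)"
proof -
  obtain L where L: "(\<lambda>i. nrm (s i)) \<longlonglongrightarrow> L" using Cauchy_abs_convergent[OF s] by blast
  have mem: "t \<in> plim s \<longleftrightarrow> (\<exists>n\<in>padic_null p. t = (\<lambda>i. n i + s i))" for t
    by (auto simp: plim_def a_r_coset_def' CR_simps)
  have all: "\<forall>t\<in>plim s. (\<lambda>i. nrm (t i)) \<longlonglongrightarrow> L"
  proof
    fix t assume "t \<in> plim s"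
    then obtain n where n: "n \<in> padic_null p" "t = (\<lambda>i. n i + s i)" using mem by blast
    have lim: "(\<lambda>i. nrm (n i)) \<longlonglongrightarrow> 0" using n by (simp add: padic_null_def)
    have "(\<lambda>i. nrm (t i) - nrm (s i)) \<longlonglongrightarrow> 0"
    proof (rule Lim_null_comparison[OF _ lim])
      show "eventually (\<lambda>i. norm (nrm (t i) - nrm (s i)) \<le> nrm (n i)) sequentially"
      proof (intro always_eventually allI)
        fix i
        show "norm (nrm (t i) - nrm (s i)) \<le> nrm (n i)" using abs_nrm_diff_le[of "t i" "s i"] by (simp add: n(2))
      qed
    qed
    then have "(\<lambda>i. (nrm (t i) - nrm (s i)) + nrm (s i)) \<longlonglongrightarrow> 0 + L" by (intro tendsto_add L)
    then show "(\<lambda>i. nrm (t i)) \<longlonglongrightarrow> L" by simp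
  qed
  have "(\<lambda>i. 0) \<in> padic_null p" by (simp add: padic_null_def)
  then have self: "s \<in> plim s" using mem by force
  have "padic_abs p (plim s) = L"
    unfolding padic_abs_def
  proof (rule the_equality)
    show "\<forall>t\<in>plim s. (\<lambda>i. nrm (t i)) \<longlonglongrightarrow> L" by (rule all)
    show "r = L" if "\<forall>t\<in>plim s. (\<lambda>i. nrm (t i)) \<longlonglongrightarrow> r" for r
      using that self L LIMSEQ_unique by blast
  qed
  then show ?thesis using L by simp
qed

lemma padic_abs_const: "padic_abs p (plim (\<lambda>i. q)) = nrm q"
  using padic_abs_plim[OF Cauchy_const[of q]] by (simp add: LIMSEQ_const_iff)

lemma plim_null: "s \<in> padic_null p \<Longrightarrow> plim s = \<zero>\<^bsub>Qp p\<^esub>"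
proof -
  assume s: "s \<in> padic_null p"
  interpret ideal "padic_null p" CR by (rule null_ideal)
  have "plim s = padic_null p" unfolding plim_def using s by (rule a_rcos_const)
  then show ?thesis by (simp add: Qp_def FactRing_def)
qed

lemma Qp_nonarch: "nonarch_ring (Qp p) (padic_abs p)"
proof (intro nonarch_ring.intro nonarch_ring_axioms.intro Qp_cring)
  fix x assume x: "x \<in> carrier (Qp p)"
  obtain s where s: "padic_Cauchy p s" "x = plim s" using Qp_carrierE[OF x] .
  show "0 \<le> padic_abs p x"
    unfolding s(2) by (rule LIMSEQ_le_const[OF padic_abs_plim[OF s(1)]]) (simp add: nrm_nonneg)
  show "padic_abs p x = 0 \<longleftrightarrow> x = \<zero>\<^bsub>Qp p\<^esub>"
  proof
    assume "padic_abs p x = 0"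
    then have "s \<in> padic_null p" using padic_abs_plim[OF s(1)] s(2) by (simp add: padic_null_def)
    then show "x = \<zero>\<^bsub>Qp p\<^esub>" unfolding s(2) by (rule plim_null)
  next
    assume "x = \<zero>\<^bsub>Qp p\<^esub>"
    then show "padic_abs p x = 0" using padic_abs_const[of 0] by (simp add: plim_zero)
  qed
  fix y assume y: "y \<in> carrier (Qp p)"
  obtain t where t: "padic_Cauchy p t" "y = plim t" using Qp_carrierE[OF y] .
  have "(\<lambda>i. nrm (s i * t i)) \<longlonglongrightarrow> padic_abs p x * padic_abs p y"
    unfolding nrm_mult s(2) t(2) by (intro tendsto_mult padic_abs_plim s t)
  moreover have "(\<lambda>i. nrm (s i * t i)) \<longlonglongrightarrow> padic_abs p (x \<otimes>\<^bsub>Qp p\<^esub> y)"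
    unfolding s(2) t(2) plim_mult[OF s(1) t(1)] by (rule padic_abs_plim[OF Cauchy_mult[OF s(1) t(1)]])
  ultimately show "padic_abs p (x \<otimes>\<^bsub>Qp p\<^esub> y) = padic_abs p x * padic_abs p y"
    by (rule LIMSEQ_unique[rotated])
  have "(\<lambda>i. max (nrm (s i)) (nrm (t i))) \<longlonglongrightarrow> max (padic_abs p x) (padic_abs p y)"
    unfolding s(2) t(2) by (intro tendsto_max padic_abs_plim s t)
  moreover have "(\<lambda>i. nrm (s i + t i)) \<longlonglongrightarrow> padic_abs p (x \<oplus>\<^bsub>Qp p\<^esub> y)"
    unfolding s(2) t(2) plim_add[OF s(1) t(1)] by (rule padic_abs_plim[OF Cauchy_add[OF s(1) t(1)]])
  ultimately show "padic_abs p (x \<oplus>\<^bsub>Qp p\<^esub> y) \<le> max (padic_abs p x) (padic_abs p y)"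
    using LIMSEQ_le nrm_add by blast
next
  show "padic_abs p \<one>\<^bsub>Qp p\<^esub> = 1" unfolding plim_one padic_abs_const by simp
qed

text \<open>
The absolute values along a Cauchy sequence with nonzero limit are eventually constant.
\<close>

lemma Qp_values:
  assumes "x \<in> carrier (Qp p)"
  shows "padic_abs p x = 0 \<or> (\<exists>n::int. padic_abs p x = real p powi n)"
proof (cases "padic_abs p x = 0")
  case False
  obtain s where s: "padic_Cauchy p s" "x = plim s" using Qp_carrierE[OF assms] .
  note lim = padic_abs_plim[OF s(1), folded s(2)]
  have L: "0 < padic_abs p x" using False nonarch_ring.v_nonneg[OF Qp_nonarch assms] by simp
  then have "eventually (\<lambda>i. padic_abs p x / 2 < nrm (s i)) sequentially"
    by (intro order_tendstoD(1)[OF lim]) simp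
  then obtain M where M: "\<And>i. i \<ge> M \<Longrightarrow> padic_abs p x / 2 < nrm (s i)" by (auto simp: eventually_sequentially)
  obtain M' where M': "\<And>i j. i \<ge> M' \<Longrightarrow> j \<ge> M' \<Longrightarrow> nrm (s i - s j) < padic_abs p x / 2"
    using s(1) L unfolding padic_Cauchy_def by (metis half_gt_zero)
  define k where "k = max M M'"
  have le: "nrm (s i) \<le> nrm (s j)" if "i \<ge> k" "j \<ge> k" for i j
  proof -
    have "nrm (s i) \<le> max (nrm (s i - s j)) (nrm (s j))" using nrm_add[of "s i - s j" "s j"] by simp
    moreover have "nrm (s i - s j) < nrm (s j)" using M[of j] M'[of i j] that by (simp add: k_def)
    ultimately show ?thesis by simp
  qed
  have "eventually (\<lambda>i. nrm (s i) = nrm (s k)) sequentially"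
    using le by (auto simp: eventually_sequentially intro!: exI[of _ k] antisym)
  then have "(\<lambda>i. nrm (s i)) \<longlonglongrightarrow> nrm (s k)" by (rule tendsto_eventually)
  then have "padic_abs p x = nrm (s k)" using lim LIMSEQ_unique by blast
  then show ?thesis using nrm_values by metis
qed simp

lemma Qp_dense:
  assumes "x \<in> carrier (Qp p)" "0 < e"
  shows "\<exists>q. padic_abs p (x \<ominus>\<^bsub>Qp p\<^esub> plim (\<lambda>i. q)) \<le> e"
proof -
  obtain s where s: "padic_Cauchy p s" "x = plim s" using Qp_carrierE[OF assms(1)] .
  obtain M where M: "\<And>i j. i \<ge> M \<Longrightarrow> j \<ge> M \<Longrightarrow> nrm (s i - s j) < e"
    using s(1) assms(2) unfolding padic_Cauchy_def by meson
  have "padic_Cauchy p (\<lambda>i. s i - s M)" using Cauchy_add[OF s(1) Cauchy_const[of "- s M"]] by simp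
  then have lim: "(\<lambda>i. nrm (s i - s M)) \<longlonglongrightarrow> padic_abs p (plim (\<lambda>i. s i - s M))" by (rule padic_abs_plim)
  have "padic_abs p (plim (\<lambda>i. s i - s M)) \<le> e"
    by (rule LIMSEQ_le_const2[OF lim]) (use M less_imp_le in blast)
  then have "padic_abs p (plim s \<ominus>\<^bsub>Qp p\<^esub> plim (\<lambda>i. s M)) \<le> e"
    using plim_minus[OF s(1) Cauchy_const[of "s M"]] by simp
  then show ?thesis unfolding s(2) by blast
qed

lemma plim_const_minus: "plim (\<lambda>i. q) \<ominus>\<^bsub>Qp p\<^esub> plim (\<lambda>i. q') = plim (\<lambda>i. q - q')"
  by (rule plim_minus[OF Cauchy_const Cauchy_const])

lemma Qp_digits:
  "\<exists>D\<subseteq>carrier (Qp p). finite D \<and> card D = p \<and>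
     (\<forall>x\<in>carrier (Qp p). padic_abs p x \<le> (1 / p) ^ j \<longleftrightarrow> (\<exists>a\<in>D. padic_abs p (x \<ominus>\<^bsub>Qp p\<^esub> a) \<le> (1 / p) ^ Suc j)) \<and>
     (\<forall>a\<in>D. \<forall>b\<in>D. a \<noteq> b \<longrightarrow> (1 / p) ^ Suc j < padic_abs p (a \<ominus>\<^bsub>Qp p\<^esub> b))"
proof -
  interpret nonarch_ring "Qp p" "padic_abs p" by (rule Qp_nonarch)
  define c where "c = (\<lambda>a::nat. plim (\<lambda>i. of_nat a * of_nat p ^ j))"
  have cc: "c a \<in> carrier (Qp p)" for a unfolding c_def by (intro plim_carrier Cauchy_const)
  have pj: "(1 / real p) ^ Suc j < (1 / real p) ^ j" using p_gt_1 by (intro power_strict_decreasing) auto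
  have sep: "(1 / p) ^ Suc j < padic_abs p (c a \<ominus>\<^bsub>Qp p\<^esub> c b)" if "a < p" "b < p" "a \<noteq> b" for a b
  proof -
    have nd: "\<not> int p dvd int a - int b"
    proof
      assume "int p dvd int a - int b"
      then have "\<bar>int p\<bar> \<le> \<bar>int a - int b\<bar>" using that(3) by (intro dvd_imp_le_int) auto
      then show False using that by linarith
    qed
    have "padic_abs p (c a \<ominus>\<^bsub>Qp p\<^esub> c b) = nrm (of_nat a * of_nat p ^ j - of_nat b * of_nat p ^ j)"
      unfolding c_def plim_const_minus padic_abs_const ..
    also have "of_nat a * of_nat p ^ j - of_nat b * of_nat p ^ j = (of_int (int a - int b) * of_nat p ^ j :: rat)"
      by (simp add: algebra_simps)
    also have "nrm \<dots> = (1 / p) ^ j" using nrm_of_int_unit[OF nd] by (simp add: nrm_mult nrm_power nrm_p del: of_int_diff)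
    finally show ?thesis using pj by simp
  qed
  have inj: "inj_on c {..<p}"
  proof (rule inj_onI)
    fix a b assume ab: "a \<in> {..<p}" "b \<in> {..<p}" "c a = c b"
    show "a = b"
    proof (rule ccontr)
      assume "a \<noteq> b"
      have "a < p" "b < p" using ab by auto
      then have "(1 / p) ^ Suc j < padic_abs p (c a \<ominus>\<^bsub>Qp p\<^esub> c b)" using \<open>a \<noteq> b\<close> by (rule sep)
      also have "c a \<ominus>\<^bsub>Qp p\<^esub> c b = \<zero>\<^bsub>Qp p\<^esub>" using ab(3) cc by (simp add: a_minus_def r_neg)
      finally show False using v_zero by (simp add: not_less del: power_Suc)
    qed
  qed
  have cov: "padic_abs p x \<le> (1 / p) ^ j \<longleftrightarrow> (\<exists>a\<in>c ` {..<p}. padic_abs p (x \<ominus>\<^bsub>Qp p\<^esub> a) \<le> (1 / p) ^ Suc j)"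
    if x: "x \<in> carrier (Qp p)" for x
  proof
    assume le: "padic_abs p x \<le> (1 / p) ^ j"
    obtain q where q: "padic_abs p (x \<ominus>\<^bsub>Qp p\<^esub> plim (\<lambda>i. q)) \<le> (1 / p) ^ Suc j"
      using Qp_dense[OF x, of "(1 / p) ^ Suc j"] p_gt_1 by auto
    have hq: "plim (\<lambda>i. q) \<in> carrier (Qp p)" by (intro plim_carrier Cauchy_const)
    have "x \<ominus>\<^bsub>Qp p\<^esub> (x \<ominus>\<^bsub>Qp p\<^esub> plim (\<lambda>i. q)) = plim (\<lambda>i. q)" by (rule minus_minus_cancel[OF x hq])
    then have "padic_abs p (plim (\<lambda>i. q)) \<le> max (padic_abs p x) (padic_abs p (x \<ominus>\<^bsub>Qp p\<^esub> plim (\<lambda>i. q)))"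
      using v_diff[of x "x \<ominus>\<^bsub>Qp p\<^esub> plim (\<lambda>i. q)"] x hq by simp
    also have "\<dots> \<le> (1 / p) ^ j" using le q pj by auto
    finally have "nrm q \<le> (1 / p) ^ j" by (simp add: padic_abs_const)
    then obtain a where a: "a < p" "nrm (q - of_nat a * of_nat p ^ j) \<le> (1 / p) ^ Suc j" using digit_exists by blast
    have "padic_abs p (plim (\<lambda>i. q) \<ominus>\<^bsub>Qp p\<^esub> c a) \<le> (1 / p) ^ Suc j"
      unfolding c_def plim_const_minus padic_abs_const by (rule a(2))
    then have "padic_abs p (x \<ominus>\<^bsub>Qp p\<^esub> c a) \<le> (1 / p) ^ Suc j"
      using v_triangle[OF x hq cc[of a]] q by linarith
    then show "\<exists>a\<in>c ` {..<p}. padic_abs p (x \<ominus>\<^bsub>Qp p\<^esub> a) \<le> (1 / p) ^ Suc j" using a(1) by blast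
  next
    assume "\<exists>a\<in>c ` {..<p}. padic_abs p (x \<ominus>\<^bsub>Qp p\<^esub> a) \<le> (1 / p) ^ Suc j"
    then obtain a where a: "a < p" "padic_abs p (x \<ominus>\<^bsub>Qp p\<^esub> c a) \<le> (1 / p) ^ Suc j" by auto
    have "padic_abs p (c a) = nrm (of_nat a * of_nat p ^ j)" by (simp add: c_def padic_abs_const)
    also have "\<dots> \<le> 1 * (1 / p) ^ j"
      unfolding nrm_mult nrm_power nrm_p using nrm_of_int_le_1[of "int a"] by (intro mult_right_mono) auto
    finally have "padic_abs p (c a) \<le> (1 / p) ^ j" by simp
    moreover have "(x \<ominus>\<^bsub>Qp p\<^esub> c a) \<oplus>\<^bsub>Qp p\<^esub> c a = x" by (rule minus_plus_cancel[OF x cc])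
    then have "padic_abs p x \<le> max (padic_abs p (x \<ominus>\<^bsub>Qp p\<^esub> c a)) (padic_abs p (c a))"
      using v_add[of "x \<ominus>\<^bsub>Qp p\<^esub> c a" "c a"] x cc[of a] by simp
    ultimately show "padic_abs p x \<le> (1 / p) ^ j" using a(2) pj by linarith
  qed
  show ?thesis
  proof (intro exI[of _ "c ` {..<p}"] conjI ballI impI)
    show "c ` {..<p} \<subseteq> carrier (Qp p)" using cc by auto
    show "finite (c ` {..<p})" by simp
    show "card (c ` {..<p}) = p" using card_image[OF inj] by simp
    fix a b assume "a \<in> c ` {..<p}" "b \<in> c ` {..<p}" "a \<noteq> b"
    then show "(1 / p) ^ Suc j < padic_abs p (a \<ominus>\<^bsub>Qp p\<^esub> b)" using sep by blast
  qed (rule cov)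
qed

lemma Qp_nat_ge:
  assumes n: "1 \<le> n"
  shows "1 / real n \<le> padic_abs p (add_pow (Qp p) n \<one>\<^bsub>Qp p\<^esub>)"
proof -
  interpret cring "Qp p" by (rule Qp_cring)
  have "add_pow (Qp p) n \<one>\<^bsub>Qp p\<^esub> = plim (\<lambda>i. of_nat n)"
  proof (induction n)
    case 0
    then show ?case by (simp add: plim_zero)
  next
    case (Suc n)
    have "add_pow (Qp p) (Suc n) \<one>\<^bsub>Qp p\<^esub> = plim (\<lambda>i. of_nat n) \<oplus>\<^bsub>Qp p\<^esub> plim (\<lambda>i. 1)"
      using Suc by (simp add: plim_one)
    also have "\<dots> = plim (\<lambda>i. of_nat n + 1)" by (rule plim_add[OF Cauchy_const Cauchy_const])
    finally show ?case by (simp add: add.commute)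
  qed
  then show ?thesis using nrm_of_nat_ge[OF n] by (simp add: padic_abs_const)
qed

lemma Qp_padic_haar:
  assumes \<nu>: "normalized_haar p \<nu>"
  shows "padic_haar (Qp p) (padic_abs p) p (range (\<lambda>q. plim (\<lambda>i. q))) \<nu>"
proof (intro padic_haar.intro padic_haar_axioms.intro Qp_nonarch)
  show "2 \<le> p" using prime_ge_2_nat[OF p] .
  show "countable (range (\<lambda>q. plim (\<lambda>i. q)))" by simp
  show "range (\<lambda>q. plim (\<lambda>i. q)) \<subseteq> carrier (Qp p)" using plim_carrier Cauchy_const by auto
  show "\<exists>z\<in>range (\<lambda>q. plim (\<lambda>i. q)). padic_abs p (x \<ominus>\<^bsub>Qp p\<^esub> z) \<le> e" if "x \<in> carrier (Qp p)" "0 < e" for x e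
    using Qp_dense[OF that] by auto
  show "space \<nu> = carrier (Qp p)" using \<nu> by (simp add: normalized_haar_def)
  have "{U. padic_open p U} \<subseteq> Pow (carrier (Qp p))" by (auto simp: padic_open_def)
  then show "sets \<nu> = sigma_sets (carrier (Qp p)) {U. U \<subseteq> carrier (Qp p) \<and>
      (\<forall>x\<in>U. \<exists>e>0. \<forall>y\<in>carrier (Qp p). padic_abs p (y \<ominus>\<^bsub>Qp p\<^esub> x) < e \<longrightarrow> y \<in> U)}"
    using \<nu> by (simp add: normalized_haar_def padic_borel_def padic_open_def)
  show "emeasure \<nu> ((\<lambda>x. a \<oplus>\<^bsub>Qp p\<^esub> x) ` E) = emeasure \<nu> E" if "a \<in> carrier (Qp p)" "E \<in> sets \<nu>" for a E
    using \<nu> that by (simp add: normalized_haar_def)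
  show "emeasure \<nu> {x \<in> carrier (Qp p). padic_abs p x \<le> 1} = 1"
    using \<nu> by (simp add: normalized_haar_def Zp_def)
qed (rule Qp_values, assumption, rule Qp_digits)

end

section \<open>Interpolation and the improving estimate\<close>

text \<open>
A bound for the power of the norm, without the root, and pointwise for \<open>q = \<infinity>\<close>: the averages of
normalized functions are bounded everywhere in that case.
\<close>

definition Lq_le :: "'a measure \<Rightarrow> ereal \<Rightarrow> ('a \<Rightarrow> real) \<Rightarrow> real \<Rightarrow> bool" where
  "Lq_le M q u C \<longleftrightarrow> (if q = \<infinity> then \<forall>x\<in>space M. u x \<le> C
     else (\<integral>\<^sup>+x. ennreal (u x powr real_of_ereal q) \<partial>M) \<le> ennreal C)"

text \<open>
The constant \<open>C\<close> is quantified before the measures, the scales and the functions; all that it may depend on is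
\<open>m\<close>, \<open>d\<close>, \<open>r\<close>, \<open>q\<close> and the constant \<open>c\<close> of the averaging family.
\<close>

definition uniform_bound :: "'a itself \<Rightarrow> nat \<Rightarrow> (nat \<Rightarrow> nat) \<Rightarrow> (nat \<Rightarrow> real) \<Rightarrow> real \<Rightarrow> ereal \<Rightarrow> real \<Rightarrow> bool" where
  "uniform_bound T m d r c q C \<longleftrightarrow> (\<forall>(M :: 'a measure) N S \<phi> F u. averaging_family M N m d r c S \<phi> F \<longrightarrow>
     u \<in> borel_measurable M \<longrightarrow> (\<forall>x. 0 \<le> u x) \<longrightarrow>
     (\<forall>x\<in>space M. ennreal (u x) \<le> averaging_family.average N m \<phi> F x) \<longrightarrow> Lq_le M q u C)"

lemma uniform_bound_mono:
  assumes "uniform_bound TYPE('a) m d r c q C" "C \<le> C'"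
  shows "uniform_bound TYPE('a) m d r c q C'"
proof -
  have "Lq_le M q u C'" if "Lq_le M q u C" for M :: "'a measure" and u
    using that assms(2) unfolding Lq_le_def
    by (auto split: if_splits intro: order_trans ennreal_leI)
  then show ?thesis using assms(1) unfolding uniform_bound_def by blast
qed

lemma Lq_le_interpolate:
  assumes p: "0 < p" and q: "ereal p \<le> q" "q \<le> q1" and u: "u \<in> borel_measurable M" "\<And>x. 0 \<le> u x"
    and C: "0 \<le> C" and bp: "Lq_le M (ereal p) u C" and bq: "Lq_le M q1 u C"
  shows "Lq_le M q u (if q = \<infinity> then C else max (C powr (real_of_ereal q - p) * C) (C + C))"
proof (cases "q = \<infinity>")
  case True
  then show ?thesis using q bq by simp
next
  case False
  then obtain q' where q': "q = ereal q'" "p \<le> q'" using q(1) by (cases q) auto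
  have b1: "(\<integral>\<^sup>+x. ennreal (u x powr p) \<partial>M) \<le> ennreal C" using bp by (simp add: Lq_le_def)
  have meas: "(\<lambda>x. ennreal (u x powr s)) \<in> borel_measurable M" for s using u(1) by measurable
  have "(\<integral>\<^sup>+x. ennreal (u x powr q') \<partial>M) \<le> ennreal (max (C powr (q' - p) * C) (C + C))"
  proof (cases "q1 = \<infinity>")
    case True
    then have le: "u x \<le> C" if "x \<in> space M" for x using bq that by (simp add: Lq_le_def)
    have "(\<integral>\<^sup>+x. ennreal (u x powr q') \<partial>M) \<le> (\<integral>\<^sup>+x. ennreal (C powr (q' - p)) * ennreal (u x powr p) \<partial>M)"
    proof (intro nn_integral_mono)
      fix x assume x: "x \<in> space M"
      have "u x powr q' = u x powr (q' - p) * u x powr p" by (simp flip: powr_add)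
      also have "\<dots> \<le> C powr (q' - p) * u x powr p"
        using le[OF x] u(2) q'(2) by (intro mult_right_mono powr_mono2) auto
      finally show "ennreal (u x powr q') \<le> ennreal (C powr (q' - p)) * ennreal (u x powr p)"
        by (simp add: ennreal_mult[symmetric] ennreal_leI)
    qed
    also have "\<dots> = ennreal (C powr (q' - p)) * (\<integral>\<^sup>+x. ennreal (u x powr p) \<partial>M)"
      by (rule nn_integral_cmult[OF meas])
    also have "\<dots> \<le> ennreal (C powr (q' - p)) * ennreal C" by (intro mult_left_mono b1) auto
    also have "\<dots> = ennreal (C powr (q' - p) * C)" using C by (simp add: ennreal_mult)
    finally show ?thesis by (rule order_trans) (intro ennreal_leI max.cobounded1)
  next
    case False
    then obtain q2 where q2: "q1 = ereal q2" "q' \<le> q2" using q(2) q' by (cases q1) auto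
    have b2: "(\<integral>\<^sup>+x. ennreal (u x powr q2) \<partial>M) \<le> ennreal C" using bq by (simp add: Lq_le_def q2)
    have "(\<integral>\<^sup>+x. ennreal (u x powr q') \<partial>M) \<le> (\<integral>\<^sup>+x. ennreal (u x powr p) + ennreal (u x powr q2) \<partial>M)"
    proof (intro nn_integral_mono)
      fix x
      have "u x powr q' \<le> u x powr p + u x powr q2"
      proof (cases "u x \<le> 1")
        case True
        have "u x powr q' \<le> u x powr p" using True u(2)[of x] q'(2) by (intro powr_mono') auto
        then show ?thesis by (simp add: add_increasing2)
      next
        case False
        have "u x powr q' \<le> u x powr q2" using False q2(2) by (intro powr_mono) auto
        then show ?thesis by (simp add: add_increasing)
      qed
      then show "ennreal (u x powr q') \<le> ennreal (u x powr p) + ennreal (u x powr q2)"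
        by (simp add: ennreal_plus[symmetric] ennreal_leI del: ennreal_plus)
    qed
    also have "\<dots> = (\<integral>\<^sup>+x. ennreal (u x powr p) \<partial>M) + (\<integral>\<^sup>+x. ennreal (u x powr q2) \<partial>M)"
      by (rule nn_integral_add[OF meas meas])
    also have "\<dots> \<le> ennreal C + ennreal C" by (intro add_mono b1 b2)
    also have "\<dots> = ennreal (C + C)" using C by (intro ennreal_plus[symmetric])
    finally show ?thesis by (rule order_trans) (intro ennreal_leI max.cobounded2)
  qed
  then show ?thesis by (simp add: Lq_le_def q')
qed

lemma uniform_bound_interpolate:
  assumes p: "0 < p" and q: "ereal p \<le> q" "q \<le> q1"
    and bp: "uniform_bound TYPE('a) m d r c (ereal p) C1" and bq: "uniform_bound TYPE('a) m d r c q1 C2"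
  shows "\<exists>C\<ge>0. uniform_bound TYPE('a) m d r c q C"
proof -
  define C where "C = max 0 (max C1 C2)"
  have C: "0 \<le> C" "C1 \<le> C" "C2 \<le> C" by (auto simp: C_def)
  note bounds = uniform_bound_mono[OF bp C(2)] uniform_bound_mono[OF bq C(3)]
  define C' where "C' = (if q = \<infinity> then C else max (C powr (real_of_ereal q - p) * C) (C + C))"
  have "uniform_bound TYPE('a) m d r c q C'"
    unfolding uniform_bound_def
  proof (intro allI impI)
    fix M :: "'a measure" and N S \<phi> F and u :: "'a \<Rightarrow> real"
    assume a: "averaging_family M N m d r c S \<phi> F" "u \<in> borel_measurable M" "\<forall>x. 0 \<le> u x"
      "\<forall>x\<in>space M. ennreal (u x) \<le> averaging_family.average N m \<phi> F x"
    have "Lq_le M (ereal p) u C" "Lq_le M q1 u C" using bounds a unfolding uniform_bound_def by blast+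
    then show "Lq_le M q u C'" unfolding C'_def using a by (intro Lq_le_interpolate[OF p q _ _ C(1)]) auto
  qed
  moreover have "0 \<le> C'" using C(1) by (auto simp: C'_def le_max_iff_disj)
  ultimately show ?thesis by blast
qed

lemma uniform_bound_trivial: "uniform_bound TYPE('a) m d r c (ereal (p_star m r)) 1"
  unfolding uniform_bound_def Lq_le_def
  by (intro allI impI) (simp, rule averaging_family.trivial_bound, auto)

lemma uniform_bound_sup:
  assumes "K_exp m d r < 1"
  shows "\<exists>C. uniform_bound TYPE('a) m d r c \<infinity> C"
proof (intro exI)
  show "uniform_bound TYPE('a) m d r c \<infinity> (c\<^sup>2 * geo_const (1 - K_exp m d r))"
    unfolding uniform_bound_def Lq_le_def
  proof (intro allI impI, simp, intro ballI)
    fix M :: "'a measure" and N S \<phi> F and u :: "'a \<Rightarrow> real" and x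
    assume fam: "averaging_family M N m d r c S \<phi> F"
      and u: "\<forall>x\<in>space M. ennreal (u x) \<le> averaging_family.average N m \<phi> F x" and x: "x \<in> space M"
    have "ennreal (u x) \<le> ennreal (c\<^sup>2 * geo_const (1 - K_exp m d r))"
      using u x averaging_family.sup_bound[OF fam assms x] order_trans by blast
    then show "u x \<le> c\<^sup>2 * geo_const (1 - K_exp m d r)"
      using geo_const_pos[of "1 - K_exp m d r"] assms by (subst (asm) ennreal_le_iff) auto
  qed
qed

lemma uniform_bound_subcritical:
  assumes "r m \<le> q" "0 < q * (1 - K_exp m d r) + real (d m)"
  shows "\<exists>C. uniform_bound TYPE('a) m d r c (ereal q) C"
  unfolding uniform_bound_def Lq_le_def
  by (intro exI allI impI) (simp, rule averaging_family.subcritical_bound[OF _ _ _ assms], auto)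

lemma uniform_bound_critical:
  assumes "1 < K_exp m d r" "(\<Sum>i=1..m-1. 1 / r i) + 1 / r m < 1" "(\<Sum>i=1..m-1. real (d i) / r i) < 1"
  shows "\<exists>C. uniform_bound TYPE('a) m d r c (ereal (real (d m) / (K_exp m d r - 1))) C"
proof -
  have \<sigma>: "averaging_family.\<sigma> m r = (\<Sum>i=1..m-1. 1 / r i)"
    "averaging_family.\<beta> m d r = (\<Sum>i=1..m-1. (real (d i) - 1) / r i)"
    if "averaging_family M N m d r c S \<phi> F" for M N :: "'a measure" and S \<phi> F
    using averaging_family.\<sigma>_def[OF that] averaging_family.\<beta>_def[OF that] by auto
  have \<sigma>\<beta>: "(\<Sum>i=1..m-1. 1 / r i) + (\<Sum>i=1..m-1. (real (d i) - 1) / r i) < 1"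
    using assms(3) by (simp add: sum.distrib[symmetric] diff_divide_distrib)
  show ?thesis
    unfolding uniform_bound_def Lq_le_def
    by (intro exI allI impI)
       (simp, rule averaging_family.critical_bound[OF _ _ _ assms(1)], use \<sigma> \<sigma>\<beta> assms(2) in auto)
qed

text \<open>
For each admissible \<open>q\<close> some larger exponent is covered by one of the three bounds.  In the subcritical
case this is the maximum of \<open>q\<close> and \<open>r m\<close>, and \<open>r m\<close> is below the endpoint by the hypothesis on the first \<open>m - 1\<close>
exponents.
\<close>

lemma uniform_bound_range:
  assumes m: "2 \<le> m" and d: "\<forall>i\<in>{1..m}. 1 \<le> d i" and r: "\<forall>i\<in>{1..m}. 1 < r i"
    and ps: "1 \<le> p_star m r" and \<kappa>: "(\<Sum>i=1..m-1. real (d i) / r i) < 1"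
    and q: "ereal (p_star m r) \<le> q"
    and range: "q < q_star m d r \<or> (K_exp m d r < 1 \<or> K_exp m d r > 1 \<and> p_star m r > 1) \<and> q \<le> q_star m d r"
  shows "\<exists>C\<ge>0. uniform_bound TYPE('a) m d r c q C"
proof -
  let ?K = "K_exp m d r"
  have split: "{1..m} = insert m {1..m-1}" using m by auto
  have K: "?K = (\<Sum>i=1..m-1. real (d i) / r i) + real (d m) / r m"
    unfolding K_exp_def split using m by (subst sum.insert) auto
  have sr: "(\<Sum>i=1..m. 1 / r i) = (\<Sum>i=1..m-1. 1 / r i) + 1 / r m"
    unfolding split using m by (subst sum.insert) auto
  have m_in: "m \<in> {1..m}" using m by simp
  have rm: "1 < r m" "1 \<le> d m" using r d m_in by auto
  have rm_sub: "0 < r m * (1 - ?K) + real (d m)"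
  proof -
    have "r m * (?K - 1) < r m * (real (d m) / r m)" using K \<kappa> rm by (intro mult_strict_left_mono) auto
    then show ?thesis using rm by (simp add: algebra_simps)
  qed
  have ex: "\<exists>q1 C. q \<le> q1 \<and> uniform_bound TYPE('a) m d r c q1 C"
  proof -
    consider "?K < 1" | "?K \<ge> 1" "q < q_star m d r" | "?K > 1" "p_star m r > 1" "q = q_star m d r"
      using range by fastforce
    then show ?thesis
    proof cases
      case 1
      then show ?thesis using uniform_bound_sup[OF 1] by (intro exI[of _ \<infinity>]) auto
    next
      case 2
      obtain q' where q': "q = ereal q'" using 2(2) q by (cases q) auto
      have "0 < q' * (1 - ?K) + real (d m)"
      proof (cases "?K = 1")
        case True
        then show ?thesis using rm by simp
      next
        case False
        then have "q' < real (d m) / (?K - 1)" using 2 q' by (simp add: q_star_def)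
        then show ?thesis using 2 False by (simp add: field_simps)
      qed
      then have "0 < max q' (r m) * (1 - ?K) + real (d m)" using rm_sub by (simp add: max_def)
      then obtain C where "uniform_bound TYPE('a) m d r c (ereal (max q' (r m))) C"
        using uniform_bound_subcritical[of r m "max q' (r m)" d] by (metis max.cobounded2)
      then show ?thesis using q' by (intro exI[of _ "ereal (max q' (r m))"]) auto
    next
      case 3
      have "(\<Sum>i=1..m. 1 / r i) < 1"
      proof -
        have "0 < (\<Sum>i=1..m. 1 / r i)" using r m by (intro sum_pos) (force+)
        then show ?thesis using 3(2) by (simp add: p_star_def field_simps)
      qed
      then have "(\<Sum>i=1..m-1. 1 / r i) + 1 / r m < 1" by (simp only: sr)
      then obtain C where "uniform_bound TYPE('a) m d r c (ereal (real (d m) / (?K - 1))) C"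
        using uniform_bound_critical[OF 3(1) _ \<kappa>] by blast
      then show ?thesis using 3 by (auto simp: q_star_def)
    qed
  qed
  then obtain q1 C where q1: "q \<le> q1" "uniform_bound TYPE('a) m d r c q1 C" by blast
  show ?thesis using ps by (intro uniform_bound_interpolate[OF _ q q1(1) uniform_bound_trivial q1(2)]) auto
qed

lemma (in padic_haar) eval_eq_poly_val_rev:
  assumes x: "x \<in> carrier R"
  shows "set P \<subseteq> carrier R \<Longrightarrow> eval P x = poly_val (rev P) x"
proof (induction P rule: rev_induct)
  case (snoc b P)
  then have c: "set P \<subseteq> carrier R" "b \<in> carrier R" "poly_val (rev P) x \<in> carrier R" using x by auto
  have "eval (P @ [b]) x = eval P x \<otimes> x \<oplus> b" by (rule eval_append_aux[OF c(1,2) x])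
  also have "\<dots> = b \<oplus> x \<otimes> poly_val (rev P) x" using snoc c x by (simp add: a_comm m_comm)
  finally show ?case by simp
qed simp

lemma normalized_integral_le_1:
  assumes f: "f \<in> Lspace M (ereal s)" and s: "0 < s" and t: "enn2real (Lnorm M (ereal s) f) < t"
  shows "(\<integral>\<^sup>+x. ennreal ((cmod (f x) / t) powr s) \<partial>M) \<le> 1"
proof -
  let ?I = "\<integral>\<^sup>+x. ennreal (cmod (f x) powr s) \<partial>M"
  have t0: "0 < t" using t enn2real_nonneg[of "Lnorm M (ereal s) f"] by linarith
  have [measurable]: "f \<in> borel_measurable M" using f by (simp add: Lspace_def)
  have meas: "(\<lambda>x. ennreal (cmod (f x) powr s)) \<in> borel_measurable M" by measurable
  have "?I \<noteq> \<infinity>" using f by (auto simp: Lspace_def Lnorm_def Let_def)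
  then obtain J where J: "0 \<le> J" "?I = ennreal J" by (cases ?I) auto
  have "Lnorm M (ereal s) f = ennreal (J powr (1 / s))" using J by (simp add: Lnorm_def Let_def)
  then have "J powr (1 / s) < t" using t by simp
  then have "(J powr (1 / s)) powr s \<le> t powr s" using s by (intro powr_mono2) auto
  then have "J \<le> t powr s" using s J by (simp add: powr_powr)
  have "(\<integral>\<^sup>+x. ennreal ((cmod (f x) / t) powr s) \<partial>M) = (\<integral>\<^sup>+x. ennreal (1 / t powr s) * ennreal (cmod (f x) powr s) \<partial>M)"
    using t0 by (intro nn_integral_cong) (simp add: powr_divide ennreal_mult[symmetric])
  also have "\<dots> = ennreal (1 / t powr s) * ?I" by (rule nn_integral_cmult[OF meas])
  also have "\<dots> = ennreal (J / t powr s)" using J by (simp add: ennreal_mult[symmetric])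
  also have "\<dots> \<le> ennreal 1" using \<open>J \<le> t powr s\<close> t0 by (intro ennreal_leI) simp
  finally show ?thesis by simp
qed

lemma Lnorm_le_of_Lq_le:
  assumes g: "g \<in> borel_measurable M" and q: "0 < q" and T: "0 < T" and C: "0 \<le> C"
    and b: "Lq_le M q (\<lambda>x. cmod (g x) / T) C"
  shows "Lnorm M q g \<le> ennreal ((if q = \<infinity> then C else C powr (1 / real_of_ereal q)) * T)"
proof (cases "q = \<infinity>")
  case True
  have "AE x in M. ennreal (cmod (g x)) \<le> ennreal (C * T)"
    using b T True by (intro AE_I2 ennreal_leI) (auto simp: Lq_le_def field_simps)
  then have "esssup M (\<lambda>x. ennreal (cmod (g x))) \<le> ennreal (C * T)"
    using g by (intro esssup_I) auto
  then show ?thesis using True by (simp add: Lnorm_def)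
next
  case False
  then obtain q' where q': "q = ereal q'" "0 < q'" using q by (cases q) auto
  let ?I = "\<integral>\<^sup>+x. ennreal (cmod (g x) powr q') \<partial>M"
  have "?I = (\<integral>\<^sup>+x. ennreal (T powr q') * ennreal ((cmod (g x) / T) powr q') \<partial>M)"
    using T by (intro nn_integral_cong) (simp add: powr_divide ennreal_mult[symmetric])
  also have "\<dots> = ennreal (T powr q') * (\<integral>\<^sup>+x. ennreal ((cmod (g x) / T) powr q') \<partial>M)"
    using g by (intro nn_integral_cmult) measurable
  also have "\<dots> \<le> ennreal (T powr q') * ennreal C" using b by (intro mult_left_mono) (auto simp: Lq_le_def q')
  also have "\<dots> = ennreal (T powr q' * C)" using C by (simp add: ennreal_mult)
  finally have I: "?I \<le> ennreal (T powr q' * C)" .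
  then have fin: "?I \<noteq> \<infinity>" by (auto simp: top_unique)
  have "enn2real ?I \<le> T powr q' * C" using I C by (intro enn2real_leI) auto
  then have "enn2real ?I powr (1 / q') \<le> (T powr q' * C) powr (1 / q')"
    using q' by (intro powr_mono2) auto
  also have "\<dots> = C powr (1 / q') * T" using T q' C by (simp add: powr_mult powr_powr)
  finally show ?thesis using fin q' by (simp add: Lnorm_def Let_def ennreal_leI)
qed

text \<open>
The functions are divided by their norms plus \<open>\<eta> > 0\<close>, and \<open>\<eta>\<close> tends to 0 in the end.  The bound \<open>B\<close> is replaced
by \<open>max 1 B\<close>, which only weakens the hypothesis on the polynomials.
\<close>

lemma improving_boundI:
  assumes m: "2 \<le> m" and d: "\<forall>i\<in>{1..m}. 1 \<le> d i" and dm: "2 \<le> d m" and r: "\<forall>i\<in>{1..m}. 1 < r i"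
    and ps: "1 \<le> p_star m r" and q: "0 < q"
    and bound: "\<And>c. \<exists>C\<ge>0. uniform_bound TYPE((nat \<Rightarrow> rat) set) m d r c q C"
  shows "improving_bound m d r q"
  unfolding improving_bound_def
proof (intro allI impI)
  fix B :: real assume "0 < B"
  define B1 where "B1 = max 1 B"
  have B1: "1 \<le> B1" "B \<le> B1" by (auto simp: B1_def)
  define c where "c = padic_haar.scale_const m d B1"
  obtain C where C: "0 \<le> C" "uniform_bound TYPE((nat \<Rightarrow> rat) set) m d r c q C" using bound by blast
  define C' where "C' = (if q = \<infinity> then C else C powr (1 / real_of_ereal q))"
  have C'0: "0 \<le> C'" using C by (simp add: C'_def)
  show "\<exists>C\<ge>0. \<forall>p \<nu> P f. Factorial_Ring.prime p \<longrightarrow> normalized_haar p \<nu> \<longrightarrow> admissible_polys p m d B P \<longrightarrow>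
        (\<forall>i\<in>{1..m}. f i \<in> Lspace \<nu> (ereal (r i))) \<longrightarrow>
        (AE x in \<nu>. set_integrable \<nu> (Zp p) (avg_integrand p m P f x)) \<and>
        avg p \<nu> m P f \<in> borel_measurable \<nu> \<and>
        Lnorm \<nu> q (avg p \<nu> m P f) \<le> ennreal C * (\<Prod>i=1..m. Lnorm \<nu> (ereal (r i)) (f i))"
  proof (intro exI[of _ C'] conjI C'0 allI impI)
    fix p \<nu> P and f :: "nat \<Rightarrow> (nat \<Rightarrow> rat) set \<Rightarrow> complex"
    assume p: "Factorial_Ring.prime p" and \<nu>: "normalized_haar p \<nu>" and P: "admissible_polys p m d B P"
      and f: "\<forall>i\<in>{1..m}. f i \<in> Lspace \<nu> (ereal (r i))"
    interpret QP: padic_haar "Qp p" "padic_abs p" p "range (\<lambda>q. plim p (\<lambda>i. q))" \<nu>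
      by (rule Qp_padic_haar[OF p \<nu>])
    define cs where "cs = (\<lambda>i. rev (P i))"
    define N where "N = restrict_space \<nu> (Zp p)"
    define S where "S = (\<lambda>k. QP.near_critical m d B1 cs k - QP.near_critical m d B1 cs (Suc k))"
    define \<phi> where "\<phi> = (\<lambda>i x y. x \<ominus>\<^bsub>Qp p\<^esub> QP.poly_val (cs i) y)"
    have Z: "QP.Z = Zp p" by (simp add: QP.Z_def Zp_def)
    have Zs: "Zp p \<in> sets \<nu>" using QP.Z_sets by (simp add: Z)
    have ZZ: "Zp p \<inter> space \<nu> \<in> sets \<nu>" using Zs by auto
    have Zc: "Zp p \<subseteq> carrier (Qp p)" by (auto simp: Zp_def)
    have spN: "space N = Zp p" using Zc by (auto simp: N_def space_restrict_space QP.space_\<nu>)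
    have Pi: "set (P i) \<subseteq> carrier (Qp p)" "length (P i) = Suc (d i)" "P i \<noteq> []" if i: "i \<in> {1..m}" for i
    proof -
      have "polynomial\<^bsub>Qp p\<^esub> (carrier (Qp p)) (P i)"
        using P i by (simp add: admissible_polys_def univ_poly_carrier)
      then show "set (P i) \<subseteq> carrier (Qp p)" by (auto simp: polynomial_def)
      have "length (P i) - 1 = d i" using P i by (simp add: admissible_polys_def)
      then show "length (P i) = Suc (d i)" "P i \<noteq> []" using d i by force+
    qed
    have fam: "averaging_family \<nu> N m d r c S \<phi> F"
      if F: "\<And>i. i \<in> {1..m} \<Longrightarrow> F i \<in> borel_measurable \<nu>" "\<And>i x. 0 \<le> F i x"
        "\<And>i. i \<in> {1..m} \<Longrightarrow> (\<integral>\<^sup>+x. ennreal (F i x powr r i) \<partial>\<nu>) \<le> 1" for F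
      unfolding N_def S_def \<phi>_def c_def Z[symmetric]
    proof (rule QP.averaging_family_instance)
      show "1 \<le> m" using m by simp
      have "0 < (\<Sum>i=1..m. 1 / r i)" using r m by (intro sum_pos) (force+)
      then show "(\<Sum>i=1..m. 1 / r i) \<le> 1" using ps by (simp add: p_star_def field_simps)
      show "1 / real n \<le> padic_abs p (add_pow (Qp p) n \<one>\<^bsub>Qp p\<^esub>)" if "1 \<le> n" for n
        by (rule Qp_nat_ge[OF p that])
      fix i assume i: "i \<in> {1..m}"
      show "set (cs i) \<subseteq> carrier (Qp p)" "length (cs i) = Suc (d i)" using Pi[OF i] by (auto simp: cs_def)
      show "padic_abs p a \<le> B1" if "a \<in> set (cs i)" for a
        using P i that B1 by (force simp: admissible_polys_def cs_def)
      have "1 / B1 \<le> 1 / B" using B1 \<open>0 < B\<close> by (intro divide_left_mono) auto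
      also have "1 / B \<le> padic_abs p (hd (P i))" using P i by (simp add: admissible_polys_def)
      also have "hd (P i) = last (cs i)" using Pi(3)[OF i] by (simp add: cs_def last_rev)
      finally show "1 / B1 \<le> padic_abs p (last (cs i))" .
    qed (use d dm r B1 F in auto)
    define Nm where "Nm = (\<lambda>i. enn2real (Lnorm \<nu> (ereal (r i)) (f i)))"
    have Nm0: "0 \<le> Nm i" for i by (simp add: Nm_def)
    have f_meas: "f i \<in> borel_measurable \<nu>" if "i \<in> {1..m}" for i using f that by (auto simp: Lspace_def)
    define F where "F = (\<lambda>\<eta> i x. cmod (f i x) / (Nm i + \<eta>))"
    define T where "T = (\<lambda>\<eta>. \<Prod>i=1..m. Nm i + \<eta>)"
    have T: "0 < T \<eta>" if "0 < \<eta>" for \<eta> unfolding T_def using that Nm0 by (intro prod_pos) (simp add: add_nonneg_pos)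
    have famF: "averaging_family \<nu> N m d r c S \<phi> (F \<eta>)" if \<eta>: "0 < \<eta>" for \<eta>
    proof (rule fam)
      show "F \<eta> i \<in> borel_measurable \<nu>" if "i \<in> {1..m}" for i using f_meas[OF that] by (simp add: F_def)
      show "0 \<le> F \<eta> i x" for i x using \<eta> Nm0[of i] by (simp add: F_def)
      show "(\<integral>\<^sup>+x. ennreal (F \<eta> i x powr r i) \<partial>\<nu>) \<le> 1" if i: "i \<in> {1..m}" for i
        unfolding F_def
      proof (rule normalized_integral_le_1)
        show "f i \<in> Lspace \<nu> (ereal (r i))" using f i by auto
        show "0 < r i" using r i by force
        show "enn2real (Lnorm \<nu> (ereal (r i)) (f i)) < Nm i + \<eta>" using \<eta> by (simp add: Nm_def)
      qed
    qed
    let ?g = "\<lambda>x y. \<Prod>i=1..m. f i (\<phi> i x y)"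
    have g_eq: "avg_integrand p m P f x y = ?g x y" if "y \<in> Zp p" for x y
      unfolding avg_integrand_def \<phi>_def cs_def
      using that Zc Pi(1) by (intro prod.cong refl) (simp add: QP.eval_eq_poly_val_rev subset_iff)
    have g_joint: "(\<lambda>(x, y). ?g x y) \<in> borel_measurable (\<nu> \<Otimes>\<^sub>M N)"
      using averaging_family.measurable_comp_\<phi>[OF famF[OF zero_less_one] _ f_meas]
      by (simp add: case_prod_beta)
    have g_sec: "?g x \<in> borel_measurable N" if "x \<in> space \<nu>" for x
      using measurable_compose[OF measurable_Pair1'[OF that] g_joint] by simp
    have abs_int: "(\<integral>\<^sup>+y\<in>Zp p. ennreal (cmod (avg_integrand p m P f x y)) \<partial>\<nu>)
        = ennreal (T \<eta>) * averaging_family.average N m \<phi> (F \<eta>) x" if x: "x \<in> space \<nu>" and \<eta>: "0 < \<eta>" for x \<eta>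
    proof -
      have "(\<integral>\<^sup>+y\<in>Zp p. ennreal (cmod (avg_integrand p m P f x y)) \<partial>\<nu>)
          = (\<integral>\<^sup>+y. ennreal (cmod (avg_integrand p m P f x y)) \<partial>N)"
        unfolding N_def by (rule nn_integral_restrict_space[OF ZZ, symmetric])
      also have "\<dots> = (\<integral>\<^sup>+y. ennreal (T \<eta>) * ennreal (\<Prod>i=1..m. F \<eta> i (\<phi> i x y)) \<partial>N)"
      proof (intro nn_integral_cong)
        fix y assume "y \<in> space N"
        then have "cmod (avg_integrand p m P f x y) = (\<Prod>i=1..m. cmod (f i (\<phi> i x y)))"
          by (simp add: g_eq spN prod_norm)
        also have "\<dots> = (\<Prod>i=1..m. (Nm i + \<eta>) * F \<eta> i (\<phi> i x y))"
        proof (intro prod.cong refl)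
          fix i
          have "0 < Nm i + \<eta>" using \<eta> Nm0[of i] by simp
          then show "cmod (f i (\<phi> i x y)) = (Nm i + \<eta>) * F \<eta> i (\<phi> i x y)" by (simp add: F_def)
        qed
        also have "\<dots> = T \<eta> * (\<Prod>i=1..m. F \<eta> i (\<phi> i x y))" by (simp add: T_def prod.distrib)
        finally show "ennreal (cmod (avg_integrand p m P f x y)) = ennreal (T \<eta>) * ennreal (\<Prod>i=1..m. F \<eta> i (\<phi> i x y))"
          using T[OF \<eta>] averaging_family.F_nonneg[OF famF[OF \<eta>]]
          by (simp add: ennreal_mult prod_nonneg)
      qed
      also have "\<dots> = ennreal (T \<eta>) * (\<integral>\<^sup>+y. ennreal (\<Prod>i=1..m. F \<eta> i (\<phi> i x y)) \<partial>N)"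
      proof (rule nn_integral_cmult)
        have "(\<lambda>y. \<Prod>i=1..m. F \<eta> i (\<phi> i x y)) \<in> borel_measurable N"
          using averaging_family.measurable_section_\<phi>[OF famF[OF \<eta>] _ averaging_family.F_meas[OF famF[OF \<eta>]] x]
          by (intro borel_measurable_prod) auto
        then show "(\<lambda>y. ennreal (\<Prod>i=1..m. F \<eta> i (\<phi> i x y))) \<in> borel_measurable N" by simp
      qed
      finally show ?thesis by (simp add: averaging_family.average_def[OF famF[OF \<eta>]])
    qed
    have g_ind: "(\<lambda>y. indicator (Zp p) y *\<^sub>R avg_integrand p m P f x y) \<in> borel_measurable \<nu>" if x: "x \<in> space \<nu>" for x
    proof -
      have "(\<lambda>y. indicator (Zp p) y *\<^sub>R ?g x y) \<in> borel_measurable \<nu>"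
        using g_sec[OF x] borel_measurable_restrict_space_iff[OF ZZ, of "?g x"] by (simp add: N_def)
      moreover have "(\<lambda>y. indicator (Zp p) y *\<^sub>R ?g x y) = (\<lambda>y. indicator (Zp p) y *\<^sub>R avg_integrand p m P f x y)"
        using g_eq by (intro ext) (auto split: split_indicator)
      ultimately show ?thesis by simp
    qed
    have norm_ind: "ennreal (norm (indicator (Zp p) y *\<^sub>R avg_integrand p m P f x y))
        = ennreal (cmod (avg_integrand p m P f x y)) * indicator (Zp p) y" for x y
      by (auto split: split_indicator)
    show "AE x in \<nu>. set_integrable \<nu> (Zp p) (avg_integrand p m P f x)"
      using averaging_family.AE_average_finite[OF famF[OF zero_less_one]] AE_space
    proof (eventually_elim)
      case (elim x)
      have "(\<integral>\<^sup>+y\<in>Zp p. ennreal (cmod (avg_integrand p m P f x y)) \<partial>\<nu>) < \<infinity>"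
        using elim abs_int[of x 1] by (simp add: ennreal_mult_less_top)
      then show ?case
        unfolding set_integrable_def integrable_iff_bounded norm_ind using g_ind elim by simp
    qed
    have avg_eq: "avg p \<nu> m P f x = (\<integral>y. ?g x y \<partial>N)" for x
    proof -
      have "avg p \<nu> m P f x = (\<integral>y. indicator (Zp p) y *\<^sub>R ?g x y \<partial>\<nu>)"
        unfolding avg_def set_lebesgue_integral_def using g_eq
        by (intro Bochner_Integration.integral_cong refl) (auto split: split_indicator)
      then show ?thesis unfolding N_def using integral_restrict_space[OF ZZ, of "?g x"] by simp
    qed
    show avg_meas: "avg p \<nu> m P f \<in> borel_measurable \<nu>"
    proof -
      interpret N: prob_space N using averaging_family.N[OF famF[OF zero_less_one]] by simp
      have "(\<lambda>x. \<integral>y. ?g x y \<partial>N) \<in> borel_measurable \<nu>"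
        by (rule N.borel_measurable_lebesgue_integral[OF g_joint])
      then show ?thesis by (subst avg_eq[abs_def])
    qed
    have avg_le: "ennreal (cmod (avg p \<nu> m P f x) / T \<eta>) \<le> averaging_family.average N m \<phi> (F \<eta>) x"
      if x: "x \<in> space \<nu>" and \<eta>: "0 < \<eta>" for x \<eta>
    proof -
      have "ennreal (cmod (avg p \<nu> m P f x)) \<le> (\<integral>\<^sup>+y\<in>Zp p. ennreal (cmod (avg_integrand p m P f x y)) \<partial>\<nu>)"
      proof (cases "set_integrable \<nu> (Zp p) (avg_integrand p m P f x)")
        case True
        then show ?thesis
          unfolding avg_def set_lebesgue_integral_def set_integrable_def norm_ind[symmetric]
          by (rule integral_norm_bound_ennreal)
      next
        case False
        then show ?thesis
          by (simp add: avg_def set_lebesgue_integral_def set_integrable_def not_integrable_integral_eq)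
      qed
      then have le: "ennreal (cmod (avg p \<nu> m P f x)) \<le> ennreal (T \<eta>) * averaging_family.average N m \<phi> (F \<eta>) x"
        by (simp only: abs_int[OF x \<eta>])
      have "ennreal (cmod (avg p \<nu> m P f x) / T \<eta>) = ennreal (1 / T \<eta>) * ennreal (cmod (avg p \<nu> m P f x))"
        using T[OF \<eta>] by (simp add: ennreal_mult[symmetric])
      also have "\<dots> \<le> ennreal (1 / T \<eta>) * (ennreal (T \<eta>) * averaging_family.average N m \<phi> (F \<eta>) x)"
        by (intro mult_left_mono le) auto
      also have "\<dots> = averaging_family.average N m \<phi> (F \<eta>) x"
        using T[OF \<eta>] by (subst mult.assoc[symmetric], subst ennreal_mult[symmetric]) auto
      finally show ?thesis .
    qed
    have Lq: "Lnorm \<nu> q (avg p \<nu> m P f) \<le> ennreal (C' * T \<eta>)" if \<eta>: "0 < \<eta>" for \<eta>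
    proof -
      have "Lq_le \<nu> q (\<lambda>x. cmod (avg p \<nu> m P f x) / T \<eta>) C"
        using C(2) famF[OF \<eta>] avg_le[OF _ \<eta>] T[OF \<eta>] avg_meas unfolding uniform_bound_def
        by (auto simp: less_imp_le)
      then show ?thesis unfolding C'_def by (rule Lnorm_le_of_Lq_le[OF avg_meas q T[OF \<eta>] C(1)])
    qed
    have "((\<lambda>\<eta>. ennreal (C' * T \<eta>)) \<longlongrightarrow> ennreal (C' * (\<Prod>i=1..m. Nm i + 0))) (at_right 0)"
      unfolding T_def by (intro tendsto_intros)
    then have "Lnorm \<nu> q (avg p \<nu> m P f) \<le> ennreal (C' * (\<Prod>i=1..m. Nm i + 0))"
      by (rule tendsto_lowerbound) (auto simp: eventually_at_right_less intro!: eventually_mono[OF eventually_at_right_less] Lq)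
    also have "\<dots> = ennreal C' * (\<Prod>i=1..m. ennreal (Nm i))"
      using C'0 Nm0 by (simp add: ennreal_mult prod_nonneg prod_ennreal)
    also have "(\<Prod>i=1..m. ennreal (Nm i)) = (\<Prod>i=1..m. Lnorm \<nu> (ereal (r i)) (f i))"
    proof (intro prod.cong refl)
      fix i assume "i \<in> {1..m}"
      then have "Lnorm \<nu> (ereal (r i)) (f i) < \<infinity>" using f by (auto simp: Lspace_def)
      then show "ennreal (Nm i) = Lnorm \<nu> (ereal (r i)) (f i)" unfolding Nm_def by (simp add: less_top)
    qed
    finally show "Lnorm \<nu> q (avg p \<nu> m P f) \<le> ennreal C' * (\<Prod>i=1..m. Lnorm \<nu> (ereal (r i)) (f i))" .
  qed
qed

theorem theorem7p1:
  fixes m :: nat and d :: "nat \<Rightarrow> nat" and r :: "nat \<Rightarrow> real"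
  assumes "2 \<le> m"
    and "\<forall>i\<in>{1..m}. 1 \<le> d i"
    and "\<forall>i\<in>{1..m}. \<forall>j\<in>{1..m}. i \<le> j \<longrightarrow> d i \<le> d j"
    and "2 \<le> d m"
    and "\<forall>i\<in>{1..m}. 1 < r i"
    and "1 \<le> p_star m r"
    and "(\<Sum>i=1..m-1. real (d i) / r i) < 1"
  shows "(\<forall>q. ereal (p_star m r) \<le> q \<and> q < q_star m d r \<longrightarrow> improving_bound m d r q) \<and>
         (K_exp m d r < 1 \<or> (K_exp m d r > 1 \<and> p_star m r > 1) \<longrightarrow>
           (\<forall>q. ereal (p_star m r) \<le> q \<and> q \<le> q_star m d r \<longrightarrow> improving_bound m d r q))"
proof -
  have main: "improving_bound m d r q"
    if q: "ereal (p_star m r) \<le> q"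
      "q < q_star m d r \<or> (K_exp m d r < 1 \<or> K_exp m d r > 1 \<and> p_star m r > 1) \<and> q \<le> q_star m d r" for q
  proof (rule improving_boundI[OF assms(1,2,4,5,6)])
    have "ereal 0 < ereal (p_star m r)" using assms(6) by simp
    from this q(1) have "ereal 0 < q" by (rule less_le_trans)
    then show "0 < q" by (simp add: zero_ereal_def)
    show "\<exists>C\<ge>0. uniform_bound TYPE((nat \<Rightarrow> rat) set) m d r c q C" for c
      by (rule uniform_bound_range[OF assms(1,2,5,6,7) q])
  qed
  then show ?thesis by blast
qed

end
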